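(* Let $\mathcal{M}$ be a model category. Suppose that either $\mathcal{M}$ is fibrantly generated, or $\mathcal{M}$ is cofibrantly generated and all acyclic cofibrations of $\mathcal{M}$ are monomorphisms. Then $\mathcal{M}$ has a fibrant-replacement triple.
   Context: A triple is a monad. A fibrant-replacement triple on a model category $\mathcal{M}$ is a triple $(T,\nu,M)$ on $\mathcal{M}$, with $\nu_X: X\to TX$ and $M_X: T^2X\to TX$, such that for every object $X$ the map $\nu_X$ is a weak equivalence and $TX$ is fibrant ($\nu_X$ is not required to be a cofibration). $\mathcal{M}$ is cofibrantly generated if there are sets $I$ of cofibrations and $J$ of acyclic cofibrations such that the cofibrations are exactly the retracts of relative $I$-cell complexes (transfinite compositions of pushouts of elements of $I$), the acyclic cofibrations are exactly the retracts of relative $J$-cell complexes, and for some regular ordinal $\lambda$ the domains of the elements of $I$ (resp. $J$) are $\lambda$-small relative to the subcategory of cofibrations (resp. acyclic cofibrations). $\mathcal{M}$ is fibrantly generated if the opposite model category $\mathcal{M}^{op}$ is cofibrantly generated. *)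

theory Defs
  imports Main
begin

unbundle cardinal_syntax

section \<open>Categories, functors, monads\<close>

text \<open>
  A category has a set of objects and a set of arrows inside two arbitrary types; all requirements
  are relative to these sets. \<open>g \<cdot> f\<close> is composition in the usual (right-to-left) order.
\<close>

record ('o, 'm) cat =
  Obj :: "'o set"
  Arr :: "'m set"
  Dom :: "'m \<Rightarrow> 'o"
  Cod :: "'m \<Rightarrow> 'o"
  Ide :: "'o \<Rightarrow> 'm"
  Cmp :: "'m \<Rightarrow> 'm \<Rightarrow> 'm"  (infixl \<open>\<cdot>\<index>\<close> 70)

definition hom :: "('o, 'm, 'z) cat_scheme \<Rightarrow> 'o \<Rightarrow> 'o \<Rightarrow> 'm set" where
  "hom C a b = {f \<in> Arr C. Dom C f = a \<and> Cod C f = b}"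

locale category =
  fixes C :: "('o, 'm, 'z) cat_scheme" (structure)
  assumes Dom_Obj: "f \<in> Arr C \<Longrightarrow> Dom C f \<in> Obj C"
    and Cod_Obj: "f \<in> Arr C \<Longrightarrow> Cod C f \<in> Obj C"
    and Ide_hom: "a \<in> Obj C \<Longrightarrow> Ide C a \<in> hom C a a"
    and Cmp_hom: "f \<in> hom C a b \<Longrightarrow> g \<in> hom C b c \<Longrightarrow> g \<cdot> f \<in> hom C a c"
    and Cmp_assoc: "f \<in> hom C a b \<Longrightarrow> g \<in> hom C b c \<Longrightarrow> h \<in> hom C c d
      \<Longrightarrow> (h \<cdot> g) \<cdot> f = h \<cdot> (g \<cdot> f)"
    and Cmp_Ide_right: "f \<in> hom C a b \<Longrightarrow> f \<cdot> Ide C a = f"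
    and Cmp_Ide_left: "f \<in> hom C a b \<Longrightarrow> Ide C b \<cdot> f = f"

definition op_cat :: "('o, 'm, 'z) cat_scheme \<Rightarrow> ('o, 'm, 'z) cat_scheme" where
  "op_cat C = C\<lparr>Dom := Cod C, Cod := Dom C, Cmp := (\<lambda>g f. f \<cdot>\<^bsub>C\<^esub> g)\<rparr>"

record ('o, 'm, 'p, 'n) ftor =
  OMap :: "'o \<Rightarrow> 'p"
  AMap :: "'m \<Rightarrow> 'n"

definition is_functor ::
  "('o, 'm, 'y) cat_scheme \<Rightarrow> ('p, 'n, 'z) cat_scheme \<Rightarrow> ('o, 'm, 'p, 'n) ftor \<Rightarrow> bool" where
  "is_functor A B F \<longleftrightarrow> category A \<and> category B \<and>
     (\<forall>a \<in> Obj A. OMap F a \<in> Obj B) \<and>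
     (\<forall>u \<in> Arr A. AMap F u \<in> hom B (OMap F (Dom A u)) (OMap F (Cod A u))) \<and>
     (\<forall>a \<in> Obj A. AMap F (Ide A a) = Ide B (OMap F a)) \<and>
     (\<forall>u \<in> Arr A. \<forall>v \<in> Arr A. Cod A u = Dom A v \<longrightarrow>
        AMap F (v \<cdot>\<^bsub>A\<^esub> u) = AMap F v \<cdot>\<^bsub>B\<^esub> AMap F u)"

definition id_ftor :: "('o, 'm, 'o, 'm) ftor" where
  "id_ftor = \<lparr>OMap = (\<lambda>a. a), AMap = (\<lambda>u. u)\<rparr>"

definition comp_ftor ::
  "('p, 'n, 'q, 'k) ftor \<Rightarrow> ('o, 'm, 'p, 'n) ftor \<Rightarrow> ('o, 'm, 'q, 'k) ftor" where
  "comp_ftor G F = \<lparr>OMap = OMap G \<circ> OMap F, AMap = AMap G \<circ> AMap F\<rparr>"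

definition is_nat_trans ::
  "('o, 'm, 'y) cat_scheme \<Rightarrow> ('p, 'n, 'z) cat_scheme \<Rightarrow> ('o, 'm, 'p, 'n) ftor \<Rightarrow>
   ('o, 'm, 'p, 'n) ftor \<Rightarrow> ('o \<Rightarrow> 'n) \<Rightarrow> bool" where
  "is_nat_trans A B F G t \<longleftrightarrow> is_functor A B F \<and> is_functor A B G \<and>
     (\<forall>a \<in> Obj A. t a \<in> hom B (OMap F a) (OMap G a)) \<and>
     (\<forall>u \<in> Arr A. t (Cod A u) \<cdot>\<^bsub>B\<^esub> AMap F u = AMap G u \<cdot>\<^bsub>B\<^esub> t (Dom A u))"

definition is_triple ::
  "('o, 'm, 'z) cat_scheme \<Rightarrow> ('o, 'm, 'o, 'm) ftor \<Rightarrow> ('o \<Rightarrow> 'm) \<Rightarrow> ('o \<Rightarrow> 'm) \<Rightarrow> bool" where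
  "is_triple C T \<nu> \<mu> \<longleftrightarrow>
     is_nat_trans C C id_ftor T \<nu> \<and>
     is_nat_trans C C (comp_ftor T T) T \<mu> \<and>
     (\<forall>a \<in> Obj C.
        \<mu> a \<cdot>\<^bsub>C\<^esub> AMap T (\<mu> a) = \<mu> a \<cdot>\<^bsub>C\<^esub> \<mu> (OMap T a) \<and>
        \<mu> a \<cdot>\<^bsub>C\<^esub> AMap T (\<nu> a) = Ide C (OMap T a) \<and>
        \<mu> a \<cdot>\<^bsub>C\<^esub> \<nu> (OMap T a) = Ide C (OMap T a))"

definition monic :: "('o, 'm, 'z) cat_scheme \<Rightarrow> 'm \<Rightarrow> bool" where
  "monic C f \<longleftrightarrow> f \<in> Arr C \<and>
     (\<forall>x. \<forall>g \<in> hom C x (Dom C f). \<forall>h \<in> hom C x (Dom C f). f \<cdot>\<^bsub>C\<^esub> g = f \<cdot>\<^bsub>C\<^esub> h \<longrightarrow> g = h)"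

definition terminal :: "('o, 'm, 'z) cat_scheme \<Rightarrow> 'o \<Rightarrow> bool" where
  "terminal C t \<longleftrightarrow> t \<in> Obj C \<and> (\<forall>a \<in> Obj C. \<exists>!f. f \<in> hom C a t)"

definition is_retract :: "('o, 'm, 'z) cat_scheme \<Rightarrow> 'm \<Rightarrow> 'm \<Rightarrow> bool" where
  "is_retract C f g \<longleftrightarrow> f \<in> Arr C \<and> g \<in> Arr C \<and>
     (\<exists>i \<in> hom C (Dom C f) (Dom C g). \<exists>j \<in> hom C (Cod C f) (Cod C g).
      \<exists>r \<in> hom C (Dom C g) (Dom C f). \<exists>s \<in> hom C (Cod C g) (Cod C f).
        j \<cdot>\<^bsub>C\<^esub> f = g \<cdot>\<^bsub>C\<^esub> i \<and> s \<cdot>\<^bsub>C\<^esub> g = f \<cdot>\<^bsub>C\<^esub> r \<and>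
        r \<cdot>\<^bsub>C\<^esub> i = Ide C (Dom C f) \<and> s \<cdot>\<^bsub>C\<^esub> j = Ide C (Cod C f))"

definition has_lift :: "('o, 'm, 'z) cat_scheme \<Rightarrow> 'm \<Rightarrow> 'm \<Rightarrow> bool" where
  "has_lift C i p \<longleftrightarrow>
     (\<forall>u \<in> hom C (Dom C i) (Dom C p). \<forall>v \<in> hom C (Cod C i) (Cod C p).
        p \<cdot>\<^bsub>C\<^esub> u = v \<cdot>\<^bsub>C\<^esub> i \<longrightarrow>
        (\<exists>h \<in> hom C (Cod C i) (Dom C p). h \<cdot>\<^bsub>C\<^esub> i = u \<and> p \<cdot>\<^bsub>C\<^esub> h = v))"

text \<open>\<open>k\<close> is the pushout of \<open>i\<close> along \<open>f\<close>, with \<open>g\<close> the other leg: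
  \<open>k \<cdot> f = g \<cdot> i\<close>.\<close>

definition is_pushout :: "('o, 'm, 'z) cat_scheme \<Rightarrow> 'm \<Rightarrow> 'm \<Rightarrow> 'm \<Rightarrow> 'm \<Rightarrow> bool" where
  "is_pushout C i f g k \<longleftrightarrow>
     {i, f, g, k} \<subseteq> Arr C \<and> Dom C i = Dom C f \<and> Dom C g = Cod C i \<and> Dom C k = Cod C f \<and>
     Cod C g = Cod C k \<and> k \<cdot>\<^bsub>C\<^esub> f = g \<cdot>\<^bsub>C\<^esub> i \<and>
     (\<forall>x. \<forall>u \<in> hom C (Cod C i) x. \<forall>v \<in> hom C (Cod C f) x. v \<cdot>\<^bsub>C\<^esub> f = u \<cdot>\<^bsub>C\<^esub> i \<longrightarrow>
        (\<exists>!w. w \<in> hom C (Cod C k) x \<and> w \<cdot>\<^bsub>C\<^esub> g = u \<and> w \<cdot>\<^bsub>C\<^esub> k = v))"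

definition pushouts_of :: "('o, 'm, 'z) cat_scheme \<Rightarrow> 'm set \<Rightarrow> 'm set" where
  "pushouts_of C S = {k. \<exists>i \<in> S. \<exists>f g. is_pushout C i f g k}"


section \<open>Size, limits and colimits\<close>

text \<open>
  The distinction between sets and classes is expressed by a regular infinite cardinal \<open>\<kappa>\<close>,
  given (as in the library) by a well-order on some type \<open>'u\<close>: \<^emph>\<open>small\<close> means of
  cardinality less than \<open>\<kappa>\<close>. For an inaccessible \<open>\<kappa>\<close> this is
  smallness in a Grothendieck universe; only regularity is demanded, as HOL does not prove that
  uncountable inaccessibles exist. Every small set has
  a copy inside \<open>'u\<close>, so small index categories and ordinals may be taken to live on \<open>'u\<close>.
\<close>

definition regular_cardinal :: "'u rel \<Rightarrow> bool" where
  "regular_cardinal r \<longleftrightarrow> Cinfinite r \<and> regularCard r"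

definition small :: "'u rel \<Rightarrow> 'a set \<Rightarrow> bool" where
  "small \<kappa> A \<longleftrightarrow> |A| <o \<kappa>"

definition is_cocone ::
  "('j, 'k, 'y) cat_scheme \<Rightarrow> ('o, 'm, 'z) cat_scheme \<Rightarrow> ('j, 'k, 'o, 'm) ftor \<Rightarrow>
   'o \<Rightarrow> ('j \<Rightarrow> 'm) \<Rightarrow> bool" where
  "is_cocone J C D x c \<longleftrightarrow> x \<in> Obj C \<and>
     (\<forall>j \<in> Obj J. c j \<in> hom C (OMap D j) x) \<and>
     (\<forall>u \<in> Arr J. c (Cod J u) \<cdot>\<^bsub>C\<^esub> AMap D u = c (Dom J u))"

definition is_colimit ::
  "('j, 'k, 'y) cat_scheme \<Rightarrow> ('o, 'm, 'z) cat_scheme \<Rightarrow> ('j, 'k, 'o, 'm) ftor \<Rightarrow>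
   'o \<Rightarrow> ('j \<Rightarrow> 'm) \<Rightarrow> bool" where
  "is_colimit J C D x c \<longleftrightarrow> is_functor J C D \<and> is_cocone J C D x c \<and>
     (\<forall>y d. is_cocone J C D y d \<longrightarrow>
        (\<exists>!h. h \<in> hom C x y \<and> (\<forall>j \<in> Obj J. h \<cdot>\<^bsub>C\<^esub> c j = d j)))"

definition is_limit ::
  "('j, 'k, 'y) cat_scheme \<Rightarrow> ('o, 'm, 'z) cat_scheme \<Rightarrow> ('j, 'k, 'o, 'm) ftor \<Rightarrow>
   'o \<Rightarrow> ('j \<Rightarrow> 'm) \<Rightarrow> bool" where
  "is_limit J C D x c \<longleftrightarrow> is_colimit (op_cat J) (op_cat C) D x c"

definition cocomplete :: "'u rel \<Rightarrow> ('o, 'm, 'z) cat_scheme \<Rightarrow> bool" where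
  "cocomplete \<kappa> C \<longleftrightarrow>
     (\<forall>(J :: ('u, 'u) cat) D. small \<kappa> (Arr J) \<and> is_functor J C D \<longrightarrow>
        (\<exists>x c. is_colimit J C D x c))"

definition complete_cat :: "'u rel \<Rightarrow> ('o, 'm, 'z) cat_scheme \<Rightarrow> bool" where
  "complete_cat \<kappa> C \<longleftrightarrow>
     (\<forall>(J :: ('u, 'u) cat) D. small \<kappa> (Arr J) \<and> is_functor J C D \<longrightarrow>
        (\<exists>x c. is_limit J C D x c))"


section \<open>Model categories\<close>

record ('o, 'm) model_cat = "('o, 'm) cat" +
  Weq :: "'m set"
  Cof :: "'m set"
  Fib :: "'m set"

text \<open>Quillen's axioms for a closed model category, with all small limits and colimits;
  factorizations are not required to be functorial.\<close>

locale model_category = category M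
  for \<kappa> :: "'u rel" and M :: "('o, 'm, 'z) model_cat_scheme" (structure) +
  assumes classes: "Weq M \<subseteq> Arr M" "Cof M \<subseteq> Arr M" "Fib M \<subseteq> Arr M"
    and locally_small: "a \<in> Obj M \<Longrightarrow> b \<in> Obj M \<Longrightarrow> small \<kappa> (hom M a b)"
    and limits: "complete_cat \<kappa> M"
    and colimits: "cocomplete \<kappa> M"
    and two_of_three: "f \<in> hom M a b \<Longrightarrow> g \<in> hom M b c \<Longrightarrow>
        (f \<in> Weq M \<and> g \<in> Weq M \<longrightarrow> g \<cdot> f \<in> Weq M) \<and>
        (f \<in> Weq M \<and> g \<cdot> f \<in> Weq M \<longrightarrow> g \<in> Weq M) \<and>
        (g \<in> Weq M \<and> g \<cdot> f \<in> Weq M \<longrightarrow> f \<in> Weq M)"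
    and retracts: "is_retract M f g \<Longrightarrow>
        (g \<in> Weq M \<longrightarrow> f \<in> Weq M) \<and> (g \<in> Cof M \<longrightarrow> f \<in> Cof M) \<and> (g \<in> Fib M \<longrightarrow> f \<in> Fib M)"
    and lifting: "i \<in> Cof M \<Longrightarrow> p \<in> Fib M \<Longrightarrow> i \<in> Weq M \<or> p \<in> Weq M \<Longrightarrow> has_lift M i p"
    and factorization_acof: "f \<in> hom M a b \<Longrightarrow>
        \<exists>x. \<exists>i \<in> hom M a x. \<exists>p \<in> hom M x b. i \<in> Cof M \<inter> Weq M \<and> p \<in> Fib M \<and> f = p \<cdot> i"
    and factorization_afib: "f \<in> hom M a b \<Longrightarrow>
        \<exists>x. \<exists>i \<in> hom M a x. \<exists>p \<in> hom M x b. i \<in> Cof M \<and> p \<in> Fib M \<inter> Weq M \<and> f = p \<cdot> i"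

definition op_model :: "('o, 'm, 'z) model_cat_scheme \<Rightarrow> ('o, 'm, 'z) model_cat_scheme" where
  "op_model M = (op_cat M)\<lparr>Cof := Fib M, Fib := Cof M\<rparr>"

definition fibrant :: "('o, 'm, 'z) model_cat_scheme \<Rightarrow> 'o \<Rightarrow> bool" where
  "fibrant M a \<longleftrightarrow> a \<in> Obj M \<and> (\<exists>t. terminal M t \<and> (\<exists>f \<in> hom M a t. f \<in> Fib M))"

definition fibrant_replacement_triple ::
  "('o, 'm, 'z) model_cat_scheme \<Rightarrow> ('o, 'm, 'o, 'm) ftor \<Rightarrow> ('o \<Rightarrow> 'm) \<Rightarrow> ('o \<Rightarrow> 'm) \<Rightarrow> bool" where
  "fibrant_replacement_triple M T \<nu> \<mu> \<longleftrightarrow> is_triple M T \<nu> \<mu> \<and>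
     (\<forall>a \<in> Obj M. \<nu> a \<in> Weq M \<and> fibrant M (OMap T a))"


section \<open>Transfinite sequences and cofibrant generation\<close>

text \<open>Ordinals are well-orders in the sense of the library: reflexive relations \<open>r\<close> on
  \<open>Field r\<close>, whose members are the smaller ordinals. The arrow \<open>a \<rightarrow> b\<close> is \<open>(a, b)\<close>.\<close>

definition ord_cat :: "'u rel \<Rightarrow> ('u, 'u \<times> 'u) cat" where
  "ord_cat r = \<lparr>Obj = Field r, Arr = r, Dom = fst, Cod = snd, Ide = (\<lambda>a. (a, a)),
     Cmp = (\<lambda>v u. (fst u, snd v))\<rparr>"

definition is_succ :: "'u rel \<Rightarrow> 'u \<Rightarrow> 'u \<Rightarrow> bool" where
  "is_succ r b s \<longleftrightarrow> b \<in> Field r \<and> s \<in> Field r \<and> underS r s = under r b"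

definition is_lim :: "'u rel \<Rightarrow> 'u \<Rightarrow> bool" where
  "is_lim r l \<longleftrightarrow> l \<in> Field r \<and> underS r l \<noteq> {} \<and> (\<nexists>b. is_succ r b l)"

text \<open>An \<open>r\<close>-sequence is a colimit-preserving functor from the ordinal \<open>r\<close>.\<close>

definition is_sequence ::
  "('o, 'm, 'z) cat_scheme \<Rightarrow> 'u rel \<Rightarrow> ('u, 'u \<times> 'u, 'o, 'm) ftor \<Rightarrow> bool" where
  "is_sequence C r X \<longleftrightarrow> Well_order r \<and> is_functor (ord_cat r) C X \<and>
     (\<forall>l. is_lim r l \<longrightarrow>
        is_colimit (ord_cat (Restr r (underS r l))) C X (OMap X l) (\<lambda>b. AMap X (b, l)))"

definition is_sequence_in ::
  "('o, 'm, 'z) cat_scheme \<Rightarrow> 'm set \<Rightarrow> 'u rel \<Rightarrow> ('u, 'u \<times> 'u, 'o, 'm) ftor \<Rightarrow> bool" where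
  "is_sequence_in C S r X \<longleftrightarrow>
     is_sequence C r X \<and> (\<forall>b s. is_succ r b s \<longrightarrow> AMap X (b, s) \<in> S)"

text \<open>The transfinite composition of a sequence is the leg of a colimit cocone at the least
  element of the (nonzero) ordinal \<open>r\<close>.\<close>

definition transfinite_composition ::
  "'u rel \<Rightarrow> ('o, 'm, 'z) cat_scheme \<Rightarrow> 'm set \<Rightarrow> 'm \<Rightarrow> bool" where
  "transfinite_composition \<kappa> C S f \<longleftrightarrow>
     (\<exists>(r :: 'u rel) X x c z. small \<kappa> (Field r) \<and> is_sequence_in C S r X \<and>
        is_colimit (ord_cat r) C X x c \<and>
        z \<in> Field r \<and> underS r z = {} \<and> f = c z)"

definition relative_cell_complex ::
  "'u rel \<Rightarrow> ('o, 'm, 'z) cat_scheme \<Rightarrow> 'm set \<Rightarrow> 'm \<Rightarrow> bool" where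
  "relative_cell_complex \<kappa> C S f \<longleftrightarrow> transfinite_composition \<kappa> C (pushouts_of C S) f"

text \<open>The colimit, in the category of sets, of the hom-sets from \<open>a\<close> into a sequence \<open>X\<close>:
  the disjoint union of the \<open>hom a (X b)\<close> modulo becoming equal at a later stage.\<close>

definition hom_seq_rel ::
  "('o, 'm, 'z) cat_scheme \<Rightarrow> 'u rel \<Rightarrow> ('u, 'u \<times> 'u, 'o, 'm) ftor \<Rightarrow> 'o \<Rightarrow> ('u \<times> 'm) rel" where
  "hom_seq_rel C r X a =
     {((b, g), (b', g')). b \<in> Field r \<and> b' \<in> Field r \<and>
        g \<in> hom C a (OMap X b) \<and> g' \<in> hom C a (OMap X b') \<and>
        (\<exists>d. (b, d) \<in> r \<and> (b', d) \<in> r \<and>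
          AMap X (b, d) \<cdot>\<^bsub>C\<^esub> g = AMap X (b', d) \<cdot>\<^bsub>C\<^esub> g')}"

definition hom_seq_colim ::
  "('o, 'm, 'z) cat_scheme \<Rightarrow> 'u rel \<Rightarrow> ('u, 'u \<times> 'u, 'o, 'm) ftor \<Rightarrow> 'o \<Rightarrow> ('u \<times> 'm) set set" where
  "hom_seq_colim C r X a = (SIGMA b : Field r. hom C a (OMap X b)) // hom_seq_rel C r X a"

definition hom_seq_comparison ::
  "('o, 'm, 'z) cat_scheme \<Rightarrow> ('u \<Rightarrow> 'm) \<Rightarrow> ('u \<times> 'm) set \<Rightarrow> 'm" where
  "hom_seq_comparison C c Q = the_elem ((\<lambda>(b, g). c b \<cdot>\<^bsub>C\<^esub> g) ` Q)"

text \<open>\<open>a\<close> is \<open>\<lambda>\<close>-small relative to \<open>S\<close>: for every regular \<open>r \<ge> \<lambda>\<close> and every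
  \<open>r\<close>-sequence \<open>X\<close> in \<open>S\<close>, the canonical map
  \<open>colim hom(a, X b) \<rightarrow> hom(a, colim X)\<close> is bijective.\<close>

definition small_relative ::
  "'u rel \<Rightarrow> 'u rel \<Rightarrow> ('o, 'm, 'z) cat_scheme \<Rightarrow> 'm set \<Rightarrow> 'o \<Rightarrow> bool" where
  "small_relative \<kappa> l C S a \<longleftrightarrow>
     (\<forall>(r :: 'u rel) X x c. regular_cardinal r \<and> l \<le>o r \<and> r <o \<kappa> \<and>
        is_sequence_in C S r X \<and> is_colimit (ord_cat r) C X x c \<longrightarrow>
        bij_betw (hom_seq_comparison C c) (hom_seq_colim C r X a) (hom C a x))"

definition cofibrantly_generated :: "'u rel \<Rightarrow> ('o, 'm, 'z) model_cat_scheme \<Rightarrow> bool" where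
  "cofibrantly_generated \<kappa> M \<longleftrightarrow>
     (\<exists>I J. small \<kappa> I \<and> small \<kappa> J \<and> I \<subseteq> Cof M \<and> J \<subseteq> Cof M \<inter> Weq M \<and>
        Cof M = {f. \<exists>g. relative_cell_complex \<kappa> M I g \<and> is_retract M f g} \<and>
        Cof M \<inter> Weq M = {f. \<exists>g. relative_cell_complex \<kappa> M J g \<and> is_retract M f g} \<and>
        (\<exists>l :: 'u rel. regular_cardinal l \<and> l <o \<kappa> \<and>
           (\<forall>i \<in> I. small_relative \<kappa> l M (Cof M) (Dom M i)) \<and>
           (\<forall>j \<in> J. small_relative \<kappa> l M (Cof M \<inter> Weq M) (Dom M j))))"

definition fibrantly_generated :: "'u rel \<Rightarrow> ('o, 'm, 'z) model_cat_scheme \<Rightarrow> bool" where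
  "fibrantly_generated \<kappa> M \<longleftrightarrow> cofibrantly_generated \<kappa> (op_model M)"

end

theory Submission
  imports Defs
begin

text \<open>
  Let \<open>M\<close> be cofibrantly generated with acyclic cofibrations monic. Attach to \<open>X\<close>, transfinitely,
  fillers for all maps from domains of \<open>J\<close> that do not factor through an earlier stage. As
  the stages are subobjects of the colimit \<open>TX\<close>, every such map into \<open>TX\<close> receives exactly one
  chosen filler, and \<open>TX\<close> is the free object over \<open>X\<close> with chosen fillers. Hence \<open>T\<close> is a
  monad.

  If the opposite category is cofibrantly generated, work there with the unrestricted small object
  argument for \<open>0 \<rightarrow> X\<close>, attaching at each stage a cell for every square over \<open>X\<close>. A map
  \<open>QX \<rightarrow> Y\<close> lifts to \<open>QX \<rightarrow> QY\<close> stage by stage by sending each cell to the cell it names over \<open>Y\<close>;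
  uniqueness of such lifts gives the comonad laws, so \<open>Q\<close> is a monad on \<open>M\<close>.

  Smallness makes the tower indexed by the cardinal \<open>\<lambda>\<close> long enough, and (acyclic) cofibrations are
  recognized throughout by their lifting property, so cells may be attached simultaneously.
\<close>

section \<open>Small sets\<close>

text \<open>The obstacle is the multiplication. If every stage receives fillers for all maps into
  it, a map that comes from stage \<open>b\<close> receives a further filler at each later stage,
  and an extension of \<open>X\<close> \<rightarrow> \<open>TY\<close> to \<open>TX\<close> has no
  preferred filler in \<open>TY\<close> to which a cell could be sent. Admitting a map only at the
  first stage through which it factors removes the repetition, but "first stage" determines a single
  cell only if the stages embed in the colimit; this is the use of monomorphisms. For
  \<open>Q\<close> repeated cells do no harm: a cell of stage \<open>b\<close> is sent to a cell of
  the same stage \<open>b\<close>, so the stage tells the copies apart. This needs a tower that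
  begins at the initial object. The tower for \<open>T\<close> begins at \<open>X\<close>, and a map
  \<open>X\<close> \<rightarrow> \<open>TY\<close> arrives in the colimit and at no particular
  stage. One construction of towers over an object \<open>w\<close> serves both cases, with
  \<open>w\<close> terminal for \<open>T\<close> and \<open>w = Y\<close> for \<open>QY\<close>.
  Objects, colimits and cells are picked by Hilbert choice without any coherence; the uniqueness of
  extensions then yields functoriality, naturality and the monad laws together.\<close>

lemma small_subset: "small \<kappa> B \<Longrightarrow> A \<subseteq> B \<Longrightarrow> small \<kappa> A"
  unfolding small_def using card_of_mono1 ordLeq_ordLess_trans by blast

lemma small_image: "small \<kappa> A \<Longrightarrow> small \<kappa> (f ` A)"
  unfolding small_def using card_of_image ordLeq_ordLess_trans by blast

text \<open>Regularity of \<open>\<kappa>\<close> enters here: a regular infinite cardinal is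
  stable, that is, closed under sums of fewer than \<open>\<kappa>\<close> sets of size below
  \<open>\<kappa>\<close>.\<close>

lemma small_Sigma:
  assumes "regular_cardinal \<kappa>" "small \<kappa> A" "\<And>a. a \<in> A \<Longrightarrow> small \<kappa> (B a)"
  shows "small \<kappa> (Sigma A B)"
proof -
  have "stable \<kappa>"
    using assms(1) unfolding regular_cardinal_def cinfinite_def by (metis regularCard_stable)
  then show ?thesis using assms(2,3) stable_elim unfolding small_def by metis
qed

lemma small_UN:
  assumes "regular_cardinal \<kappa>" "small \<kappa> A" "\<And>a. a \<in> A \<Longrightarrow> small \<kappa> (B a)"
  shows "small \<kappa> (\<Union>a \<in> A. B a)"
proof -
  have "stable \<kappa>"
    using assms(1) unfolding regular_cardinal_def cinfinite_def by (metis regularCard_stable)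
  then show ?thesis using assms(2,3) stable_UNION unfolding small_def by metis
qed

lemma small_finite:
  assumes "regular_cardinal \<kappa>" "finite A"
  shows "small \<kappa> A"
proof -
  have "infinite (Field \<kappa>)" and co: "Card_order \<kappa>"
    using assms(1) unfolding regular_cardinal_def cinfinite_def by auto
  then have "|A| <o |Field \<kappa>|" using assms(2) finite_ordLess_infinite[OF card_of_Well_order card_of_Well_order] by (simp add: Field_card_of)
  then show ?thesis unfolding small_def using co card_of_Field_ordIso ordLess_ordIso_trans by blast
qed

lemma small_embeds:
  fixes \<kappa> :: "'u rel"
  assumes "small \<kappa> A"
  shows "\<exists>f :: 'a \<Rightarrow> 'u. inj_on f A"
proof -
  have "|Field |A|| \<le>o |Field \<kappa>|"
    using assms unfolding small_def by (intro card_of_mono2 ordLess_imp_ordLeq)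
  then have "|A| \<le>o |Field \<kappa>|" by (simp add: Field_card_of)
  then show ?thesis unfolding card_of_ordLeq[symmetric] by blast
qed

section \<open>Categories and colimits\<close>

lemma homI: "f \<in> Arr C \<Longrightarrow> Dom C f = a \<Longrightarrow> Cod C f = b \<Longrightarrow> f \<in> hom C a b"
  by (simp add: hom_def)

lemma Arr_hom: "f \<in> Arr C \<Longrightarrow> f \<in> hom C (Dom C f) (Cod C f)"
  by (simp add: hom_def)

context category
begin

lemma hom_Obj: "f \<in> hom C a b \<Longrightarrow> a \<in> Obj C \<and> b \<in> Obj C"
  using Dom_Obj Cod_Obj by (auto simp: hom_def)

end

lemma op_cat_simps [simp]:
  "Obj (op_cat C) = Obj C" "Arr (op_cat C) = Arr C" "Dom (op_cat C) f = Cod C f" "Cod (op_cat C) f = Dom C f"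
  "Ide (op_cat C) a = Ide C a" "g \<cdot>\<^bsub>op_cat C\<^esub> f = f \<cdot>\<^bsub>C\<^esub> g"
  by (simp_all add: op_cat_def)

lemma hom_op_cat [simp]: "hom (op_cat C) a b = hom C b a"
  by (auto simp: hom_def)

lemma (in category) category_op_cat: "category (op_cat C)"
proof
  fix f g h a b c d
  assume "f \<in> hom (op_cat C) a b" "g \<in> hom (op_cat C) b c" "h \<in> hom (op_cat C) c d"
  then show "h \<cdot>\<^bsub>op_cat C\<^esub> g \<cdot>\<^bsub>op_cat C\<^esub> f = h \<cdot>\<^bsub>op_cat C\<^esub> (g \<cdot>\<^bsub>op_cat C\<^esub> f)"
    using Cmp_assoc[of h d c g b f a] by simp
qed (simp_all add: Dom_Obj Cod_Obj Ide_hom Cmp_hom Cmp_Ide_left Cmp_Ide_right)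

text \<open>A functor is a pair of total functions whose values outside the index category mean
  nothing. This and the next two rules let a diagram known only on an initial segment stand in for
  one defined everywhere, as the recursion for towers demands.\<close>

lemma is_functor_cong:
  assumes "is_functor A B F"
    and "\<And>a. a \<in> Obj A \<Longrightarrow> OMap F a = OMap G a" "\<And>u. u \<in> Arr A \<Longrightarrow> AMap F u = AMap G u"
  shows "is_functor A B G"
proof -
  interpret A: category A using assms(1) by (simp add: is_functor_def)
  have "v \<cdot>\<^bsub>A\<^esub> u \<in> Arr A" if "u \<in> Arr A" "v \<in> Arr A" "Cod A u = Dom A v" for u v
    using A.Cmp_hom[of u "Dom A u" "Cod A u" v "Cod A v"] that by (simp add: hom_def)
  moreover have "Ide A a \<in> Arr A" if "a \<in> Obj A" for a
    using A.Ide_hom[OF that] by (simp add: hom_def)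
  ultimately show ?thesis
    using assms A.Dom_Obj A.Cod_Obj unfolding is_functor_def by metis
qed

lemma is_cocone_cong:
  assumes "category J"
    and "\<And>a. a \<in> Obj J \<Longrightarrow> OMap F a = OMap G a" "\<And>u. u \<in> Arr J \<Longrightarrow> AMap F u = AMap G u"
  shows "is_cocone J C F x c \<longleftrightarrow> is_cocone J C G x c"
  using assms unfolding is_cocone_def by auto

lemma is_colimit_cong:
  assumes "is_colimit J C F x c"
    and "\<And>a. a \<in> Obj J \<Longrightarrow> OMap F a = OMap G a" "\<And>u. u \<in> Arr J \<Longrightarrow> AMap F u = AMap G u"
  shows "is_colimit J C G x c"
proof -
  have "category J" using assms(1) by (simp add: is_colimit_def is_functor_def)
  then have "is_cocone J C F y d \<longleftrightarrow> is_cocone J C G y d" for y d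
    using assms(2,3) by (rule is_cocone_cong)
  then show ?thesis using assms(1) is_functor_cong[of J C F G] assms(2,3)
    unfolding is_colimit_def by simp
qed

lemma is_colimit_cocone: "is_colimit J C D x c \<Longrightarrow> is_cocone J C D x c"
  by (simp add: is_colimit_def)

lemma is_colimit_leg: "is_colimit J C D x c \<Longrightarrow> j \<in> Obj J \<Longrightarrow> c j \<in> hom C (OMap D j) x"
  by (simp add: is_colimit_def is_cocone_def)

lemma is_colimit_map:
  assumes "is_colimit J C D x c" "is_cocone J C D y d"
  obtains h where "h \<in> hom C x y" "\<And>j. j \<in> Obj J \<Longrightarrow> h \<cdot>\<^bsub>C\<^esub> c j = d j"
  using assms unfolding is_colimit_def by blast

text \<open>Both maps induce the same cocone, and the uniqueness clause applies to it.\<close>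

lemma is_colimit_eq:
  assumes col: "is_colimit J C D x c" and h: "h \<in> hom C x y" and k: "k \<in> hom C x y"
    and eq: "\<And>j. j \<in> Obj J \<Longrightarrow> h \<cdot>\<^bsub>C\<^esub> c j = k \<cdot>\<^bsub>C\<^esub> c j"
  shows "h = k"
proof -
  have F: "is_functor J C D" and co: "is_cocone J C D x c" using col by (auto simp: is_colimit_def)
  interpret J: category J using F by (simp add: is_functor_def)
  interpret C: category C using F by (simp add: is_functor_def)
  have "is_cocone J C D y (\<lambda>j. h \<cdot>\<^bsub>C\<^esub> c j)"
    unfolding is_cocone_def
  proof (intro conjI ballI)
    show "y \<in> Obj C" using C.hom_Obj[OF h] by simp
    show "h \<cdot>\<^bsub>C\<^esub> c j \<in> hom C (OMap D j) y" if "j \<in> Obj J" for j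
      using co that h C.Cmp_hom unfolding is_cocone_def by blast
    fix u assume u: "u \<in> Arr J"
    have "c (Cod J u) \<in> hom C (OMap D (Cod J u)) x" "AMap D u \<in> hom C (OMap D (Dom J u)) (OMap D (Cod J u))"
      using co F u J.Cod_Obj unfolding is_cocone_def is_functor_def by blast+
    then have "h \<cdot>\<^bsub>C\<^esub> c (Cod J u) \<cdot>\<^bsub>C\<^esub> AMap D u = h \<cdot>\<^bsub>C\<^esub> (c (Cod J u) \<cdot>\<^bsub>C\<^esub> AMap D u)"
      using C.Cmp_assoc h by blast
    also have "c (Cod J u) \<cdot>\<^bsub>C\<^esub> AMap D u = c (Dom J u)"
      using co u unfolding is_cocone_def by blast
    finally show "h \<cdot>\<^bsub>C\<^esub> c (Cod J u) \<cdot>\<^bsub>C\<^esub> AMap D u = h \<cdot>\<^bsub>C\<^esub> c (Dom J u)" .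
  qed
  then have "\<exists>!g. g \<in> hom C x y \<and> (\<forall>j \<in> Obj J. g \<cdot>\<^bsub>C\<^esub> c j = h \<cdot>\<^bsub>C\<^esub> c j)"
    using col unfolding is_colimit_def by auto
  then show ?thesis using h k eq by metis
qed

text \<open>Cocompleteness is stated for index categories living on \<open>'u\<close>; any small index category
  has an isomorphic copy there.\<close>

lemma cocomplete_colimit:
  fixes \<kappa> :: "'u rel" and J :: "('j, 'k, 'y) cat_scheme"
  assumes coc: "cocomplete \<kappa> C" and sm: "small \<kappa> (Arr J)" and F: "is_functor J C D"
  shows "\<exists>x c. is_colimit J C D x c"
proof -
  interpret J: category J using F by (simp add: is_functor_def)
  interpret C: category C using F by (simp add: is_functor_def)
  obtain \<psi> :: "'k \<Rightarrow> 'u" where \<psi>: "inj_on \<psi> (Arr J)" using small_embeds[OF sm] by blast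
  define p where "p = the_inv_into (Arr J) \<psi>"
  \<comment> \<open>Objects are encoded by their identity arrows, so smallness of the set of arrows
    suffices to move the whole category to \<open>'u\<close>.\<close>
  define \<phi> where "\<phi> a = \<psi> (Ide J a)" for a
  have Ia: "Ide J a \<in> Arr J" "Dom J (Ide J a) = a" if "a \<in> Obj J" for a
    using J.Ide_hom[OF that] by (auto simp: hom_def)
  have \<phi>: "inj_on \<phi> (Obj J)"
    by (rule inj_onI) (metis Ia \<phi>_def \<psi> inj_on_eq_iff)
  define o' where "o' = the_inv_into (Obj J) \<phi>"
  have p: "p (\<psi> u) = u" if "u \<in> Arr J" for u using that \<psi> by (simp add: p_def the_inv_into_f_f)
  have o': "o' (\<phi> a) = a" if "a \<in> Obj J" for a using that \<phi> by (simp add: o'_def the_inv_into_f_f)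
  define K :: "('u, 'u) cat" where "K = \<lparr>Obj = \<phi> ` Obj J, Arr = \<psi> ` Arr J,
    Dom = (\<lambda>u. \<phi> (Dom J (p u))), Cod = (\<lambda>u. \<phi> (Cod J (p u))), Ide = (\<lambda>a. \<psi> (Ide J (o' a))),
    Cmp = (\<lambda>v u. \<psi> (p v \<cdot>\<^bsub>J\<^esub> p u))\<rparr>"
  have Ks: "Obj K = \<phi> ` Obj J" "Arr K = \<psi> ` Arr J" "Dom K u = \<phi> (Dom J (p u))"
    "Cod K u = \<phi> (Cod J (p u))" "Ide K a = \<psi> (Ide J (o' a))" "v \<cdot>\<^bsub>K\<^esub> u = \<psi> (p v \<cdot>\<^bsub>J\<^esub> p u)" for u v a
    by (simp_all add: K_def)
  have homK: "f \<in> hom K a b \<longleftrightarrow> (\<exists>g a' b'. a' \<in> Obj J \<and> b' \<in> Obj J \<and> a = \<phi> a' \<and> b = \<phi> b' \<and> f = \<psi> g \<and> g \<in> hom J a' b')" for f a b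
  proof
    assume "f \<in> hom K a b"
    then obtain g where "g \<in> Arr J" "f = \<psi> g" "a = \<phi> (Dom J g)" "b = \<phi> (Cod J g)"
      using p by (auto simp: hom_def Ks)
    then show "\<exists>g a' b'. a' \<in> Obj J \<and> b' \<in> Obj J \<and> a = \<phi> a' \<and> b = \<phi> b' \<and> f = \<psi> g \<and> g \<in> hom J a' b'"
      using J.Dom_Obj J.Cod_Obj Arr_hom by metis
  next
    assume "\<exists>g a' b'. a' \<in> Obj J \<and> b' \<in> Obj J \<and> a = \<phi> a' \<and> b = \<phi> b' \<and> f = \<psi> g \<and> g \<in> hom J a' b'"
    then show "f \<in> hom K a b" using p by (auto simp: hom_def Ks)
  qed
  have \<phi>eq: "a = b" if "\<phi> a = \<phi> b" "a \<in> Obj J" "b \<in> Obj J" for a b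
    using that \<phi> by (simp add: inj_on_eq_iff)
  have comp: "\<psi> g \<cdot>\<^bsub>K\<^esub> \<psi> f = \<psi> (g \<cdot>\<^bsub>J\<^esub> f)" if "f \<in> hom J a b" "g \<in> hom J b' c" for f g a b b' c
    using that by (simp add: Ks p hom_def)
  have "category K"
  proof
    fix f assume "f \<in> Arr K" then show "Dom K f \<in> Obj K" "Cod K f \<in> Obj K"
      using p J.Dom_Obj J.Cod_Obj by (auto simp: Ks)
  next
    fix a assume "a \<in> Obj K"
    then obtain a' where "a' \<in> Obj J" "a = \<phi> a'" "Ide K a = \<psi> (Ide J a')" using o' by (auto simp: Ks)
    then show "Ide K a \<in> hom K a a" unfolding homK using J.Ide_hom by blast
  next
    fix f g a b c assume "f \<in> hom K a b" "g \<in> hom K b c"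
    then show "g \<cdot>\<^bsub>K\<^esub> f \<in> hom K a c"
      unfolding homK using comp J.Cmp_hom \<phi>eq by metis
  next
    fix f g h a b c d assume "f \<in> hom K a b" "g \<in> hom K b c" "h \<in> hom K c d"
    then obtain f' g' h' a' b' b'' c' c'' d' where *: "f = \<psi> f'" "g = \<psi> g'" "h = \<psi> h'"
      "f' \<in> hom J a' b'" "g' \<in> hom J b' c'" "h' \<in> hom J c' d'"
      unfolding homK by (metis \<phi>eq)
    then show "h \<cdot>\<^bsub>K\<^esub> g \<cdot>\<^bsub>K\<^esub> f = h \<cdot>\<^bsub>K\<^esub> (g \<cdot>\<^bsub>K\<^esub> f)"
      using comp[OF *(4,5)] comp[OF *(5,6)] comp[OF J.Cmp_hom[OF *(4,5)] *(6)]
        comp[OF *(4) J.Cmp_hom[OF *(5,6)]] J.Cmp_assoc[OF *(4-6)] * by simp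
  next
    fix f a b assume "f \<in> hom K a b"
    then obtain g a' b' where *: "a' \<in> Obj J" "b' \<in> Obj J" "a = \<phi> a'" "b = \<phi> b'" "f = \<psi> g" "g \<in> hom J a' b'"
      unfolding homK by blast
    then have "Ide K a = \<psi> (Ide J a')" "Ide K b = \<psi> (Ide J b')" by (simp_all add: Ks o')
    then show "f \<cdot>\<^bsub>K\<^esub> Ide K a = f" "Ide K b \<cdot>\<^bsub>K\<^esub> f = f"
      using comp[OF J.Ide_hom *(6)] comp[OF *(6) J.Ide_hom] * J.Cmp_Ide_right J.Cmp_Ide_left by auto
  qed
  define E where "E = \<lparr>OMap = OMap D \<circ> o', AMap = AMap D \<circ> p\<rparr>"
  have E: "OMap E (\<phi> a) = OMap D a" if "a \<in> Obj J" for a using that by (simp add: E_def o')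
  have E': "AMap E (\<psi> u) = AMap D u" if "u \<in> Arr J" for u using that by (simp add: E_def p)
  have "is_functor K C E"
    unfolding is_functor_def
  proof (intro conjI ballI impI)
    show "category K" by fact
    show "category C" by (rule C.category_axioms)
    show "OMap E a \<in> Obj C" if "a \<in> Obj K" for a
      using that F E unfolding is_functor_def Ks by auto
    show "AMap E u \<in> hom C (OMap E (Dom K u)) (OMap E (Cod K u))" if "u \<in> Arr K" for u
      using that F E E' p J.Dom_Obj J.Cod_Obj unfolding is_functor_def Ks by auto
    show "AMap E (Ide K a) = Ide C (OMap E a)" if "a \<in> Obj K" for a
      using that F E E' o' Ia unfolding is_functor_def Ks by auto
    fix u v assume "u \<in> Arr K" "v \<in> Arr K" "Cod K u = Dom K v"
    then obtain u' v' where *: "u = \<psi> u'" "v = \<psi> v'" "u' \<in> Arr J" "v' \<in> Arr J" "Cod J u' = Dom J v'"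
      using p \<phi>eq J.Dom_Obj J.Cod_Obj unfolding Ks by auto
    then have "v' \<cdot>\<^bsub>J\<^esub> u' \<in> Arr J" using J.Cmp_hom[of u' _ _ v'] by (auto simp: hom_def)
    then show "AMap E (v \<cdot>\<^bsub>K\<^esub> u) = AMap E v \<cdot>\<^bsub>C\<^esub> AMap E u"
      using * F E' unfolding is_functor_def by (simp add: Ks p)
  qed
  moreover have "small \<kappa> (Arr K)" using small_image[OF sm] by (simp add: Ks)
  ultimately obtain x c where col: "is_colimit K C E x c"
    using coc unfolding cocomplete_def by blast
  \<comment> \<open>Cocones on the copy and on the original correspond by relabelling, hence so do
    universal cocones.\<close>
  have coc_iff: "is_cocone J C D y (d \<circ> \<phi>) \<longleftrightarrow> is_cocone K C E y d" for y d
    using p E E' J.Dom_Obj J.Cod_Obj unfolding is_cocone_def Ks by auto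
  have "is_colimit J C D x (c \<circ> \<phi>)"
    unfolding is_colimit_def
  proof (intro conjI allI impI)
    show "is_functor J C D" by fact
    show "is_cocone J C D x (c \<circ> \<phi>)" using col coc_iff unfolding is_colimit_def by simp
    fix y d assume d: "is_cocone J C D y d"
    have "is_cocone J C D y ((d \<circ> o') \<circ> \<phi>)"
      using d o' J.Dom_Obj J.Cod_Obj unfolding is_cocone_def by auto
    then have "is_cocone K C E y (d \<circ> o')" using coc_iff by blast
    then have "\<exists>!h. h \<in> hom C x y \<and> (\<forall>j \<in> Obj K. h \<cdot>\<^bsub>C\<^esub> c j = (d \<circ> o') j)"
      using col unfolding is_colimit_def by blast
    then show "\<exists>!h. h \<in> hom C x y \<and> (\<forall>j\<in>Obj J. h \<cdot>\<^bsub>C\<^esub> (c \<circ> \<phi>) j = d j)"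
      unfolding Ks by (simp add: o')
  qed
  then show ?thesis by blast
qed

section \<open>Diagrams on preorders\<close>

lemma ord_cat_simps [simp]:
  "Obj (ord_cat r) = Field r" "Arr (ord_cat r) = r" "Dom (ord_cat r) u = fst u"
  "Cod (ord_cat r) u = snd u" "Ide (ord_cat r) a = (a, a)" "v \<cdot>\<^bsub>ord_cat r\<^esub> u = (fst u, snd v)"
  by (simp_all add: ord_cat_def)

lemma hom_ord_cat [simp]: "f \<in> hom (ord_cat r) a b \<longleftrightarrow> f = (a, b) \<and> (a, b) \<in> r"
  by (auto simp: hom_def)

lemma category_ord_cat:
  assumes "Refl r" "trans r"
  shows "category (ord_cat r)"
  using assms by unfold_locales (auto intro: FieldI1 FieldI2 elim: transE dest: refl_onD)

context category
begin

lemma is_functor_ord_cat: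
  assumes "Refl r" "trans r"
  shows "is_functor (ord_cat r) C X \<longleftrightarrow>
    (\<forall>a \<in> Field r. OMap X a \<in> Obj C \<and> AMap X (a, a) = Ide C (OMap X a)) \<and>
    (\<forall>a b. (a, b) \<in> r \<longrightarrow> AMap X (a, b) \<in> hom C (OMap X a) (OMap X b)) \<and>
    (\<forall>a b c. (a, b) \<in> r \<longrightarrow> (b, c) \<in> r \<longrightarrow> AMap X (a, c) = AMap X (b, c) \<cdot> AMap X (a, b))"
  using category_ord_cat[OF assms] category_axioms unfolding is_functor_def by (auto 0 3)

lemma functor_const:
  assumes "Refl r" "trans r" "y \<in> Obj C"
  shows "is_functor (ord_cat r) C \<lparr>OMap = (\<lambda>_. y), AMap = (\<lambda>_. Ide C y)\<rparr>"
  using assms Ide_hom[of y] Cmp_Ide_right[of "Ide C y" y y] by (simp add: is_functor_ord_cat)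

end

lemma is_cocone_ord_cat:
  "is_cocone (ord_cat r) C X x c \<longleftrightarrow> x \<in> Obj C \<and> (\<forall>b \<in> Field r. c b \<in> hom C (OMap X b) x) \<and>
    (\<forall>a b. (a, b) \<in> r \<longrightarrow> c b \<cdot>\<^bsub>C\<^esub> AMap X (a, b) = c a)"
  unfolding is_cocone_def by auto

lemma ord_colimit_map:
  assumes "is_colimit (ord_cat r) C X x c" "is_cocone (ord_cat r) C X y d"
  obtains h where "h \<in> hom C x y" "\<And>b. b \<in> Field r \<Longrightarrow> h \<cdot>\<^bsub>C\<^esub> c b = d b"
  by (rule is_colimit_map[OF assms]) (simp add: that)

section \<open>Zero, successors and limits in a well-order\<close>

lemma well_orderD:
  assumes "Well_order r"
  shows "Refl r" "trans r" "antisym r" "Total r" "wf (r - Id)"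
  using assms unfolding order_on_defs by auto

lemma Restr_underS:
  assumes "Refl r" "trans r"
  shows "Field (Restr r (underS r l)) = underS r l" "Refl (Restr r (underS r l))"
    "trans (Restr r (underS r l))"
proof -
  show F: "Field (Restr r (underS r l)) = underS r l"
    using assms(1) unfolding underS_def Field_def refl_on_def by blast
  show "Refl (Restr r (underS r l))"
    unfolding F using assms(1) unfolding refl_on_def underS_def by (auto intro: FieldI1)
  show "trans (Restr r (underS r l))" using assms(2) by (simp add: trans_Restr)
qed

lemma is_succD:
  assumes "Well_order r" "is_succ r b s"
  shows "(b, s) \<in> r" "b \<noteq> s" "b \<in> underS r s" "\<And>d. (d, s) \<in> r \<Longrightarrow> d = s \<or> (d, b) \<in> r"
    "\<And>b'. is_succ r b' s \<Longrightarrow> b' = b"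
proof -
  note wo = well_orderD[OF assms(1)]
  have us: "underS r s = under r b" and b: "b \<in> Field r" using assms(2) by (auto simp: is_succ_def)
  show bs: "b \<in> underS r s" using us b wo(1) unfolding under_def refl_on_def by auto
  then show "(b, s) \<in> r" "b \<noteq> s" by (auto simp: underS_def)
  show "d = s \<or> (d, b) \<in> r" if "(d, s) \<in> r" for d
    using us that unfolding under_def underS_def by blast
  show "b' = b" if "is_succ r b' s" for b'
  proof -
    have "under r b' = under r b" using that us by (simp add: is_succ_def)
    moreover have "b' \<in> under r b'"
      using that wo(1) unfolding is_succ_def under_def refl_on_def by auto
    moreover have "b \<in> under r b" using b wo(1) unfolding under_def refl_on_def by auto
    ultimately show ?thesis using wo(3) unfolding under_def antisym_def by blast
  qed
qed

lemma zero_succ_lim_cases: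
  assumes "b \<in> Field r"
  obtains "underS r b = {}" | a where "is_succ r a b" | "is_lim r b"
  using assms unfolding is_lim_def by blast

lemma zero_least:
  assumes "Well_order r" "z \<in> Field r" "underS r z = {}" "b \<in> Field r"
  shows "(z, b) \<in> r"
proof (cases "b = z")
  case True then show ?thesis using assms(4) well_orderD(1)[OF assms(1)] by (simp add: refl_on_def)
next
  case False
  then have "(b, z) \<notin> r" using assms(3) unfolding underS_def by blast
  then show ?thesis using False assms(2,4) well_orderD(4)[OF assms(1)] unfolding total_on_def by blast
qed

lemma zero_unique:
  assumes "Well_order r" "z \<in> Field r" "underS r z = {}" "b \<in> Field r" "underS r b = {}"
  shows "b = z"
proof -
  have "z \<notin> underS r b" using assms(5) by simp
  then show ?thesis using zero_least[OF assms(1-4)] by (auto simp: underS_def)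
qed

lemma zero_exists:
  assumes "Well_order r" "Field r \<noteq> {}"
  obtains z where "z \<in> Field r" "underS r z = {}"
proof -
  obtain z where z: "z \<in> Field r" and *: "\<And>b. (b, z) \<in> r - Id \<Longrightarrow> b \<notin> Field r"
    using wfE_min[OF well_orderD(5)[OF assms(1)], of _ "Field r"] assms(2) by blast
  then have "underS r z = {}" unfolding underS_def by (auto dest: FieldI1)
  then show ?thesis using that z by blast
qed

text \<open>The successor is the least element strictly above \<open>b\<close>; \<open>c\<close>
  shows that there is one to minimize over.\<close>

lemma succ_exists:
  assumes "Well_order r" "(b, c) \<in> r" "b \<noteq> c"
  obtains s where "is_succ r b s"
proof -
  note wo = well_orderD[OF assms(1)]
  obtain s where s: "(b, s) \<in> r" "b \<noteq> s" and min: "\<And>d. (d, s) \<in> r - Id \<Longrightarrow> \<not> ((b, d) \<in> r \<and> b \<noteq> d)"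
    by (rule wfE_min[OF wo(5), of c "{d. (b, d) \<in> r \<and> b \<noteq> d}"]) (use assms(2,3) in auto)
  have "underS r s = under r b"
  proof (intro equalityI subsetI)
    fix d assume "d \<in> underS r s"
    then have d: "(d, s) \<in> r" "d \<noteq> s" by (auto simp: underS_def)
    then have "\<not> ((b, d) \<in> r \<and> b \<noteq> d)" using min by blast
    then show "d \<in> under r b"
      using wo(1,4) d(1) s(1) unfolding under_def total_on_def refl_on_def
      by (metis FieldI1 mem_Collect_eq)
  next
    fix d assume "d \<in> under r b"
    then show "d \<in> underS r s"
      using s wo(2,3) unfolding under_def underS_def trans_def antisym_def by blast
  qed
  then show ?thesis using that s unfolding is_succ_def by (meson FieldI1 FieldI2)
qed

section \<open>Sequences, and maps out of them by transfinite recursion\<close>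

lemma is_sequenceD:
  assumes "is_sequence C r X"
  shows "Well_order r" "is_functor (ord_cat r) C X" "category C"
    "\<And>l. is_lim r l \<Longrightarrow> is_colimit (ord_cat (Restr r (underS r l))) C X (OMap X l) (\<lambda>b. AMap X (b, l))"
  using assms unfolding is_sequence_def is_functor_def by auto

context category
begin

lemma functor_ord_catD:
  assumes "Well_order r" "is_functor (ord_cat r) C X"
  shows "\<And>a. a \<in> Field r \<Longrightarrow> OMap X a \<in> Obj C" "\<And>a. a \<in> Field r \<Longrightarrow> AMap X (a, a) = Ide C (OMap X a)"
    "\<And>a b. (a, b) \<in> r \<Longrightarrow> AMap X (a, b) \<in> hom C (OMap X a) (OMap X b)"
    "\<And>a b c. (a, b) \<in> r \<Longrightarrow> (b, c) \<in> r \<Longrightarrow> AMap X (b, c) \<cdot> AMap X (a, b) = AMap X (a, c)"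
  using assms(2) unfolding is_functor_ord_cat[OF well_orderD(1,2)[OF assms(1)]] by auto

text \<open>\<open>P\<close> is an invariant of the components and
  \<open>R\<close> a relation to be satisfied at every successor step.\<close>

lemma sequence_map_exists:
  assumes X: "is_sequence C r X" and Y: "is_functor (ord_cat r) C Y"
    and zero: "\<And>z. z \<in> Field r \<Longrightarrow> underS r z = {} \<Longrightarrow> \<exists>h \<in> hom C (OMap X z) (OMap Y z). P z h"
    and succ: "\<And>b s h. is_succ r b s \<Longrightarrow> h \<in> hom C (OMap X b) (OMap Y b) \<Longrightarrow> P b h \<Longrightarrow>
      \<exists>h' \<in> hom C (OMap X s) (OMap Y s). h' \<cdot> AMap X (b, s) = AMap Y (b, s) \<cdot> h \<and> P s h' \<and> R b s h h'"
    and lim: "\<And>l h g. is_lim r l \<Longrightarrow> h \<in> hom C (OMap X l) (OMap Y l) \<Longrightarrow>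
      (\<And>b. b \<in> underS r l \<Longrightarrow> g b \<in> hom C (OMap X b) (OMap Y b) \<and> P b (g b) \<and>
        h \<cdot> AMap X (b, l) = AMap Y (b, l) \<cdot> g b) \<Longrightarrow> P l h"
  obtains \<eta> where "\<And>b. b \<in> Field r \<Longrightarrow> \<eta> b \<in> hom C (OMap X b) (OMap Y b)" "\<And>b. b \<in> Field r \<Longrightarrow> P b (\<eta> b)"
    "\<And>a b. (a, b) \<in> r \<Longrightarrow> \<eta> b \<cdot> AMap X (a, b) = AMap Y (a, b) \<cdot> \<eta> a"
    "\<And>b s. is_succ r b s \<Longrightarrow> R b s (\<eta> b) (\<eta> s)"
proof -
  note sX = is_sequenceD[OF X]
  note wo = well_orderD[OF sX(1)]
  note fX = functor_ord_catD[OF sX(1,2)] and fY = functor_ord_catD[OF sX(1) Y]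
  define A where "A b s h h' \<longleftrightarrow> h' \<in> hom C (OMap X s) (OMap Y s) \<and>
      h' \<cdot> AMap X (b, s) = AMap Y (b, s) \<cdot> h \<and> P s h' \<and> R b s h h'" for b s h h'
  define B where "B f l h \<longleftrightarrow> h \<in> hom C (OMap X l) (OMap Y l) \<and>
      (\<forall>a \<in> underS r l. h \<cdot> AMap X (a, l) = AMap Y (a, l) \<cdot> f a)" for f l h
  \<comment> \<open>Hilbert choice fixes a component at each kind of stage before any is known to
    exist. The induction on \<open>G\<close> below proves that the required properties can be met,
    hence that the choices meet them.\<close>
  define H where "H f b = (if underS r b = {} then SOME h. h \<in> hom C (OMap X b) (OMap Y b) \<and> P b h
    else if \<exists>a. is_succ r a b then SOME h. A (THE a. is_succ r a b) b (f (THE a. is_succ r a b)) h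
    else SOME h. B f b h)" for f b
  define \<eta> where "\<eta> = wfrec (r - Id) H"
  have \<eta>: "\<eta> b = H (cut \<eta> (r - Id) b) b" for b
    unfolding \<eta>_def using wo(5) by (rule wfrec)
  have cut: "cut \<eta> (r - Id) b a = \<eta> a" if "a \<in> underS r b" for a b
    using that unfolding underS_def by (simp add: cut_def)
  define G where "G b \<longleftrightarrow> \<eta> b \<in> hom C (OMap X b) (OMap Y b) \<and> P b (\<eta> b) \<and>
    (\<forall>a. (a, b) \<in> r \<longrightarrow> \<eta> b \<cdot> AMap X (a, b) = AMap Y (a, b) \<cdot> \<eta> a) \<and>
    (\<forall>a. is_succ r a b \<longrightarrow> R a b (\<eta> a) (\<eta> b))" for b
  have refl: "\<eta> b \<cdot> AMap X (b, b) = AMap Y (b, b) \<cdot> \<eta> b" if "\<eta> b \<in> hom C (OMap X b) (OMap Y b)" "b \<in> Field r" for b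
    using that fX(2) fY(2) Cmp_Ide_left Cmp_Ide_right by simp
  have "b \<in> Field r \<longrightarrow> G b" for b
  proof (induction b rule: wf_induct_rule[OF wo(5)])
    case (1 b)
    then have IH: "G a" if "a \<in> underS r b" for a
      using that unfolding underS_def by (auto dest: FieldI1)
    show ?case
    proof
      assume b: "b \<in> Field r"
      then show "G b"
      proof (cases rule: zero_succ_lim_cases)
        case 1
        then have "\<eta> b = (SOME h. h \<in> hom C (OMap X b) (OMap Y b) \<and> P b h)"
          by (subst \<eta>) (simp add: H_def)
        then have e: "\<eta> b \<in> hom C (OMap X b) (OMap Y b) \<and> P b (\<eta> b)"
          using someI_ex[of "\<lambda>h. h \<in> hom C (OMap X b) (OMap Y b) \<and> P b h"] zero[OF b 1] by (auto simp: Bex_def)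
        have "a = b" if "(a, b) \<in> r" for a using 1 that unfolding underS_def by blast
        moreover have "\<not> is_succ r a b" for a using 1 is_succD(3)[OF sX(1)] by blast
        ultimately show ?thesis unfolding G_def using e refl b by blast
      next
        case (2 a)
        have the: "(THE a. is_succ r a b) = a" using 2 is_succD(5)[OF sX(1)] by blast
        note a = is_succD[OF sX(1) 2]
        have aF: "a \<in> Field r" using 2 by (simp add: is_succ_def)
        have "\<eta> b = (SOME h. A a b (\<eta> a) h)"
          using a(3) 2 by (subst \<eta>) (auto simp: H_def the cut)
        moreover have "\<exists>h. A a b (\<eta> a) h"
          using succ[OF 2] IH[OF a(3)] unfolding G_def A_def by blast
        ultimately have e: "A a b (\<eta> a) (\<eta> b)" using someI_ex[of "A a b (\<eta> a)"] by simp
        have "\<eta> b \<cdot> AMap X (d, b) = AMap Y (d, b) \<cdot> \<eta> d" if db: "(d, b) \<in> r" for d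
        proof (cases "d = b")
          case True then show ?thesis using refl e b unfolding A_def by blast
        next
          case False
          \<comment> \<open>Every map from an older stage into a successor passes through its
            predecessor \<open>a\<close>, which reduces naturality to the single step from
            \<open>a\<close> to \<open>b\<close>.\<close>
          then have da: "(d, a) \<in> r" using a(4) db by blast
          have Ga: "G a" using IH a(3) .
          have h: "\<eta> a \<in> hom C (OMap X a) (OMap Y a)" "\<eta> b \<in> hom C (OMap X b) (OMap Y b)"
            "\<eta> d \<in> hom C (OMap X d) (OMap Y d)"
            using Ga e IH[of d] False db unfolding G_def A_def underS_def by blast+
          have "\<eta> b \<cdot> AMap X (d, b) = \<eta> b \<cdot> AMap X (a, b) \<cdot> AMap X (d, a)"
            using fX(4)[OF da a(1)] Cmp_assoc[OF fX(3)[OF da] fX(3)[OF a(1)] h(2)] by simp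
          also have "\<dots> = AMap Y (a, b) \<cdot> (\<eta> a \<cdot> AMap X (d, a))"
            using e Cmp_assoc[OF fX(3)[OF da] h(1) fY(3)[OF a(1)]] unfolding A_def by simp
          also have "\<dots> = AMap Y (a, b) \<cdot> AMap Y (d, a) \<cdot> \<eta> d"
            using Ga da Cmp_assoc[OF h(3) fY(3)[OF da] fY(3)[OF a(1)]] unfolding G_def by simp
          finally show ?thesis using fY(4)[OF da a(1)] by simp
        qed
        then show ?thesis using e a(5) unfolding G_def A_def by blast
      next
        case 3
        then have ns: "\<nexists>a. is_succ r a b" "underS r b \<noteq> {}" by (auto simp: is_lim_def)
        have "\<eta> b = (SOME h. B (cut \<eta> (r - Id) b) b h)" using ns by (subst \<eta>) (simp add: H_def)
        moreover have "B (cut \<eta> (r - Id) b) b h \<longleftrightarrow> B \<eta> b h" for h using cut by (simp add: B_def)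
        ultimately have "\<eta> b = (SOME h. B \<eta> b h)" by simp
        moreover have "\<exists>h. B \<eta> b h"
        proof -
          \<comment> \<open>At a limit stage the component is induced by the colimit on the source
            side, so the target \<open>Y\<close> need only be a functor.\<close>
          have "is_cocone (ord_cat (Restr r (underS r b))) C X (OMap Y b) (\<lambda>a. AMap Y (a, b) \<cdot> \<eta> a)"
            unfolding is_cocone_ord_cat Restr_underS(1)[OF wo(1,2)]
          proof (intro conjI ballI allI impI)
            show "OMap Y b \<in> Obj C" using fY(1) b .
            show "AMap Y (a, b) \<cdot> \<eta> a \<in> hom C (OMap X a) (OMap Y b)" if a: "a \<in> underS r b" for a
              using IH[OF a] a fY(3) Cmp_hom unfolding G_def underS_def by blast
            fix a d assume ad: "(a, d) \<in> Restr r (underS r b)"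
            then have *: "(a, d) \<in> r" "(d, b) \<in> r" "(a, b) \<in> r" "G a" "G d" using IH by (auto simp: underS_def)
            then have "AMap Y (d, b) \<cdot> \<eta> d \<cdot> AMap X (a, d) = AMap Y (d, b) \<cdot> (\<eta> d \<cdot> AMap X (a, d))"
              using Cmp_assoc[OF fX(3)[OF *(1)] _ fY(3)[OF *(2)]] unfolding G_def by blast
            also have "\<dots> = AMap Y (d, b) \<cdot> AMap Y (a, d) \<cdot> \<eta> a"
              using * Cmp_assoc[OF _ fY(3)[OF *(1)] fY(3)[OF *(2)], of "\<eta> a" "OMap X a"] unfolding G_def by simp
            finally show "AMap Y (d, b) \<cdot> \<eta> d \<cdot> AMap X (a, d) = AMap Y (a, b) \<cdot> \<eta> a"
              using fY(4) * by simp
          qed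
          then obtain h where "h \<in> hom C (OMap X b) (OMap Y b)"
            "\<And>a. a \<in> underS r b \<Longrightarrow> h \<cdot> AMap X (a, b) = AMap Y (a, b) \<cdot> \<eta> a"
            using is_colimit_map[OF sX(4)[OF 3]] by (auto simp: Restr_underS(1)[OF wo(1,2)])
          then show ?thesis unfolding B_def by blast
        qed
        ultimately have e: "B \<eta> b (\<eta> b)" using someI_ex[of "B \<eta> b"] by simp
        \<comment> \<open>The component at a limit is already determined by the colimit, so
          \<open>P\<close> cannot be built into the choice; it has to be inherited from the earlier
          stages.\<close>
        have "P b (\<eta> b)"
          using lim[OF 3, of "\<eta> b" \<eta>] e IH unfolding B_def G_def by blast
        moreover have "\<eta> b \<cdot> AMap X (a, b) = AMap Y (a, b) \<cdot> \<eta> a" if "(a, b) \<in> r" for a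
          using refl e b that unfolding B_def underS_def by (cases "a = b") auto
        ultimately show ?thesis using e ns unfolding B_def G_def by blast
      qed
    qed
  qed
  moreover have "b \<in> Field r" if "(a, b) \<in> r \<or> is_succ r a b" for a b
    using that unfolding is_succ_def by (auto intro: FieldI2)
  ultimately show ?thesis using that[of \<eta>] unfolding G_def by blast
qed

text \<open>The legs into a limit stage are jointly epic, so agreement passes through limits and
  only zero and successors have to be checked.\<close>

lemma sequence_map_unique:
  assumes X: "is_sequence C r X" and Y: "is_functor (ord_cat r) C Y"
    and hom: "\<And>b. b \<in> Field r \<Longrightarrow> \<eta> b \<in> hom C (OMap X b) (OMap Y b)"
      "\<And>b. b \<in> Field r \<Longrightarrow> \<theta> b \<in> hom C (OMap X b) (OMap Y b)"
    and nat: "\<And>a b. (a, b) \<in> r \<Longrightarrow> \<eta> b \<cdot> AMap X (a, b) = AMap Y (a, b) \<cdot> \<eta> a"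
      "\<And>a b. (a, b) \<in> r \<Longrightarrow> \<theta> b \<cdot> AMap X (a, b) = AMap Y (a, b) \<cdot> \<theta> a"
    and zero: "\<And>z. z \<in> Field r \<Longrightarrow> underS r z = {} \<Longrightarrow> \<eta> z = \<theta> z"
    and succ: "\<And>b s. is_succ r b s \<Longrightarrow> \<eta> b = \<theta> b \<Longrightarrow> \<eta> s = \<theta> s"
    and b: "b \<in> Field r"
  shows "\<eta> b = \<theta> b"
proof -
  note sX = is_sequenceD[OF X]
  note wo = well_orderD[OF sX(1)]
  have "b \<in> Field r \<longrightarrow> \<eta> b = \<theta> b"
  proof (induction b rule: wf_induct_rule[OF wo(5)])
    case (1 b)
    then have IH: "\<eta> a = \<theta> a" if "a \<in> underS r b" for a
      using that unfolding underS_def by (auto dest: FieldI1)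
    show ?case
    proof
      assume b: "b \<in> Field r"
      then show "\<eta> b = \<theta> b"
      proof (cases rule: zero_succ_lim_cases)
        case 1 with b zero show ?thesis by blast
      next
        case (2 a)
        then show ?thesis using succ IH is_succD(3)[OF sX(1) 2] by blast
      next
        case 3
        have "\<eta> b \<cdot> AMap X (a, b) = \<theta> b \<cdot> AMap X (a, b)" if "a \<in> underS r b" for a
          using that IH nat unfolding underS_def by auto
        then show ?thesis using is_colimit_eq[OF sX(4)[OF 3] hom(1)[OF b] hom(2)[OF b]]
          by (simp add: Restr_underS(1)[OF wo(1,2)])
      qed
    qed
  qed
  then show ?thesis using b by blast
qed

section \<open>Lifting properties\<close>

lemma has_liftD:
  assumes "has_lift C i p" "u \<in> hom C (Dom C i) (Dom C p)" "v \<in> hom C (Cod C i) (Cod C p)" "p \<cdot> u = v \<cdot> i"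
  obtains h where "h \<in> hom C (Cod C i) (Dom C p)" "h \<cdot> i = u" "p \<cdot> h = v"
  using assms unfolding has_lift_def by blast

text \<open>A natural map into a constant diagram is a cocone, so lifts are built stage by stage
  into \<open>Dom C p\<close> and glued. The starting stage \<open>a\<close> is arbitrary because
  later the legs from all stages must be recognized as acyclic cofibrations, not just the leg from
  zero.\<close>

lemma sequence_lift:
  fixes r :: "'u rel"
  assumes X: "is_sequence C r X" and col: "is_colimit (ord_cat r) C X x c" and p: "p \<in> Arr C"
    and step: "\<And>b s. is_succ r b s \<Longrightarrow> has_lift C (AMap X (b, s)) p"
    and a: "a \<in> Field r"
  shows "has_lift C (c a) p"
proof -
  note sX = is_sequenceD[OF X]
  note wo = well_orderD[OF sX(1)]
  note fX = functor_ord_catD[OF sX(1,2)]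
  have c: "c b \<in> hom C (OMap X b) x" if "b \<in> Field r" for b
    using is_colimit_leg[OF col] that by simp
  have cc: "c b \<cdot> AMap X (a, b) = c a" if "(a, b) \<in> r" for a b
    using is_colimit_cocone[OF col] that unfolding is_cocone_ord_cat by blast
  have ph: "p \<in> hom C (Dom C p) (Cod C p)" using p by (rule Arr_hom)
  have ca: "Dom C (c a) = OMap X a" "Cod C (c a) = x" using c[OF a] by (auto simp: hom_def)
  show ?thesis
    unfolding has_lift_def ca
  proof (intro ballI impI)
    fix u v assume u: "u \<in> hom C (OMap X a) (Dom C p)" and v: "v \<in> hom C x (Cod C p)" and uv: "p \<cdot> u = v \<cdot> c a"
    define Y where "Y = \<lparr>OMap = (\<lambda>_::'u. Dom C p), AMap = (\<lambda>_::'u \<times> 'u. Ide C (Dom C p))\<rparr>"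
    have Ys: "OMap Y b = Dom C p" "AMap Y e = Ide C (Dom C p)" for b e by (simp_all add: Y_def)
    have Yf: "is_functor (ord_cat r) C Y"
      unfolding Y_def using functor_const[OF wo(1,2)] Dom_Obj p by blast
    \<comment> \<open>The second clause prescribes restrictions of \<open>u\<close> up to stage
      \<open>a\<close>; thus the recursion may begin at zero although the data of the lifting
      problem sit at \<open>a\<close>.\<close>
    define P where "P b h \<longleftrightarrow> p \<cdot> h = v \<cdot> c b \<and> ((b, a) \<in> r \<longrightarrow> h = u \<cdot> AMap X (b, a))" for b h
    have base: "u \<cdot> AMap X (b, a) \<in> hom C (OMap X b) (Dom C p)" "P b (u \<cdot> AMap X (b, a))" if ba: "(b, a) \<in> r" for b
    proof -
      note x = fX(3)[OF ba]
      show "u \<cdot> AMap X (b, a) \<in> hom C (OMap X b) (Dom C p)" using Cmp_hom[OF x u] .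
      have "p \<cdot> (u \<cdot> AMap X (b, a)) = v \<cdot> c a \<cdot> AMap X (b, a)" using Cmp_assoc[OF x u ph] uv by simp
      also have "\<dots> = v \<cdot> c b" using Cmp_assoc[OF x c[OF a] v] cc[OF ba] by simp
      finally show "P b (u \<cdot> AMap X (b, a))" unfolding P_def by simp
    qed
    obtain \<eta> where \<eta>: "\<And>b. b \<in> Field r \<Longrightarrow> \<eta> b \<in> hom C (OMap X b) (OMap Y b)" "\<And>b. b \<in> Field r \<Longrightarrow> P b (\<eta> b)"
      "\<And>a b. (a, b) \<in> r \<Longrightarrow> \<eta> b \<cdot> AMap X (a, b) = AMap Y (a, b) \<cdot> \<eta> a"
    proof (rule sequence_map_exists[OF X Yf, where P = P and R = "\<lambda>_ _ _ _. True"])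
      fix z assume z: "z \<in> Field r" "underS r z = {}"
      then have "(z, a) \<in> r"
        using zero_least[OF sX(1)] a by blast
      then show "\<exists>h \<in> hom C (OMap X z) (OMap Y z). P z h" using base unfolding Ys by blast
    next
      fix b s h assume bs: "is_succ r b s" and h: "h \<in> hom C (OMap X b) (OMap Y b)" and P: "P b h"
      note s = is_succD[OF sX(1) bs]
      have F: "b \<in> Field r" "s \<in> Field r" using bs by (auto simp: is_succ_def)
      have id: "AMap Y (b, s) \<cdot> h = h" using h Cmp_Ide_left unfolding Ys by blast
      show "\<exists>h' \<in> hom C (OMap X s) (OMap Y s). h' \<cdot> AMap X (b, s) = AMap Y (b, s) \<cdot> h \<and> P s h' \<and> True"
      proof (cases "(s, a) \<in> r")
        case True
        then have ba: "(b, a) \<in> r" using s(1) wo(2) by (meson transE)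
        have "u \<cdot> AMap X (s, a) \<cdot> AMap X (b, s) = h"
          using P ba fX(4)[OF s(1) True] Cmp_assoc[OF fX(3)[OF s(1)] fX(3)[OF True] u] unfolding P_def by simp
        then show ?thesis using base[OF True] id unfolding Ys by (intro bexI[of _ "u \<cdot> AMap X (s, a)"]) simp_all
      next
        \<comment> \<open>Beyond \<open>a\<close> nothing is prescribed, and the lifting property of
          the single step supplies the next component.\<close>
        case False
        have X': "AMap X (b, s) \<in> hom C (OMap X b) (OMap X s)" using fX(3) s(1) .
        have vs: "v \<cdot> c s \<in> hom C (OMap X s) (Cod C p)" using Cmp_hom[OF c[OF F(2)] v] .
        have "p \<cdot> h = v \<cdot> c s \<cdot> AMap X (b, s)"
          using P cc[OF s(1)] Cmp_assoc[OF X' c[OF F(2)] v] unfolding P_def by simp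
        then obtain h' where "h' \<in> hom C (OMap X s) (Dom C p)" "h' \<cdot> AMap X (b, s) = h" "p \<cdot> h' = v \<cdot> c s"
          using has_liftD[OF step[OF bs], of h "v \<cdot> c s"] h vs X' unfolding Ys by (auto simp: hom_def)
        then show ?thesis using False id unfolding Ys P_def by (intro bexI[of _ h']) simp_all
      qed
    next
      fix l h g assume l: "is_lim r l" and h: "h \<in> hom C (OMap X l) (OMap Y l)"
        and g: "\<And>b. b \<in> underS r l \<Longrightarrow> g b \<in> hom C (OMap X b) (OMap Y b) \<and> P b (g b) \<and>
          h \<cdot> AMap X (b, l) = AMap Y (b, l) \<cdot> g b"
      have lF: "l \<in> Field r" using l by (simp add: is_lim_def)
      have hX: "h \<cdot> AMap X (b, l) = g b" if "b \<in> underS r l" for b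
        using g[OF that] Cmp_Ide_left unfolding Ys by auto
      have h': "h \<in> hom C (OMap X l) (Dom C p)" using h by (simp add: Ys)
      have "p \<cdot> h = v \<cdot> c l"
      proof (rule is_colimit_eq[OF sX(4)[OF l]])
        show "p \<cdot> h \<in> hom C (OMap X l) (Cod C p)" using Cmp_hom[OF h' ph] .
        show "v \<cdot> c l \<in> hom C (OMap X l) (Cod C p)" using Cmp_hom[OF c[OF lF] v] .
        fix b assume "b \<in> Obj (ord_cat (Restr r (underS r l)))"
        then have b: "b \<in> underS r l" by (simp add: Restr_underS(1)[OF wo(1,2)])
        then have bl: "(b, l) \<in> r" by (simp add: underS_def)
        have "p \<cdot> h \<cdot> AMap X (b, l) = p \<cdot> g b"
          using Cmp_assoc[OF fX(3)[OF bl] h' ph] hX[OF b] by simp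
        also have "\<dots> = v \<cdot> c b" using g[OF b] by (simp add: P_def)
        also have "\<dots> = v \<cdot> c l \<cdot> AMap X (b, l)"
          using Cmp_assoc[OF fX(3)[OF bl] c[OF lF] v] cc[OF bl] by simp
        finally show "p \<cdot> h \<cdot> AMap X (b, l) = v \<cdot> c l \<cdot> AMap X (b, l)" .
      qed
      moreover have "h = u \<cdot> AMap X (l, a)" if la: "(l, a) \<in> r"
      proof (rule is_colimit_eq[OF sX(4)[OF l] h'])
        show "u \<cdot> AMap X (l, a) \<in> hom C (OMap X l) (Dom C p)" using base(1)[OF la] .
        fix b assume "b \<in> Obj (ord_cat (Restr r (underS r l)))"
        then have b: "b \<in> underS r l" by (simp add: Restr_underS(1)[OF wo(1,2)])
        then have bl: "(b, l) \<in> r" by (simp add: underS_def)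
        then have ba: "(b, a) \<in> r" using la wo(2) by (meson transE)
        have "h \<cdot> AMap X (b, l) = u \<cdot> AMap X (b, a)" using hX[OF b] g[OF b] ba by (simp add: P_def)
        then show "h \<cdot> AMap X (b, l) = u \<cdot> AMap X (l, a) \<cdot> AMap X (b, l)"
          using fX(4)[OF bl la] Cmp_assoc[OF fX(3)[OF bl] fX(3)[OF la] u] by simp
      qed
      ultimately show "P l h" unfolding P_def by blast
    qed (rule that)
    have "is_cocone (ord_cat r) C X (Dom C p) \<eta>"
      unfolding is_cocone_ord_cat
    proof (intro conjI ballI allI impI)
      show "Dom C p \<in> Obj C" using Dom_Obj p .
      show "\<eta> b \<in> hom C (OMap X b) (Dom C p)" if "b \<in> Field r" for b using \<eta>(1)[OF that] by (simp add: Ys)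
      show "\<eta> b \<cdot> AMap X (d, b) = \<eta> d" if "(d, b) \<in> r" for d b
        using \<eta>(3)[OF that] \<eta>(1)[of d] that Cmp_Ide_left unfolding Ys by (metis FieldI1)
    qed
    then obtain h where h: "h \<in> hom C x (Dom C p)" and hc: "\<And>b. b \<in> Field r \<Longrightarrow> h \<cdot> c b = \<eta> b"
      by (rule ord_colimit_map[OF col]) (rule that)
    have "p \<cdot> h = v"
    proof (rule is_colimit_eq[OF col Cmp_hom[OF h ph] v])
      fix b assume "b \<in> Obj (ord_cat r)"
      then have b: "b \<in> Field r" by simp
      show "p \<cdot> h \<cdot> c b = v \<cdot> c b"
        using Cmp_assoc[OF c[OF b] h ph] hc[OF b] \<eta>(2)[OF b] by (simp add: P_def)
    qed
    moreover have "h \<cdot> c a = u"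
    proof -
      have aa: "(a, a) \<in> r" using a wo(1) by (simp add: refl_on_def)
      then have "\<eta> a = u \<cdot> AMap X (a, a)" using \<eta>(2)[OF a] unfolding P_def by blast
      then show ?thesis using hc[OF a] fX(2)[OF a] Cmp_Ide_right[OF u] by simp
    qed
    ultimately show "\<exists>h \<in> hom C x (Dom C p). h \<cdot> c a = u \<and> p \<cdot> h = v" using h by blast
  qed
qed

end

section \<open>Attaching cells\<close>

lemma is_colimit_legs_cong:
  assumes col: "is_colimit J C X x c" and cd: "\<And>a. a \<in> Obj J \<Longrightarrow> c a = d a"
  shows "is_colimit J C X x d"
proof -
  interpret J: category J using col by (simp add: is_colimit_def is_functor_def)
  have "is_cocone J C X x d"
    using is_colimit_cocone[OF col] cd J.Dom_Obj J.Cod_Obj unfolding is_cocone_def by simp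
  then show ?thesis using col cd unfolding is_colimit_def by simp
qed

text \<open>This is the pushout of the coproduct of all \<open>i t\<close> along the map induced by
  the \<open>u t\<close>, expressed by its universal property so that no coproduct is formed. The
  map \<open>k\<close> includes the old object, and \<open>q t\<close> is the characteristic map of
  the cell \<open>t\<close>.\<close>

definition is_attach ::
  "('o, 'm, 'z) cat_scheme \<Rightarrow> 'k set \<Rightarrow> ('k \<Rightarrow> 'm) \<Rightarrow> ('k \<Rightarrow> 'm) \<Rightarrow> 'm \<Rightarrow> ('k \<Rightarrow> 'm) \<Rightarrow> bool" where
  "is_attach C K i u k q \<longleftrightarrow> k \<in> Arr C \<and>
     (\<forall>t \<in> K. i t \<in> Arr C \<and> u t \<in> hom C (Dom C (i t)) (Dom C k) \<and>
        q t \<in> hom C (Cod C (i t)) (Cod C k) \<and> q t \<cdot>\<^bsub>C\<^esub> i t = k \<cdot>\<^bsub>C\<^esub> u t) \<and>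
     (\<forall>y. \<forall>f \<in> hom C (Dom C k) y. \<forall>g.
        (\<forall>t \<in> K. g t \<in> hom C (Cod C (i t)) y \<and> g t \<cdot>\<^bsub>C\<^esub> i t = f \<cdot>\<^bsub>C\<^esub> u t) \<longrightarrow>
        (\<exists>!w. w \<in> hom C (Cod C k) y \<and> w \<cdot>\<^bsub>C\<^esub> k = f \<and> (\<forall>t \<in> K. w \<cdot>\<^bsub>C\<^esub> q t = g t)))"

lemma is_attachD:
  assumes "is_attach C K i u k q"
  shows "k \<in> Arr C" "\<And>t. t \<in> K \<Longrightarrow> i t \<in> Arr C" "\<And>t. t \<in> K \<Longrightarrow> u t \<in> hom C (Dom C (i t)) (Dom C k)"
    "\<And>t. t \<in> K \<Longrightarrow> q t \<in> hom C (Cod C (i t)) (Cod C k)"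
    "\<And>t. t \<in> K \<Longrightarrow> q t \<cdot>\<^bsub>C\<^esub> i t = k \<cdot>\<^bsub>C\<^esub> u t"
  using assms unfolding is_attach_def by auto

lemma is_attach_map:
  assumes "is_attach C K i u k q" "f \<in> hom C (Dom C k) y"
    "\<And>t. t \<in> K \<Longrightarrow> g t \<in> hom C (Cod C (i t)) y" "\<And>t. t \<in> K \<Longrightarrow> g t \<cdot>\<^bsub>C\<^esub> i t = f \<cdot>\<^bsub>C\<^esub> u t"
  obtains w where "w \<in> hom C (Cod C k) y" "w \<cdot>\<^bsub>C\<^esub> k = f" "\<And>t. t \<in> K \<Longrightarrow> w \<cdot>\<^bsub>C\<^esub> q t = g t"
proof -
  have "\<exists>!w. w \<in> hom C (Cod C k) y \<and> w \<cdot>\<^bsub>C\<^esub> k = f \<and> (\<forall>t \<in> K. w \<cdot>\<^bsub>C\<^esub> q t = g t)"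
    using assms unfolding is_attach_def by blast
  then show ?thesis using that by blast
qed

context category
begin

lemma is_attach_eq:
  assumes att: "is_attach C K i u k q" and w: "w \<in> hom C (Cod C k) y" and w': "w' \<in> hom C (Cod C k) y"
    and eq: "w \<cdot> k = w' \<cdot> k" "\<And>t. t \<in> K \<Longrightarrow> w \<cdot> q t = w' \<cdot> q t"
  shows "w = w'"
proof -
  note a = is_attachD[OF att]
  have k: "k \<in> hom C (Dom C k) (Cod C k)" using a(1) by (rule Arr_hom)
  have wk: "w \<cdot> k \<in> hom C (Dom C k) y" using Cmp_hom[OF k w] .
  have g: "w \<cdot> q t \<in> hom C (Cod C (i t)) y \<and> w \<cdot> q t \<cdot> i t = w \<cdot> k \<cdot> u t" if t: "t \<in> K" for t
  proof -
    have i: "i t \<in> hom C (Dom C (i t)) (Cod C (i t))" using a(2)[OF t] by (rule Arr_hom)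
    show ?thesis
      using Cmp_hom[OF a(4)[OF t] w] Cmp_assoc[OF i a(4)[OF t] w] Cmp_assoc[OF a(3)[OF t] k w] a(5)[OF t] by simp
  qed
  have "\<forall>f \<in> hom C (Dom C k) y. \<forall>g.
        (\<forall>t \<in> K. g t \<in> hom C (Cod C (i t)) y \<and> g t \<cdot> i t = f \<cdot> u t) \<longrightarrow>
        (\<exists>!w. w \<in> hom C (Cod C k) y \<and> w \<cdot> k = f \<and> (\<forall>t \<in> K. w \<cdot> q t = g t))"
    using att unfolding is_attach_def by blast
  from this[rule_format, OF wk, of "\<lambda>t. w \<cdot> q t"]
  have "\<exists>!v. v \<in> hom C (Cod C k) y \<and> v \<cdot> k = w \<cdot> k \<and> (\<forall>t \<in> K. v \<cdot> q t = w \<cdot> q t)" using g by blast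
  then show ?thesis using w w' eq by metis
qed

text \<open>The pushout is taken as one colimit over a preorder shaped like a star: a span for each
  cell, all of them meeting in the common vertex \<open>None\<close>.\<close>

lemma attach_exists:
  fixes \<kappa> :: "'u rel" and K :: "'k set"
  assumes coc: "cocomplete \<kappa> C" and reg: "regular_cardinal \<kappa>" and sm: "small \<kappa> K" and Z: "Z \<in> Obj C"
    and i: "\<And>t. t \<in> K \<Longrightarrow> i t \<in> Arr C" and u: "\<And>t. t \<in> K \<Longrightarrow> u t \<in> hom C (Dom C (i t)) Z"
  obtains k q where "is_attach C K i u k q" "Dom C k = Z"
proof -
  \<comment> \<open>\<open>None\<close> stands for \<open>Z\<close>, and
    \<open>Some (t, False)\<close>, \<open>Some (t, True)\<close> stand for the domain and the
    codomain of the generator \<open>i t\<close>.\<close>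
  define Ob where "Ob = insert None (Some ` (K \<times> (UNIV :: bool set)))"
  define r where "r = Id_on Ob \<union> ((\<lambda>t. (Some (t, False), None)) ` K \<union> (\<lambda>t. (Some (t, False), Some (t, True))) ` K)"
  have F: "Field r = Ob"
  proof
    show "Field r \<subseteq> Ob" unfolding r_def Ob_def Field_def by auto
    have "(a, a) \<in> r" if "a \<in> Ob" for a using that unfolding r_def by blast
    then show "Ob \<subseteq> Field r" by (auto intro: FieldI1)
  qed
  have r: "Refl r" "trans r"
    unfolding F unfolding r_def refl_on_def trans_def Ob_def by auto
  have "small \<kappa> Ob"
  proof -
    have "small \<kappa> (K \<times> (UNIV :: bool set))" by (intro small_Sigma[OF reg sm] small_finite[OF reg]) simp
    \<comment> \<open>A binary union is presented as a union over two truth values, so that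
      \<open>small_UN\<close> applies.\<close>
    moreover have "small \<kappa> (\<Union>x \<in> {True, False}. if x then {None} else Some ` (K \<times> (UNIV :: bool set)))"
      by (rule small_UN[OF reg]) (auto intro: small_finite[OF reg] small_image calculation)
    moreover have "(\<Union>x \<in> {True, False}. if x then {None} else Some ` (K \<times> (UNIV :: bool set))) = Ob"
      by (auto simp: Ob_def)
    ultimately show ?thesis by simp
  qed
  then have "small \<kappa> (Ob \<times> Ob)" by (intro small_Sigma[OF reg])
  moreover have "r \<subseteq> Ob \<times> Ob" unfolding r_def Ob_def by auto
  ultimately have smr: "small \<kappa> (Arr (ord_cat r))" using small_subset by simp
  define D where "D = \<lparr>OMap = (\<lambda>j. case j of None \<Rightarrow> Z | Some (t, b) \<Rightarrow> if b then Cod C (i t) else Dom C (i t)),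
    AMap = (\<lambda>(j, j' :: ('k \<times> bool) option). case j of None \<Rightarrow> Ide C Z | Some (t, b) \<Rightarrow> if b then Ide C (Cod C (i t)) else
      (case j' of None \<Rightarrow> u t | Some (t', b') \<Rightarrow> if b' then i t else Ide C (Dom C (i t))))\<rparr>"
  have D: "OMap D None = Z" "OMap D (Some (t, False)) = Dom C (i t)" "OMap D (Some (t, True)) = Cod C (i t)"
    "AMap D (None, None) = Ide C Z" "AMap D (Some (t, True), Some (t', True)) = Ide C (Cod C (i t))"
    "AMap D (Some (t, False), Some (t', False)) = Ide C (Dom C (i t))"
    "AMap D (Some (t, False), None) = u t" "AMap D (Some (t, False), Some (t', True)) = i t" for t t'
    by (simp_all add: D_def)
  have ih: "i t \<in> hom C (Dom C (i t)) (Cod C (i t))" if "t \<in> K" for t using i[OF that] by (rule Arr_hom)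
  have cases: "P a b" if "(a, b) \<in> r" "P None None" "\<And>t x. t \<in> K \<Longrightarrow> P (Some (t, x)) (Some (t, x))"
    "\<And>t. t \<in> K \<Longrightarrow> P (Some (t, False)) None" "\<And>t. t \<in> K \<Longrightarrow> P (Some (t, False)) (Some (t, True))" for P a b
    using that unfolding r_def Ob_def by auto
  have ob: "OMap D a \<in> Obj C \<and> AMap D (a, a) = Ide C (OMap D a)" if aO: "a \<in> Ob" for a
  proof (cases a)
    case None then show ?thesis using Z by (simp add: D)
  next
    case (Some p)
    then obtain t x where "a = Some (t, x)" "t \<in> K" using aO unfolding Ob_def by auto
    then show ?thesis using Dom_Obj[OF i] Cod_Obj[OF i] by (cases x) (simp_all add: D)
  qed
  have ar: "AMap D (a, b) \<in> hom C (OMap D a) (OMap D b)" if "(a, b) \<in> r" for a b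
    using that
  proof (rule cases[where P = "\<lambda>a b. AMap D (a, b) \<in> hom C (OMap D a) (OMap D b)"])
    show "AMap D (None, None) \<in> hom C (OMap D None) (OMap D None)" using Ide_hom[OF Z] by (simp add: D)
    fix t assume t: "t \<in> K"
    show "AMap D (Some (t, x), Some (t, x)) \<in> hom C (OMap D (Some (t, x))) (OMap D (Some (t, x)))" for x
      using t Ide_hom[OF Dom_Obj[OF i]] Ide_hom[OF Cod_Obj[OF i]] by (cases x) (simp_all add: D)
  qed (simp_all add: D u ih)
  have "is_functor (ord_cat r) C D"
    unfolding is_functor_ord_cat[OF r] F
  proof (intro conjI ballI allI impI)
    fix a b d assume ab: "(a, b) \<in> r" and bd: "(b, d) \<in> r"
    \<comment> \<open>All arrows other than identities leave a vertex \<open>Some (t, False)\<close>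
      and end in vertices of another kind, so one of two composable arrows is an identity.\<close>
    then consider "a = b" | "b = d" unfolding r_def Ob_def by auto
    then show "AMap D (a, d) = AMap D (b, d) \<cdot> AMap D (a, b)"
    proof cases
      case 1
      then have "AMap D (a, b) = Ide C (OMap D b)" using ob ab F by (auto dest: FieldI1)
      then show ?thesis using 1 ar[OF bd] Cmp_Ide_right by simp
    next
      case 2
      then have "AMap D (b, d) = Ide C (OMap D b)" using ob ab F by (auto dest: FieldI2)
      then show ?thesis using 2 ar[OF ab] Cmp_Ide_left by simp
    qed
  qed (use ob ar in auto)
  then obtain x c where col: "is_colimit (ord_cat r) C D x c" using cocomplete_colimit[OF coc smr] by blast
  have cx: "c b \<in> hom C (OMap D b) x" if "b \<in> Ob" for b using is_colimit_leg[OF col] that F by simp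
  have cc: "c b \<cdot> AMap D (a, b) = c a" if "(a, b) \<in> r" for a b
    using is_colimit_cocone[OF col] that unfolding is_cocone_ord_cat by blast
  define k where "k = c None"
  define q where "q t = c (Some (t, True))" for t
  have k: "k \<in> hom C Z x" using cx[of None] by (simp add: Ob_def k_def D)
  have cf: "k \<cdot> u t = c (Some (t, False))" "q t \<cdot> i t = c (Some (t, False))" if "t \<in> K" for t
    using cc[of "Some (t, False)" None] cc[of "Some (t, False)" "Some (t, True)"] that by (auto simp: r_def k_def q_def D)
  have kd: "Dom C k = Z" "Cod C k = x" "k \<in> Arr C" using k by (auto simp: hom_def)
  have "is_attach C K i u k q"
    unfolding is_attach_def kd
  proof (intro conjI ballI allI impI)
    fix t assume t: "t \<in> K"
    show "i t \<in> Arr C" "u t \<in> hom C (Dom C (i t)) Z" using i u t by auto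
    show "q t \<in> hom C (Cod C (i t)) x" using cx[of "Some (t, True)"] t by (simp add: Ob_def q_def D)
    show "q t \<cdot> i t = k \<cdot> u t" using cf[OF t] by simp
  next
    fix y f g assume f: "f \<in> hom C Z y" and g: "\<forall>t \<in> K. g t \<in> hom C (Cod C (i t)) y \<and> g t \<cdot> i t = f \<cdot> u t"
    define d where "d j = (case j of None \<Rightarrow> f | Some (t, b) \<Rightarrow> if b then g t else f \<cdot> u t)" for j
    have d: "d None = f" "d (Some (t, True)) = g t" "d (Some (t, False)) = f \<cdot> u t" for t by (simp_all add: d_def)
    have dh: "d b \<in> hom C (OMap D b) y" if bO: "b \<in> Ob" for b
    proof (cases b)
      case None then show ?thesis using f by (simp add: D d)
    next
      case (Some p)
      then obtain t x where "b = Some (t, x)" "t \<in> K" using bO unfolding Ob_def by auto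
      then show ?thesis using g Cmp_hom[OF u f] by (cases x) (simp_all add: D d)
    qed
    have "is_cocone (ord_cat r) C D y d"
      unfolding is_cocone_ord_cat F
    proof (intro conjI ballI allI impI)
      show "y \<in> Obj C" using hom_Obj[OF f] by simp
      show "d b \<in> hom C (OMap D b) y" if "b \<in> Ob" for b using dh that .
      fix a b assume ab: "(a, b) \<in> r"
      show "d b \<cdot> AMap D (a, b) = d a"
      proof (cases "a = b")
        case True
        then have "a \<in> Ob" using ab F by (auto dest: FieldI1)
        then show ?thesis using True ob[of a] Cmp_Ide_right[OF dh[of a]] by simp
      next
        case False then show ?thesis using ab g unfolding r_def Ob_def by (auto simp: D d)
      qed
    qed
    then have ex: "\<exists>!h. h \<in> hom C x y \<and> (\<forall>j \<in> Ob. h \<cdot> c j = d j)"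
      using col F unfolding is_colimit_def by simp
    \<comment> \<open>The legs at the vertices \<open>Some (t, False)\<close> are determined by
      \<open>k\<close>, so a cocone amounts to its values on the base and on the codomains.\<close>
    have "(\<forall>j \<in> Ob. h \<cdot> c j = d j) \<longleftrightarrow> h \<cdot> k = f \<and> (\<forall>t \<in> K. h \<cdot> q t = g t)" if h: "h \<in> hom C x y" for h
    proof
      assume "\<forall>j \<in> Ob. h \<cdot> c j = d j"
      then show "h \<cdot> k = f \<and> (\<forall>t \<in> K. h \<cdot> q t = g t)"
        unfolding k_def q_def Ob_def by (auto simp: d)
    next
      assume *: "h \<cdot> k = f \<and> (\<forall>t \<in> K. h \<cdot> q t = g t)"
      have "h \<cdot> c (Some (t, False)) = f \<cdot> u t" if t: "t \<in> K" for t
        using cf(1)[OF t] Cmp_assoc[OF u[OF t] k h] * by simp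
      then have "h \<cdot> c (Some (t, x)) = d (Some (t, x))" if "t \<in> K" for t x
        using that * by (cases x) (simp_all add: d q_def)
      then show "\<forall>j \<in> Ob. h \<cdot> c j = d j"
        using * unfolding k_def Ob_def by (auto simp: d)
    qed
    then show "\<exists>!w. w \<in> hom C x y \<and> w \<cdot> k = f \<and> (\<forall>t \<in> K. w \<cdot> q t = g t)"
      using ex by metis
  qed (use kd in auto)
  then show ?thesis using that kd(1) by blast
qed

text \<open>Lifts are chosen cell by cell and glued by the universal property. Thus simultaneous
  attachment is never rewritten as a transfinite composition of single pushouts.\<close>

lemma is_attach_lift:
  assumes att: "is_attach C K i u k q" and p: "p \<in> Arr C" and lift: "\<And>t. t \<in> K \<Longrightarrow> has_lift C (i t) p"
  shows "has_lift C k p"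
  unfolding has_lift_def
proof (intro ballI impI)
  note a = is_attachD[OF att]
  have k: "k \<in> hom C (Dom C k) (Cod C k)" using a(1) by (rule Arr_hom)
  have ph: "p \<in> hom C (Dom C p) (Cod C p)" using p by (rule Arr_hom)
  fix f v assume f: "f \<in> hom C (Dom C k) (Dom C p)" and v: "v \<in> hom C (Cod C k) (Cod C p)" and eq: "p \<cdot> f = v \<cdot> k"
  have "\<exists>h. h \<in> hom C (Cod C (i t)) (Dom C p) \<and> h \<cdot> i t = f \<cdot> u t \<and> p \<cdot> h = v \<cdot> q t" if t: "t \<in> K" for t
  proof -
    have i: "i t \<in> hom C (Dom C (i t)) (Cod C (i t))" using a(2)[OF t] by (rule Arr_hom)
    have "p \<cdot> (f \<cdot> u t) = v \<cdot> q t \<cdot> i t"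
      using Cmp_assoc[OF a(3)[OF t] f ph] eq Cmp_assoc[OF a(3)[OF t] k v] Cmp_assoc[OF i a(4)[OF t] v] a(5)[OF t] by simp
    then show ?thesis
      using has_liftD[OF lift[OF t] Cmp_hom[OF a(3)[OF t] f] Cmp_hom[OF a(4)[OF t] v]] by blast
  qed
  then obtain g where g: "\<And>t. t \<in> K \<Longrightarrow> g t \<in> hom C (Cod C (i t)) (Dom C p)"
    "\<And>t. t \<in> K \<Longrightarrow> g t \<cdot> i t = f \<cdot> u t" "\<And>t. t \<in> K \<Longrightarrow> p \<cdot> g t = v \<cdot> q t" by metis
  obtain w where w: "w \<in> hom C (Cod C k) (Dom C p)" "w \<cdot> k = f" "\<And>t. t \<in> K \<Longrightarrow> w \<cdot> q t = g t"
    using is_attach_map[OF att f g(1,2)] by blast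
  have "p \<cdot> w = v"
  proof (rule is_attach_eq[OF att Cmp_hom[OF w(1) ph] v])
    show "p \<cdot> w \<cdot> k = v \<cdot> k" using Cmp_assoc[OF k w(1) ph] w(2) eq by simp
    show "p \<cdot> w \<cdot> q t = v \<cdot> q t" if t: "t \<in> K" for t
      using Cmp_assoc[OF a(4)[OF t] w(1) ph] w(3)[OF t] g(3)[OF t] by simp
  qed
  then show "\<exists>h \<in> hom C (Cod C k) (Dom C p). h \<cdot> k = f \<and> p \<cdot> h = v" using w by blast
qed

section \<open>Towers\<close>

text \<open>\<open>S\<close> extends the object \<open>x\<close> reached at stage \<open>b\<close>, \<open>E\<close> extends its map \<open>e\<close> to \<open>w\<close>; \<open>c\<close> stands for
  the maps into \<open>x\<close> from earlier stages.\<close>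

lemma tower_exists:
  fixes \<kappa> r :: "'u rel"
  assumes coc: "cocomplete \<kappa> C" and reg: "regular_cardinal \<kappa>" and wor: "Well_order r" and smr: "small \<kappa> (Field r)"
    and e0: "e0 \<in> hom C x0 w"
    and step: "\<And>b x c e. e \<in> hom C x w \<Longrightarrow> S b x c e \<in> hom C x (Cod C (S b x c e))"
      "\<And>b x c e. e \<in> hom C x w \<Longrightarrow> E b x c e \<in> hom C (Cod C (S b x c e)) w"
      "\<And>b x c e. e \<in> hom C x w \<Longrightarrow> E b x c e \<cdot> S b x c e = e"
  obtains X e where "is_sequence C r X"
    "\<And>b. b \<in> Field r \<Longrightarrow> e b \<in> hom C (OMap X b) w"
    "\<And>a b. (a, b) \<in> r \<Longrightarrow> e b \<cdot> AMap X (a, b) = e a"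
    "\<And>z. z \<in> Field r \<Longrightarrow> underS r z = {} \<Longrightarrow> OMap X z = x0 \<and> e z = e0"
    "\<And>b s. is_succ r b s \<Longrightarrow> AMap X (b, s) = S b (OMap X b) (\<lambda>a. AMap X (a, b)) (e b)"
    "\<And>b s. is_succ r b s \<Longrightarrow> e s = E b (OMap X b) (\<lambda>a. AMap X (a, b)) (e b)"
proof -
  note wo = well_orderD[OF wor]
  note RS = Restr_underS[OF wo(1,2)]
  \<comment> \<open>A table on the stages records an object, the maps into it indexed by their
    source stage, and its augmentation; \<open>diag\<close> reads a diagram off such a
    table.\<close>
  define diag where "diag f = \<lparr>OMap = (\<lambda>a. fst (f a)), AMap = (\<lambda>(a, d). fst (snd (f d)) a)\<rparr>"
    for f :: "'u \<Rightarrow> 'o \<times> ('u \<Rightarrow> 'm) \<times> 'm"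
  define J where "J b = ord_cat (Restr r (underS r b))" for b
  define cl where "cl f b = (SOME xc. is_colimit (J b) C (diag f) (fst xc) (snd xc))" for f b
  \<comment> \<open>The colimit at a limit stage has legs from strictly earlier stages only, and a
    successor stage has composites with the new step; the identity at \<open>d = b\<close> is put in
    by hand in both cases.\<close>
  define H where "H f b = (if underS r b = {} then (x0, (\<lambda>_. Ide C x0), e0)
    else if \<exists>a. is_succ r a b then
      (let a = (THE a. is_succ r a b); k = S a (fst (f a)) (fst (snd (f a))) (snd (snd (f a))) in
        (Cod C k, (\<lambda>d. if d = b then Ide C (Cod C k) else k \<cdot> fst (snd (f a)) d),
          E a (fst (f a)) (fst (snd (f a))) (snd (snd (f a)))))
    else (fst (cl f b), (\<lambda>d. if d = b then Ide C (fst (cl f b)) else snd (cl f b) d),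
        SOME h. h \<in> hom C (fst (cl f b)) w \<and> (\<forall>a \<in> underS r b. h \<cdot> snd (cl f b) a = snd (snd (f a)))))" for f b
  define D where "D = wfrec (r - Id) H"
  define x where "x b = fst (D b)" for b
  define m where "m b = fst (snd (D b))" for b
  define e where "e b = snd (snd (D b))" for b
  have Db: "D b = H (cut D (r - Id) b) b" for b unfolding D_def using wo(5) by (rule wfrec)
  have cut: "cut D (r - Id) b a = D a" if "a \<in> underS r b" for a b
    using that unfolding underS_def by (simp add: cut_def)
  define X where "X = \<lparr>OMap = x, AMap = (\<lambda>(a, b). m b a)\<rparr>"
  have X: "OMap X b = x b" "AMap X (a, b) = m b a" for a b by (simp_all add: X_def)
  have XD: "X = diag D" by (simp add: X_def diag_def x_def[abs_def] m_def[abs_def])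
  define G where "G b \<longleftrightarrow> x b \<in> Obj C \<and> m b b = Ide C (x b) \<and> e b \<in> hom C (x b) w \<and>
    (\<forall>a. (a, b) \<in> r \<longrightarrow> m b a \<in> hom C (x a) (x b) \<and> e b \<cdot> m b a = e a) \<and>
    (\<forall>a d. (a, d) \<in> r \<longrightarrow> (d, b) \<in> r \<longrightarrow> m b a = m b d \<cdot> m d a) \<and>
    (underS r b = {} \<longrightarrow> x b = x0 \<and> e b = e0) \<and>
    (\<forall>a. is_succ r a b \<longrightarrow> m b a = S a (x a) (m a) (e a) \<and> e b = E a (x a) (m a) (e a)) \<and>
    (is_lim r b \<longrightarrow> is_colimit (J b) C X (x b) (m b))" for b
  have refl: "(b, b) \<in> r" if "b \<in> Field r" for b using that wo(1) by (simp add: refl_on_def)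
  have "b \<in> Field r \<longrightarrow> G b" for b
  proof (induction b rule: wf_induct_rule[OF wo(5)])
    case (1 b)
    then have IH: "G a" if "a \<in> underS r b" for a
      using that unfolding underS_def by (auto dest: FieldI1)
    show ?case
    proof
      assume b: "b \<in> Field r"
      then show "G b"
      proof (cases rule: zero_succ_lim_cases)
        case 1
        then have v: "x b = x0" "m b = (\<lambda>_. Ide C x0)" "e b = e0"
          unfolding x_def m_def e_def by (subst Db, simp add: H_def)+
        have "a = b" if "(a, b) \<in> r" for a using 1 that unfolding underS_def by blast
        moreover have "\<not> is_succ r a b" for a using 1 is_succD(3)[OF wor] by blast
        moreover have "\<not> is_lim r b" using 1 by (simp add: is_lim_def)
        moreover have "x0 \<in> Obj C" using hom_Obj[OF e0] by simp
        moreover have "e0 \<cdot> Ide C x0 = e0" "Ide C x0 \<cdot> Ide C x0 = Ide C x0"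
          using Cmp_Ide_right[OF e0] Cmp_Ide_right[OF Ide_hom[OF \<open>x0 \<in> Obj C\<close>]] by auto
        ultimately show ?thesis using v e0 Ide_hom[of x0] unfolding G_def by metis
      next
        case (2 a)
        note a = is_succD[OF wor 2]
        have the: "(THE a. is_succ r a b) = a" using 2 a(5) by blast
        have Ga: "G a" using IH a(3) .
        define k where "k = S a (x a) (m a) (e a)"
        have v: "x b = Cod C k" "m b = (\<lambda>d. if d = b then Ide C (Cod C k) else k \<cdot> m a d)" "e b = E a (x a) (m a) (e a)"
          unfolding x_def m_def e_def k_def using a(3) 2
          by (subst Db, auto simp: H_def Let_def the cut)+
        have ea: "e a \<in> hom C (x a) w" using Ga by (simp add: G_def)
        have k: "k \<in> hom C (x a) (x b)" and eb: "e b \<in> hom C (x b) w" and ek: "e b \<cdot> k = e a"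
          using step[OF ea] unfolding v(1) v(3) k_def by blast+
        have xb: "x b \<in> Obj C" using hom_Obj[OF k] by simp
        have ida: "m a a = Ide C (x a)" using Ga by (simp add: G_def)
        have mba: "m b a = k" using a(2) ida Cmp_Ide_right[OF k] by (simp add: v(2))
        have mb: "m b d = k \<cdot> m a d" if "d \<noteq> b" for d using that by (simp add: v(2))
        have mbb: "m b b = Ide C (x b)" by (simp add: v)
        have ma: "m a d \<in> hom C (x d) (x a)" "e a \<cdot> m a d = e d" if "(d, a) \<in> r" for d
          using Ga that by (auto simp: G_def)
        have hb: "m b d \<in> hom C (x d) (x b) \<and> e b \<cdot> m b d = e d" if db: "(d, b) \<in> r" for d
        proof (cases "d = b")
          case True then show ?thesis using Ide_hom[OF xb] Cmp_Ide_right[OF eb] by (simp add: mbb)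
        next
          case False
          then have da: "(d, a) \<in> r" using a(4) db by blast
          then show ?thesis using mb[OF False] Cmp_hom[OF ma(1)[OF da] k] Cmp_assoc[OF ma(1)[OF da] k eb] ek ma(2)[OF da] by simp
        qed
        have comp: "m b d = m b f \<cdot> m f d" if df: "(d, f) \<in> r" and fb: "(f, b) \<in> r" for d f
        proof (cases "f = b")
          case True then show ?thesis using Cmp_Ide_left[OF conjunct1[OF hb[of d]]] df mbb by simp
        next
          case False
          then have fa: "(f, a) \<in> r" using a(4) fb by blast
          have db: "d \<noteq> b" using False df fb wo(3) unfolding antisym_def by blast
          have mfd: "m f d \<in> hom C (x d) (x f)" using IH[of f] False fb df unfolding underS_def G_def by blast
          have "m a d = m a f \<cdot> m f d" using Ga df fa unfolding G_def by blast
          then show ?thesis using mb[OF db] mb[OF False] Cmp_assoc[OF mfd ma(1)[OF fa] k] by simp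
        qed
        have "\<not> is_lim r b" "underS r b \<noteq> {}" using 2 a(3) by (auto simp: is_lim_def)
        then show ?thesis
          using xb mbb eb hb comp a(5) mba v(3) unfolding G_def k_def by blast
      next
        case 3
        then have ns: "\<nexists>a. is_succ r a b" "underS r b \<noteq> {}" by (auto simp: is_lim_def)
        define xc where "xc = cl (cut D (r - Id) b) b"
        \<comment> \<open>The recursion sees earlier values through \<open>cut\<close>. Below
          \<open>b\<close> they are the final ones, so the colimit chosen during the recursion is a
          colimit of the finished diagram.\<close>
        have cutD: "is_colimit (J b) C (diag (cut D (r - Id) b)) y d \<longleftrightarrow> is_colimit (J b) C X y d" for y d
        proof -
          have o: "OMap (diag (cut D (r - Id) b)) a = OMap X a" if "a \<in> Obj (J b)" for a
            using that cut unfolding XD by (simp add: J_def RS(1) diag_def)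
          have m: "AMap (diag (cut D (r - Id) b)) a = AMap X a" if "a \<in> Arr (J b)" for a
            using that cut unfolding XD by (auto simp: J_def diag_def)
          show ?thesis
            using is_colimit_cong[of "J b" C "diag (cut D (r - Id) b)" y d X, OF _ o m]
              is_colimit_cong[of "J b" C X y d "diag (cut D (r - Id) b)", OF _ o[symmetric] m[symmetric]] by blast
        qed
        have "is_functor (J b) C X"
          unfolding J_def is_functor_ord_cat[OF RS(2,3)] RS(1)
        proof (intro conjI ballI allI impI)
          fix a assume "a \<in> underS r b"
          then have "G a" by (rule IH)
          then show "OMap X a \<in> Obj C" "AMap X (a, a) = Ide C (OMap X a)" by (auto simp: G_def X)
        next
          fix a d assume ad: "(a, d) \<in> Restr r (underS r b)"
          then have "G d" using IH by auto
          then show "AMap X (a, d) \<in> hom C (OMap X a) (OMap X d)" using ad by (auto simp: G_def X)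
          fix f assume "(d, f) \<in> Restr r (underS r b)"
          moreover then have "G f" using IH by auto
          ultimately show "AMap X (a, f) = AMap X (d, f) \<cdot> AMap X (a, d)"
            using ad unfolding G_def X by blast
        qed
        moreover have "small \<kappa> (Arr (J b))"
        proof -
          have "small \<kappa> (Field r \<times> Field r)" by (intro small_Sigma[OF reg] smr)
          moreover have "Arr (J b) \<subseteq> Field r \<times> Field r" by (auto simp: J_def intro: FieldI1 FieldI2)
          ultimately show ?thesis using small_subset by blast
        qed
        ultimately have "\<exists>xc. is_colimit (J b) C X (fst xc) (snd xc)"
          using cocomplete_colimit[OF coc] by (metis fst_conv snd_conv)
        then have xc: "is_colimit (J b) C X (fst xc) (snd xc)"
          unfolding xc_def cl_def cutD by (rule someI_ex)
        define c where "c = snd xc"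
        define P where "P h \<longleftrightarrow> h \<in> hom C (fst xc) w \<and> (\<forall>a \<in> underS r b. h \<cdot> c a = e a)" for h
        have v: "x b = fst xc" "m b = (\<lambda>d. if d = b then Ide C (fst xc) else c d)" "e b = (SOME h. P h)"
          unfolding x_def m_def e_def xc_def P_def c_def using ns cut
          by (subst Db, simp add: H_def Let_def)+
        have mbb: "m b b = Ide C (x b)" by (simp add: v)
        have ne: "a \<noteq> b" if "a \<in> underS r b" for a using that by (simp add: underS_def)
        have col: "is_colimit (J b) C X (x b) (m b)"
          using xc unfolding v(1) by (rule is_colimit_legs_cong) (use ne in \<open>auto simp: v(2) c_def J_def RS(1)\<close>)
        have xb: "x b \<in> Obj C" using is_colimit_cocone[OF col] by (simp add: is_cocone_def)
        have mb: "m b a \<in> hom C (x a) (x b)" if "a \<in> underS r b" for a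
          using is_colimit_leg[OF col, of a] that by (simp add: J_def RS(1) X)
        have mm: "m b a = m b d \<cdot> m d a" if "(a, d) \<in> r" "a \<in> underS r b" "d \<in> underS r b" for a d
          using is_colimit_cocone[OF col] that unfolding J_def is_cocone_ord_cat X by auto
        have "is_cocone (J b) C X w e"
          unfolding J_def is_cocone_ord_cat RS(1) X using IH hom_Obj[OF e0] unfolding G_def by auto
        then obtain h where h: "h \<in> hom C (x b) w" "\<And>a. a \<in> underS r b \<Longrightarrow> h \<cdot> m b a = e a"
          using is_colimit_map[OF col] by (auto simp: J_def RS(1))
        have "\<exists>h. P h" using h ne unfolding P_def v(1,2) by (metis (full_types))
        then have "P (e b)" unfolding v(3) by (rule someI_ex)
        then have eb: "e b \<in> hom C (x b) w" "\<And>a. a \<in> underS r b \<Longrightarrow> e b \<cdot> m b a = e a"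
          using ne unfolding P_def v(1,2) by auto
        have hb: "m b d \<in> hom C (x d) (x b) \<and> e b \<cdot> m b d = e d" if db: "(d, b) \<in> r" for d
        proof (cases "d = b")
          case True then show ?thesis using Ide_hom[OF xb] Cmp_Ide_right[OF eb(1)] by (simp add: mbb)
        next
          case False
          then show ?thesis using db mb eb(2) by (simp add: underS_def)
        qed
        have comp: "m b d = m b f \<cdot> m f d" if df: "(d, f) \<in> r" and fb: "(f, b) \<in> r" for d f
        proof (cases "f = b")
          case True then show ?thesis using Cmp_Ide_left[OF conjunct1[OF hb[of d]]] df mbb by simp
        next
          case False
          moreover have "d \<noteq> b" using False df fb wo(3) unfolding antisym_def by blast
          moreover have "(d, b) \<in> r" using df fb wo(2) by (meson transE)
          ultimately show ?thesis using mm df fb by (simp add: underS_def)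
        qed
        show ?thesis using xb mbb eb(1) hb comp ns col unfolding G_def by blast
      qed
    qed
  qed
  note G = this[rule_format, unfolded G_def]
  have F: "a \<in> Field r \<and> b \<in> Field r" if "(a, b) \<in> r" for a b using that by (auto intro: FieldI1 FieldI2)
  have "is_sequence C r X"
    unfolding is_sequence_def is_functor_ord_cat[OF wo(1,2)] X
  proof (intro conjI allI impI ballI)
    show "is_colimit (ord_cat (Restr r (underS r l))) C X (x l) (\<lambda>b. m l b)" if "is_lim r l" for l
      using G[of l] that unfolding J_def is_lim_def by blast
    show "m c a = m c b \<cdot> m b a" if "(a, b) \<in> r" "(b, c) \<in> r" for a b c
      using G[of c] F[OF that(2)] that by blast
  qed (use wor G F in blast)+
  moreover have "e b \<in> hom C (OMap X b) w" if "b \<in> Field r" for b using G that by (simp add: X)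
  moreover have "e b \<cdot> AMap X (a, b) = e a" if "(a, b) \<in> r" for a b using G[of b] F that by (simp add: X)
  moreover have "OMap X z = x0 \<and> e z = e0" if "z \<in> Field r" "underS r z = {}" for z using G that by (simp add: X)
  moreover have "AMap X (b, s) = S b (OMap X b) (\<lambda>a. AMap X (a, b)) (e b) \<and>
      e s = E b (OMap X b) (\<lambda>a. AMap X (a, b)) (e b)" if "is_succ r b s" for b s
    using G[of s] that unfolding X is_succ_def by simp
  ultimately show ?thesis using that[of X e] by blast
qed

end

section \<open>Closure properties of lifting, and the retract argument\<close>

context category
begin

lemma retract_lift:
  assumes ret: "is_retract C f g" and lift: "has_lift C g p" and p: "p \<in> Arr C"
  shows "has_lift C f p"
proof -
  have f: "f \<in> hom C (Dom C f) (Cod C f)" and g: "g \<in> hom C (Dom C g) (Cod C g)"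
    using ret by (simp_all add: is_retract_def Arr_hom)
  obtain i j r s where i: "i \<in> hom C (Dom C f) (Dom C g)" and j: "j \<in> hom C (Cod C f) (Cod C g)"
    and r: "r \<in> hom C (Dom C g) (Dom C f)" and s: "s \<in> hom C (Cod C g) (Cod C f)"
    and eq: "j \<cdot> f = g \<cdot> i" "s \<cdot> g = f \<cdot> r" "r \<cdot> i = Ide C (Dom C f)" "s \<cdot> j = Ide C (Cod C f)"
    using ret unfolding is_retract_def by (elim conjE bexE) (rule that)
  have ph: "p \<in> hom C (Dom C p) (Cod C p)" using p by (rule Arr_hom)
  show ?thesis
    unfolding has_lift_def
  proof (intro ballI impI)
    fix u v assume u: "u \<in> hom C (Dom C f) (Dom C p)" and v: "v \<in> hom C (Cod C f) (Cod C p)" and uv: "p \<cdot> u = v \<cdot> f"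
    have "p \<cdot> (u \<cdot> r) = v \<cdot> s \<cdot> g"
      using Cmp_assoc[OF r u ph] uv Cmp_assoc[OF r f v] eq(2) Cmp_assoc[OF g s v] by simp
    then obtain h where h: "h \<in> hom C (Cod C g) (Dom C p)" "h \<cdot> g = u \<cdot> r" "p \<cdot> h = v \<cdot> s"
      using has_liftD[OF lift Cmp_hom[OF r u] Cmp_hom[OF s v]] by blast
    have "h \<cdot> j \<cdot> f = u"
      using Cmp_assoc[OF f j h(1)] eq(1) Cmp_assoc[OF i g h(1)] h(2) Cmp_assoc[OF i r u] eq(3) Cmp_Ide_right[OF u] by simp
    moreover have "p \<cdot> (h \<cdot> j) = v"
      using Cmp_assoc[OF j h(1) ph] h(3) Cmp_assoc[OF j s v] eq(4) Cmp_Ide_right[OF v] by simp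
    ultimately show "\<exists>h \<in> hom C (Cod C f) (Dom C p). h \<cdot> f = u \<and> p \<cdot> h = v"
      using Cmp_hom[OF j h(1)] by blast
  qed
qed

lemma pushout_lift:
  assumes po: "is_pushout C i f g k" and lift: "has_lift C i p" and p: "p \<in> Arr C"
  shows "has_lift C k p"
proof -
  have i: "i \<in> hom C (Dom C i) (Cod C i)" and f: "f \<in> hom C (Dom C i) (Cod C f)"
    and g: "g \<in> hom C (Cod C i) (Cod C k)" and k: "k \<in> hom C (Cod C f) (Cod C k)" and eq: "k \<cdot> f = g \<cdot> i"
    and dk: "Dom C k = Cod C f"
    using po unfolding is_pushout_def hom_def by auto
  have ph: "p \<in> hom C (Dom C p) (Cod C p)" using p by (rule Arr_hom)
  have univ: "\<exists>!w. w \<in> hom C (Cod C k) x \<and> w \<cdot> g = u \<and> w \<cdot> k = v"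
    if "u \<in> hom C (Cod C i) x" "v \<in> hom C (Cod C f) x" "v \<cdot> f = u \<cdot> i" for x u v
    using po that unfolding is_pushout_def by blast
  show ?thesis
    unfolding has_lift_def dk
  proof (intro ballI impI)
    fix u v assume u: "u \<in> hom C (Cod C f) (Dom C p)" and v: "v \<in> hom C (Cod C k) (Cod C p)" and uv: "p \<cdot> u = v \<cdot> k"
    have "p \<cdot> (u \<cdot> f) = v \<cdot> g \<cdot> i"
      using Cmp_assoc[OF f u ph] uv Cmp_assoc[OF f k v] eq Cmp_assoc[OF i g v] by simp
    then obtain h where h: "h \<in> hom C (Cod C i) (Dom C p)" "h \<cdot> i = u \<cdot> f" "p \<cdot> h = v \<cdot> g"
      using has_liftD[OF lift Cmp_hom[OF f u] Cmp_hom[OF g v]] by blast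
    obtain w where w: "w \<in> hom C (Cod C k) (Dom C p)" "w \<cdot> g = h" "w \<cdot> k = u"
      using univ[OF h(1) u] h(2) by auto
    have "v \<cdot> k \<cdot> f = v \<cdot> g \<cdot> i"
      using Cmp_assoc[OF f k v] eq Cmp_assoc[OF i g v] by simp
    then have "\<exists>!w. w \<in> hom C (Cod C k) (Cod C p) \<and> w \<cdot> g = v \<cdot> g \<and> w \<cdot> k = v \<cdot> k"
      using univ[OF Cmp_hom[OF g v] Cmp_hom[OF k v]] by blast
    moreover have "p \<cdot> w \<cdot> g = v \<cdot> g" using Cmp_assoc[OF g w(1) ph] w(2) h(3) by simp
    moreover have "p \<cdot> w \<cdot> k = v \<cdot> k" using Cmp_assoc[OF k w(1) ph] w(3) uv by simp
    ultimately have "p \<cdot> w = v" using v Cmp_hom[OF w(1) ph] by metis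
    then show "\<exists>h \<in> hom C (Cod C k) (Dom C p). h \<cdot> k = u \<and> p \<cdot> h = v" using w by blast
  qed
qed

lemma relative_cell_complex_lift:
  fixes \<kappa> :: "'u rel"
  assumes cell: "relative_cell_complex \<kappa> C S f" and p: "p \<in> Arr C" and lift: "\<And>i. i \<in> S \<Longrightarrow> has_lift C i p"
  shows "has_lift C f p"
proof -
  obtain r :: "'u rel" and X x c z where X: "is_sequence_in C (pushouts_of C S) r X" and col: "is_colimit (ord_cat r) C X x c"
    and z: "z \<in> Field r" and f: "f = c z"
    using cell unfolding relative_cell_complex_def transfinite_composition_def by blast
  have "has_lift C k p" if "k \<in> pushouts_of C S" for k
    using that pushout_lift[OF _ lift p] unfolding pushouts_of_def by blast
  then show ?thesis
    unfolding f using X z unfolding is_sequence_in_def by (intro sequence_lift[OF _ col p]) auto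
qed

text \<open>Lifting \<open>f\<close> against \<open>p\<close> with top \<open>i\<close> and bottom
  an identity gives a section of \<open>p\<close> that carries \<open>f\<close> to \<open>i\<close>;
  together with the identity of \<open>Dom C f\<close> it is the retraction. The next lemma is the
  dual.\<close>

lemma retract_argument_left:
  assumes f: "f \<in> Arr C" and i: "i \<in> hom C (Dom C f) z" and p: "p \<in> hom C z (Cod C f)" and eq: "f = p \<cdot> i"
    and lift: "has_lift C f p"
  shows "is_retract C f i"
proof -
  have fh: "f \<in> hom C (Dom C f) (Cod C f)" using f by (rule Arr_hom)
  have ob: "Dom C f \<in> Obj C" "Cod C f \<in> Obj C" using f Dom_Obj Cod_Obj by auto
  have pd: "Dom C p = z" "Cod C p = Cod C f" and di: "Dom C i = Dom C f" "Cod C i = z" "i \<in> Arr C"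
    using p i by (auto simp: hom_def)
  obtain h where h: "h \<in> hom C (Cod C f) z" "h \<cdot> f = i" "p \<cdot> h = Ide C (Cod C f)"
  proof -
    have "p \<cdot> i = Ide C (Cod C f) \<cdot> f" using Cmp_Ide_left[OF fh] eq by simp
    then show ?thesis using that lift i Ide_hom[OF ob(2)] unfolding has_lift_def pd by blast
  qed
  show ?thesis
    unfolding is_retract_def di
    using f di(3) Ide_hom[OF ob(1)] h p eq Cmp_Ide_right[OF i] Cmp_Ide_right[OF fh] Cmp_Ide_right[OF Ide_hom[OF ob(1)]]
    by (metis (no_types, lifting))
qed

lemma retract_argument_right:
  assumes f: "f \<in> Arr C" and i: "i \<in> hom C (Dom C f) z" and p: "p \<in> hom C z (Cod C f)" and eq: "f = p \<cdot> i"
    and lift: "has_lift C i f"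
  shows "is_retract C f p"
proof -
  have fh: "f \<in> hom C (Dom C f) (Cod C f)" using f by (rule Arr_hom)
  have ob: "Dom C f \<in> Obj C" "Cod C f \<in> Obj C" using f Dom_Obj Cod_Obj by auto
  have pd: "Dom C p = z" "Cod C p = Cod C f" "p \<in> Arr C" and di: "Dom C i = Dom C f" "Cod C i = z"
    using p i by (auto simp: hom_def)
  obtain h where h: "h \<in> hom C z (Dom C f)" "h \<cdot> i = Ide C (Dom C f)" "f \<cdot> h = p"
  proof -
    have "f \<cdot> Ide C (Dom C f) = p \<cdot> i" using Cmp_Ide_right[OF fh] eq by simp
    then show ?thesis using that lift p Ide_hom[OF ob(1)] unfolding has_lift_def di by blast
  qed
  show ?thesis
    unfolding is_retract_def pd
    using f pd(3) Ide_hom[OF ob(2)] h i eq Cmp_Ide_left[OF p] Cmp_Ide_left[OF fh] Cmp_Ide_left[OF Ide_hom[OF ob(2)]]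
    by (metis (no_types, lifting))
qed

end

section \<open>Recognition of the classes of a model structure by lifting\<close>

context model_category
begin

text \<open>Factor \<open>f\<close> as an acyclic cofibration followed by a fibration:
  \<open>f\<close> lifts against the second factor and so is a retract of the first. The three
  lemmas that follow vary the factorization and the side.\<close>

lemma acofI:
  assumes f: "f \<in> Arr M" and lift: "\<And>p. p \<in> Fib M \<Longrightarrow> has_lift M f p"
  shows "f \<in> Cof M \<inter> Weq M"
proof -
  obtain z i p where "i \<in> hom M (Dom M f) z" "p \<in> hom M z (Cod M f)" "i \<in> Cof M \<inter> Weq M" "p \<in> Fib M" "f = p \<cdot> i"
    using factorization_acof[OF Arr_hom[OF f]] by blast
  then show ?thesis using retracts[OF retract_argument_left[OF f]] lift by blast
qed

lemma cofI:
  assumes f: "f \<in> Arr M" and lift: "\<And>p. p \<in> Fib M \<Longrightarrow> p \<in> Weq M \<Longrightarrow> has_lift M f p"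
  shows "f \<in> Cof M"
proof -
  obtain z i p where "i \<in> hom M (Dom M f) z" "p \<in> hom M z (Cod M f)" "i \<in> Cof M" "p \<in> Fib M \<inter> Weq M" "f = p \<cdot> i"
    using factorization_afib[OF Arr_hom[OF f]] by blast
  then show ?thesis using retracts[OF retract_argument_left[OF f]] lift by blast
qed

lemma fibI:
  assumes f: "f \<in> Arr M" and lift: "\<And>i. i \<in> Cof M \<Longrightarrow> i \<in> Weq M \<Longrightarrow> has_lift M i f"
  shows "f \<in> Fib M"
proof -
  obtain z i p where "i \<in> hom M (Dom M f) z" "p \<in> hom M z (Cod M f)" "i \<in> Cof M \<inter> Weq M" "p \<in> Fib M" "f = p \<cdot> i"
    using factorization_acof[OF Arr_hom[OF f]] by blast
  then show ?thesis using retracts[OF retract_argument_right[OF f]] lift by blast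
qed

lemma afibI:
  assumes f: "f \<in> Arr M" and lift: "\<And>i. i \<in> Cof M \<Longrightarrow> has_lift M i f"
  shows "f \<in> Fib M \<inter> Weq M"
proof -
  obtain z i p where "i \<in> hom M (Dom M f) z" "p \<in> hom M z (Cod M f)" "i \<in> Cof M" "p \<in> Fib M \<inter> Weq M" "f = p \<cdot> i"
    using factorization_afib[OF Arr_hom[OF f]] by blast
  then show ?thesis using retracts[OF retract_argument_right[OF f]] lift by blast
qed

end

section \<open>Cell towers\<close>

text \<open>A cell \<open>(i, u, v)\<close> is a square from a generator \<open>i\<close> to the augmentation \<open>e\<close>. With \<open>new\<close>,
  only cells whose attaching map \<open>u\<close> does not factor through an earlier stage are admitted.\<close>

definition cells ::
  "('o, 'm, 'z) cat_scheme \<Rightarrow> bool \<Rightarrow> 'u rel \<Rightarrow> 'm set \<Rightarrow> 'o \<Rightarrow> 'u \<Rightarrow> 'o \<Rightarrow> ('u \<Rightarrow> 'm) \<Rightarrow> 'm \<Rightarrow>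
   ('m \<times> 'm \<times> 'm) set" where
  "cells C new r G w b x m e = {(i, u, v). i \<in> G \<and> u \<in> hom C (Dom C i) x \<and> v \<in> hom C (Cod C i) w \<and>
     e \<cdot>\<^bsub>C\<^esub> u = v \<cdot>\<^bsub>C\<^esub> i \<and>
     (new \<longrightarrow> \<not> (\<exists>a \<in> underS r b. \<exists>u' \<in> hom C (Dom C i) (Dom C (m a)). u = m a \<cdot>\<^bsub>C\<^esub> u'))}"

abbreviation stage_cells ::
  "('o, 'm, 'z) cat_scheme \<Rightarrow> bool \<Rightarrow> 'u rel \<Rightarrow> 'm set \<Rightarrow> 'o \<Rightarrow> ('u, 'u \<times> 'u, 'o, 'm) ftor \<Rightarrow>
   ('u \<Rightarrow> 'm) \<Rightarrow> 'u \<Rightarrow> ('m \<times> 'm \<times> 'm) set" where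
  "stage_cells C new r G w X e b \<equiv> cells C new r G w b (OMap X b) (\<lambda>a. AMap X (a, b)) (e b)"

text \<open>The characteristic maps \<open>q\<close> belong to the data, because both monads are
  read off from which cell carries which name. For a terminal \<open>w\<close> the last component of
  a cell is forced, and a cell is just a generator with an attaching map.\<close>

definition is_cell_tower ::
  "('o, 'm, 'z) cat_scheme \<Rightarrow> bool \<Rightarrow> 'u rel \<Rightarrow> 'm set \<Rightarrow> 'o \<Rightarrow> ('u, 'u \<times> 'u, 'o, 'm) ftor \<Rightarrow>
   ('u \<Rightarrow> 'm) \<Rightarrow> ('u \<Rightarrow> 'm \<times> 'm \<times> 'm \<Rightarrow> 'm) \<Rightarrow> bool" where
  "is_cell_tower C new r G w X e q \<longleftrightarrow> is_sequence C r X \<and>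
     (\<forall>b \<in> Field r. e b \<in> hom C (OMap X b) w) \<and>
     (\<forall>a b. (a, b) \<in> r \<longrightarrow> e b \<cdot>\<^bsub>C\<^esub> AMap X (a, b) = e a) \<and>
     (\<forall>b s. is_succ r b s \<longrightarrow>
        is_attach C (stage_cells C new r G w X e b) fst (fst \<circ> snd) (AMap X (b, s)) (q b) \<and>
        (\<forall>t \<in> stage_cells C new r G w X e b. e s \<cdot>\<^bsub>C\<^esub> q b t = snd (snd t)))"

lemma (in category) small_cells:
  assumes reg: "regular_cardinal \<kappa>" and ls: "\<And>a b. a \<in> Obj C \<Longrightarrow> b \<in> Obj C \<Longrightarrow> small \<kappa> (hom C a b)"
    and G: "small \<kappa> G" "G \<subseteq> Arr C" and e: "e \<in> hom C x w"
  shows "small \<kappa> (cells C new r G w b x m e)"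
proof (rule small_subset)
  show "cells C new r G w b x m e \<subseteq> (SIGMA i : G. hom C (Dom C i) x \<times> hom C (Cod C i) w)"
    unfolding cells_def by auto
  show "small \<kappa> (SIGMA i : G. hom C (Dom C i) x \<times> hom C (Cod C i) w)"
    using G hom_Obj[OF e] Dom_Obj Cod_Obj by (intro small_Sigma[OF reg] ls) auto
qed

lemma (in category) cell_tower_exists:
  fixes \<kappa> r :: "'u rel"
  assumes coc: "cocomplete \<kappa> C" and reg: "regular_cardinal \<kappa>"
    and ls: "\<And>a b. a \<in> Obj C \<Longrightarrow> b \<in> Obj C \<Longrightarrow> small \<kappa> (hom C a b)"
    and wor: "Well_order r" and smr: "small \<kappa> (Field r)"
    and G: "small \<kappa> G" "G \<subseteq> Arr C" and e0: "e0 \<in> hom C x0 w"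
  obtains X e q x c where "is_cell_tower C new r G w X e q"
    "\<And>z. z \<in> Field r \<Longrightarrow> underS r z = {} \<Longrightarrow> OMap X z = x0 \<and> e z = e0"
    "is_colimit (ord_cat r) C X x c"
proof -
  define K where "K = cells C new r G w"
  define A where "A b x m e kq \<longleftrightarrow> is_attach C (K b x m e) fst (fst \<circ> snd) (fst kq) (snd kq) \<and> Dom C (fst kq) = x" for b x m e kq
  define S where "S b x m e = (SOME kq. A b x m e kq)" for b x m e
  \<comment> \<open>The augmentation of the next stage restricts to the old one and sends each cell
    to the bottom edge of its square.\<close>
  define B where "B b x m e f \<longleftrightarrow> f \<in> hom C (Cod C (fst (S b x m e))) w \<and> f \<cdot> fst (S b x m e) = e \<and>
    (\<forall>t \<in> K b x m e. f \<cdot> snd (S b x m e) t = snd (snd t))" for b x m e f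
  define E where "E b x m e = (SOME f. B b x m e f)" for b x m e
  have KD: "fst t \<in> Arr C" "(fst \<circ> snd) t \<in> hom C (Dom C (fst t)) x" "snd (snd t) \<in> hom C (Cod C (fst t)) w"
    "snd (snd t) \<cdot> fst t = e \<cdot> (fst \<circ> snd) t" if "t \<in> K b x m e" for t b x m e
    using that G(2) unfolding K_def cells_def by auto
  have S: "A b x m e (S b x m e)" if e: "e \<in> hom C x w" for b x m e
  proof -
    have "small \<kappa> (K b x m e)" unfolding K_def by (intro small_cells[OF reg _ G e] ls)
    then obtain k q where "is_attach C (K b x m e) fst (fst \<circ> snd) k q" "Dom C k = x"
      by (rule attach_exists[OF coc reg _ conjunct1[OF hom_Obj[OF e]] KD(1,2)])
    then have "\<exists>kq. A b x m e kq" unfolding A_def by (intro exI[of _ "(k, q)"]) simp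
    then show ?thesis unfolding S_def by (rule someI_ex)
  qed
  have E: "B b x m e (E b x m e)" if e: "e \<in> hom C x w" for b x m e
  proof -
    have att: "is_attach C (K b x m e) fst (fst \<circ> snd) (fst (S b x m e)) (snd (S b x m e))"
      and d: "Dom C (fst (S b x m e)) = x" using S[OF e] unfolding A_def by auto
    have e': "e \<in> hom C (Dom C (fst (S b x m e))) w" using e d by simp
    obtain f where "f \<in> hom C (Cod C (fst (S b x m e))) w" "f \<cdot> fst (S b x m e) = e"
      "\<And>t. t \<in> K b x m e \<Longrightarrow> f \<cdot> snd (S b x m e) t = snd (snd t)"
      by (rule is_attach_map[OF att e' KD(3,4)], assumption+) (rule that)
    then have "B b x m e f" unfolding B_def by blast
    then show ?thesis unfolding E_def by (rule someI)
  qed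
  have k: "fst (S b x m e) \<in> hom C x (Cod C (fst (S b x m e)))" if e: "e \<in> hom C x w" for b x m e
  proof -
    have "is_attach C (K b x m e) fst (fst \<circ> snd) (fst (S b x m e)) (snd (S b x m e))" "Dom C (fst (S b x m e)) = x"
      using S[OF e] unfolding A_def by auto
    then show ?thesis using is_attachD(1) homI by metis
  qed
  obtain X e where X: "is_sequence C r X"
    "\<And>b. b \<in> Field r \<Longrightarrow> e b \<in> hom C (OMap X b) w"
    "\<And>a b. (a, b) \<in> r \<Longrightarrow> e b \<cdot> AMap X (a, b) = e a"
    "\<And>z. z \<in> Field r \<Longrightarrow> underS r z = {} \<Longrightarrow> OMap X z = x0 \<and> e z = e0"
    "\<And>b s. is_succ r b s \<Longrightarrow> AMap X (b, s) = fst (S b (OMap X b) (\<lambda>a. AMap X (a, b)) (e b))"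
    "\<And>b s. is_succ r b s \<Longrightarrow> e s = E b (OMap X b) (\<lambda>a. AMap X (a, b)) (e b)"
  proof (rule tower_exists[OF coc reg wor smr e0, of "\<lambda>b x m e. fst (S b x m e)" E])
    fix b x m e assume e: "e \<in> hom C x w"
    show "fst (S b x m e) \<in> hom C x (Cod C (fst (S b x m e)))" using k[OF e] .
    show "E b x m e \<in> hom C (Cod C (fst (S b x m e))) w" "E b x m e \<cdot> fst (S b x m e) = e"
      using E[OF e] unfolding B_def by auto
  qed (rule that)
  define q where "q b = snd (S b (OMap X b) (\<lambda>a. AMap X (a, b)) (e b))" for b
  have "is_attach C (stage_cells C new r G w X e b) fst (fst \<circ> snd) (AMap X (b, s)) (q b) \<and>
        (\<forall>t \<in> stage_cells C new r G w X e b. e s \<cdot> q b t = snd (snd t))" if bs: "is_succ r b s" for b s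
  proof -
    have eb: "e b \<in> hom C (OMap X b) w" using X(2) bs by (simp add: is_succ_def)
    show ?thesis using S[OF eb] E[OF eb] unfolding X(5,6)[OF bs] q_def A_def B_def K_def by blast
  qed
  then have "is_cell_tower C new r G w X e q" using X unfolding is_cell_tower_def by blast
  moreover have "small \<kappa> (Arr (ord_cat r))"
  proof -
    have "small \<kappa> (Field r \<times> Field r)" by (intro small_Sigma[OF reg] smr)
    moreover have "r \<subseteq> Field r \<times> Field r" by (auto intro: FieldI1 FieldI2)
    ultimately show ?thesis using small_subset by simp
  qed
  then obtain x c where "is_colimit (ord_cat r) C X x c"
    using cocomplete_colimit[OF coc] is_sequenceD(2)[OF X(1)] by blast
  ultimately show ?thesis using that X(4) by blast
qed

lemma (in category) cell_tower_step_lift: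
  assumes tower: "is_cell_tower C new r G w X e q" and p: "p \<in> Arr C" and lift: "\<And>i. i \<in> G \<Longrightarrow> has_lift C i p"
    and bs: "is_succ r b s"
  shows "has_lift C (AMap X (b, s)) p"
proof -
  have "is_attach C (stage_cells C new r G w X e b) fst (fst \<circ> snd) (AMap X (b, s)) (q b)"
    using tower bs unfolding is_cell_tower_def by blast
  moreover have "has_lift C (fst t) p" if "t \<in> stage_cells C new r G w X e b" for t
    using that lift unfolding cells_def by auto
  ultimately show ?thesis using is_attach_lift[OF _ p] by blast
qed

text \<open>This is surjectivity of the comparison map for a tower whose length is the cardinal
  \<open>l\<close> itself, unfolded to representatives.\<close>

lemma small_relative_factor:
  assumes sm: "small_relative \<kappa> l C S a" and l: "regular_cardinal l" "l <o \<kappa>"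
    and X: "is_sequence_in C S l X" and col: "is_colimit (ord_cat l) C X x c" and u: "u \<in> hom C a x"
  obtains b u' where "b \<in> Field l" "u' \<in> hom C a (OMap X b)" "u = c b \<cdot>\<^bsub>C\<^esub> u'"
proof -
  have wol: "Well_order l" using X by (simp add: is_sequence_in_def is_sequence_def)
  note sX = is_sequenceD[OF conjunct1[OF X[unfolded is_sequence_in_def]]]
  interpret C: category C by (rule sX(3))
  note fX = C.functor_ord_catD[OF sX(1,2)]
  have cc: "c b \<cdot>\<^bsub>C\<^esub> AMap X (a, b) = c a" if "(a, b) \<in> l" for a b
    using is_colimit_cocone[OF col] that unfolding is_cocone_ord_cat by blast
  have ch: "c b \<in> hom C (OMap X b) x" if "b \<in> Field l" for b using is_colimit_leg[OF col] that by simp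
  have "l \<le>o l" using wol by (rule ordLeq_reflexive)
  then have "bij_betw (hom_seq_comparison C c) (hom_seq_colim C l X a) (hom C a x)"
    using sm l X col unfolding small_relative_def by blast
  then obtain Q where Q: "Q \<in> hom_seq_colim C l X a" "u = hom_seq_comparison C c Q"
    using u unfolding bij_betw_def by blast
  then obtain b g where b: "b \<in> Field l" "g \<in> hom C a (OMap X b)" and Qe: "Q = hom_seq_rel C l X a `` {(b, g)}"
    unfolding hom_seq_colim_def quotient_def by auto
  have "(b, b) \<in> l" using b(1) well_orderD(1)[OF wol] by (simp add: refl_on_def)
  then have bQ: "(b, g) \<in> Q" unfolding Qe hom_seq_rel_def using b by auto
  \<comment> \<open>\<open>the_elem\<close> is meaningful only if all representatives of a class
    give the same map into the colimit. They agree at a common later stage \<open>d\<close>, and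
    \<open>c d\<close> carries this to \<open>x\<close>.\<close>
  have "c b' \<cdot>\<^bsub>C\<^esub> g' = c b \<cdot>\<^bsub>C\<^esub> g" if "(b', g') \<in> Q" for b' g'
  proof -
    have "((b, g), (b', g')) \<in> hom_seq_rel C l X a" using that by (simp add: Qe)
    then obtain d where d: "(b, d) \<in> l" "(b', d) \<in> l" "AMap X (b, d) \<cdot>\<^bsub>C\<^esub> g = AMap X (b', d) \<cdot>\<^bsub>C\<^esub> g'"
      and g': "g' \<in> hom C a (OMap X b')" unfolding hom_seq_rel_def by blast
    have dF: "d \<in> Field l" using d(1) by (rule FieldI2)
    have "c d \<cdot>\<^bsub>C\<^esub> (AMap X (b, d) \<cdot>\<^bsub>C\<^esub> g) = c b \<cdot>\<^bsub>C\<^esub> g"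
      using C.Cmp_assoc[OF b(2) fX(3)[OF d(1)] ch[OF dF]] unfolding cc[OF d(1)] by (rule sym)
    moreover have "c d \<cdot>\<^bsub>C\<^esub> (AMap X (b', d) \<cdot>\<^bsub>C\<^esub> g') = c b' \<cdot>\<^bsub>C\<^esub> g'"
      using C.Cmp_assoc[OF g' fX(3)[OF d(2)] ch[OF dF]] unfolding cc[OF d(2)] by (rule sym)
    ultimately show ?thesis using d(3) by simp
  qed
  note eq = this
  have "hom_seq_comparison C c Q = c b \<cdot>\<^bsub>C\<^esub> g"
    unfolding hom_seq_comparison_def
  proof (rule the_elem_image_unique)
    show "Q \<noteq> {}" using bQ by blast
    show "(case p of (b, g) \<Rightarrow> c b \<cdot>\<^bsub>C\<^esub> g) = c b \<cdot>\<^bsub>C\<^esub> g" if "p \<in> Q" for p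
      using eq[of "fst p" "snd p"] that by (simp only: prod.collapse split_beta)
  qed
  then have "u = c b \<cdot>\<^bsub>C\<^esub> g" by (simp add: Q(2))
  then show ?thesis using that b by blast
qed

section \<open>Kleisli triples\<close>

text \<open>A monad in extension form. Both constructions produce a distinguished extension of a map
  \<open>a\<close> \<rightarrow> \<open>T b\<close>, characterized by uniqueness, and this form lets
  each law be an instance of that uniqueness.\<close>

locale kleisli = category +
  fixes T :: "'o \<Rightarrow> 'o" and \<nu> :: "'o \<Rightarrow> 'm" and ext :: "'o \<Rightarrow> 'o \<Rightarrow> 'm \<Rightarrow> 'm"
  assumes unit_hom: "a \<in> Obj C \<Longrightarrow> \<nu> a \<in> hom C a (T a)"
    and ext_hom: "a \<in> Obj C \<Longrightarrow> b \<in> Obj C \<Longrightarrow> f \<in> hom C a (T b) \<Longrightarrow> ext a b f \<in> hom C (T a) (T b)"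
    and ext_unit: "a \<in> Obj C \<Longrightarrow> b \<in> Obj C \<Longrightarrow> f \<in> hom C a (T b) \<Longrightarrow> ext a b f \<cdot> \<nu> a = f"
    and ext_of_unit: "a \<in> Obj C \<Longrightarrow> ext a a (\<nu> a) = Ide C (T a)"
    and ext_ext: "a \<in> Obj C \<Longrightarrow> b \<in> Obj C \<Longrightarrow> d \<in> Obj C \<Longrightarrow> f \<in> hom C a (T b) \<Longrightarrow> g \<in> hom C b (T d) \<Longrightarrow>
      ext b d g \<cdot> ext a b f = ext a d (ext b d g \<cdot> f)"
begin

lemma triple: "\<exists>F \<mu>. is_triple C F \<nu> \<mu> \<and> (\<forall>a. OMap F a = T a)"
proof -
  define F where "F = \<lparr>OMap = T, AMap = (\<lambda>u. ext (Dom C u) (Cod C u) (\<nu> (Cod C u) \<cdot> u))\<rparr>"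
  \<comment> \<open>The multiplication extends the identity, just as the functor extends the unit
    after an arrow.\<close>
  define \<mu> where "\<mu> a = ext (T a) a (Ide C (T a))" for a
  have FO: "OMap F a = T a" for a by (simp add: F_def)
  have FA: "AMap F u = ext a b (\<nu> b \<cdot> u)" if "u \<in> hom C a b" for u a b
    using that by (auto simp: F_def hom_def)
  have TO: "T a \<in> Obj C" if "a \<in> Obj C" for a using hom_Obj[OF unit_hom[OF that]] by simp
  have id: "Ide C (T a) \<in> hom C (T a) (T a)" if "a \<in> Obj C" for a using Ide_hom[OF TO[OF that]] .
  have \<mu>h: "\<mu> a \<in> hom C (T (T a)) (T a)" if "a \<in> Obj C" for a
    unfolding \<mu>_def using ext_hom[OF TO[OF that] that id[OF that]] .
  have nu: "\<nu> b \<cdot> u \<in> hom C a (T b)" if "u \<in> hom C a b" for u a b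
    using Cmp_hom[OF that unit_hom] hom_Obj[OF that] by simp
  have Fh: "AMap F u \<in> hom C (T a) (T b)" if "u \<in> hom C a b" for u a b
    unfolding FA[OF that] using ext_hom[OF _ _ nu[OF that]] hom_Obj[OF that] by simp
  have Fnu: "AMap F u \<cdot> \<nu> a = \<nu> b \<cdot> u" if "u \<in> hom C a b" for u a b
    unfolding FA[OF that] using ext_unit[OF _ _ nu[OF that]] hom_Obj[OF that] by simp
  \<comment> \<open>Extensions absorb the functor on the right. This identity, its special case
    \<open>muF\<close> and its counterpart \<open>Fmu\<close> account for functoriality, naturality
    and associativity.\<close>
  have extF: "ext b d g \<cdot> AMap F u = ext a d (g \<cdot> u)" if u: "u \<in> hom C a b" and g: "g \<in> hom C b (T d)" and d: "d \<in> Obj C" for a b d g u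
  proof -
    have ob: "a \<in> Obj C" "b \<in> Obj C" using hom_Obj[OF u] by auto
    have "ext b d g \<cdot> (\<nu> b \<cdot> u) = g \<cdot> u"
      using Cmp_assoc[OF u unit_hom[OF ob(2)] ext_hom[OF ob(2) d g]] ext_unit[OF ob(2) d g] by simp
    then show ?thesis using ext_ext[OF ob d nu[OF u] g] by (simp add: FA[OF u])
  qed
  have Fcomp: "AMap F (v \<cdot> u) = AMap F v \<cdot> AMap F u" if u: "u \<in> hom C a b" and v: "v \<in> hom C b d" for u v a b d
    using extF[OF u nu[OF v]] hom_Obj[OF v] FA[OF v] FA[OF Cmp_hom[OF u v]] Cmp_assoc[OF u v unit_hom] by simp
  have Fid: "AMap F (Ide C a) = Ide C (T a)" if a: "a \<in> Obj C" for a
    using FA[OF Ide_hom[OF a]] Cmp_Ide_right[OF unit_hom[OF a]] ext_of_unit[OF a] by simp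
  have F: "is_functor C C F"
    unfolding is_functor_def FO
  proof (intro conjI ballI impI)
    fix u v assume "u \<in> Arr C" "v \<in> Arr C" "Cod C u = Dom C v"
    then show "AMap F (v \<cdot> u) = AMap F v \<cdot> AMap F u" using Fcomp Arr_hom by metis
  qed (use category_axioms TO Fid Fh[OF Arr_hom] in auto)
  have id_F: "is_functor C C id_ftor"
    unfolding is_functor_def id_ftor_def using category_axioms Arr_hom by auto
  have FF: "is_functor C C (comp_ftor F F)"
    unfolding is_functor_def comp_ftor_def
  proof (intro conjI ballI impI)
    fix u v assume "u \<in> Arr C" "v \<in> Arr C" "Cod C u = Dom C v"
    then have *: "u \<in> hom C (Dom C u) (Cod C u)" "v \<in> hom C (Cod C u) (Cod C v)" by (auto simp: hom_def)
    show "AMap \<lparr>OMap = OMap F \<circ> OMap F, AMap = AMap F \<circ> AMap F\<rparr> (v \<cdot> u) =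
      AMap \<lparr>OMap = OMap F \<circ> OMap F, AMap = AMap F \<circ> AMap F\<rparr> v \<cdot> AMap \<lparr>OMap = OMap F \<circ> OMap F, AMap = AMap F \<circ> AMap F\<rparr> u"
      using Fcomp[OF *] Fcomp[OF Fh[OF *(1)] Fh[OF *(2)]] by simp
  qed (use category_axioms TO Fid Fh[OF Fh[OF Arr_hom]] FO in auto)
  have nat\<nu>: "is_nat_trans C C id_ftor F \<nu>"
    unfolding is_nat_trans_def using id_F F unit_hom Fnu[OF Arr_hom] by (simp add: id_ftor_def FO)
  have muF: "\<mu> b \<cdot> AMap F u = ext a b u" if "u \<in> hom C a (T b)" "b \<in> Obj C" for a b u
    unfolding \<mu>_def using extF[OF that(1) id[OF that(2)] that(2)] Cmp_Ide_left[OF that(1)] by simp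
  have Fmu: "ext a b f \<cdot> \<mu> a = ext (T a) b (ext a b f)" if f: "f \<in> hom C a (T b)" and b: "b \<in> Obj C" for a b f
  proof -
    have a: "a \<in> Obj C" using hom_Obj[OF f] by simp
    show ?thesis
      unfolding \<mu>_def using ext_ext[OF TO[OF a] a b id[OF a] f] Cmp_Ide_right[OF ext_hom[OF a b f]] by simp
  qed
  have nat\<mu>: "is_nat_trans C C (comp_ftor F F) F \<mu>"
    unfolding is_nat_trans_def
  proof (intro conjI ballI)
    fix u assume "u \<in> Arr C"
    then have u: "u \<in> hom C (Dom C u) (Cod C u)" by (rule Arr_hom)
    have "\<mu> (Cod C u) \<cdot> AMap F (AMap F u) = AMap F u \<cdot> \<mu> (Dom C u)"
      using muF[OF Fh[OF u]] Fmu[OF nu[OF u]] hom_Obj[OF u] FA[OF u] by simp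
    then show "\<mu> (Cod C u) \<cdot> AMap (comp_ftor F F) u = AMap F u \<cdot> \<mu> (Dom C u)" by (simp add: comp_ftor_def)
  qed (use F FF \<mu>h FO in \<open>auto simp: comp_ftor_def\<close>)
  have "\<mu> a \<cdot> AMap F (\<mu> a) = \<mu> a \<cdot> \<mu> (T a) \<and> \<mu> a \<cdot> AMap F (\<nu> a) = Ide C (T a) \<and> \<mu> a \<cdot> \<nu> (T a) = Ide C (T a)"
    if a: "a \<in> Obj C" for a
    using muF[OF \<mu>h[OF a] a] Fmu[OF id[OF a] a] muF[OF unit_hom[OF a] a] ext_of_unit[OF a]
      ext_unit[OF TO[OF a] a id[OF a]] unfolding \<mu>_def by simp
  then have "is_triple C F \<nu> \<mu>" unfolding is_triple_def FO using nat\<nu> nat\<mu> by blast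
  then show ?thesis using FO by blast
qed

end

section \<open>The cofibrant replacement cotriple\<close>

text \<open>\<open>L y\<close> is obtained from an initial object over \<open>y\<close> by attaching, at every stage, all cells.
  A map \<open>g : L y \<rightarrow> y'\<close> has a unique lift \<open>L y \<rightarrow> L y'\<close> sending cells to cells; this
  is the co-Kleisli extension.\<close>

locale cofibrant_towers = category +
  fixes r :: "'u rel" and G :: "'m set" and z0 :: 'o and X :: "'o \<Rightarrow> ('u, 'u \<times> 'u, 'o, 'm) ftor"
    and e :: "'o \<Rightarrow> 'u \<Rightarrow> 'm" and q :: "'o \<Rightarrow> 'u \<Rightarrow> 'm \<times> 'm \<times> 'm \<Rightarrow> 'm"
    and L :: "'o \<Rightarrow> 'o" and c :: "'o \<Rightarrow> 'u \<Rightarrow> 'm"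
  assumes wo: "Well_order r" and no_max: "\<And>b. b \<in> Field r \<Longrightarrow> \<exists>s. is_succ r b s"
    and initial: "z0 \<in> Obj C" "\<And>a. a \<in> Obj C \<Longrightarrow> \<exists>!f. f \<in> hom C z0 a"
    and tower: "\<And>y. y \<in> Obj C \<Longrightarrow> is_cell_tower C False r G y (X y) (e y) (q y)"
    and zero: "\<And>y z. y \<in> Obj C \<Longrightarrow> z \<in> Field r \<Longrightarrow> underS r z = {} \<Longrightarrow> OMap (X y) z = z0"
    and colimit: "\<And>y. y \<in> Obj C \<Longrightarrow> is_colimit (ord_cat r) C (X y) (L y) (c y)"
begin

abbreviation K :: "'o \<Rightarrow> 'u \<Rightarrow> ('m \<times> 'm \<times> 'm) set" where
  "K y b \<equiv> stage_cells C False r G y (X y) (e y) b"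

lemma seq: "y \<in> Obj C \<Longrightarrow> is_sequence C r (X y)"
  using tower by (simp add: is_cell_tower_def)

lemmas fX = functor_ord_catD[OF wo is_sequenceD(2)[OF seq]]

lemma e_hom: "y \<in> Obj C \<Longrightarrow> b \<in> Field r \<Longrightarrow> e y b \<in> hom C (OMap (X y) b) y"
  using tower by (simp add: is_cell_tower_def)

lemma e_nat: "y \<in> Obj C \<Longrightarrow> (a, b) \<in> r \<Longrightarrow> e y b \<cdot> AMap (X y) (a, b) = e y a"
  using tower by (simp add: is_cell_tower_def)

lemma attach: "y \<in> Obj C \<Longrightarrow> is_succ r b s \<Longrightarrow> is_attach C (K y b) fst (fst \<circ> snd) (AMap (X y) (b, s)) (q y b)"
  using tower unfolding is_cell_tower_def by blast

lemma e_cell: "y \<in> Obj C \<Longrightarrow> is_succ r b s \<Longrightarrow> t \<in> K y b \<Longrightarrow> e y s \<cdot> q y b t = snd (snd t)"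
  using tower unfolding is_cell_tower_def by blast

lemma c_hom: "y \<in> Obj C \<Longrightarrow> b \<in> Field r \<Longrightarrow> c y b \<in> hom C (OMap (X y) b) (L y)"
  using is_colimit_leg[OF colimit] by simp

lemma c_nat: "y \<in> Obj C \<Longrightarrow> (a, b) \<in> r \<Longrightarrow> c y b \<cdot> AMap (X y) (a, b) = c y a"
  using is_colimit_cocone[OF colimit] unfolding is_cocone_ord_cat by blast

lemma L_eq:
  assumes "y \<in> Obj C" "h \<in> hom C (L y) x" "k \<in> hom C (L y) x" "\<And>b. b \<in> Field r \<Longrightarrow> h \<cdot> c y b = k \<cdot> c y b"
  shows "h = k"
  using is_colimit_eq[OF colimit assms(2,3)] assms(1,4) by simp

lemma succD:
  assumes "is_succ r b s"
  shows "b \<in> Field r" "s \<in> Field r" "(b, s) \<in> r"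
  using assms is_succD(1)[OF wo assms] by (auto simp: is_succ_def)

lemma cellD:
  assumes "t \<in> K y b"
  shows "fst t \<in> G" "fst (snd t) \<in> hom C (Dom C (fst t)) (OMap (X y) b)" "snd (snd t) \<in> hom C (Cod C (fst t)) y"
    "e y b \<cdot> fst (snd t) = snd (snd t) \<cdot> fst t"
  using assms unfolding cells_def by auto

lemma cellI:
  assumes "i \<in> G" "u \<in> hom C (Dom C i) (OMap (X y) b)" "v \<in> hom C (Cod C i) y" "e y b \<cdot> u = v \<cdot> i"
  shows "(i, u, v) \<in> K y b"
  using assms unfolding cells_def by auto

lemma q_hom:
  assumes "y \<in> Obj C" "is_succ r b s" "t \<in> K y b"
  shows "fst t \<in> hom C (Dom C (fst t)) (Cod C (fst t))" "q y b t \<in> hom C (Cod C (fst t)) (OMap (X y) s)"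
    "q y b t \<cdot> fst t = AMap (X y) (b, s) \<cdot> fst (snd t)"
  using is_attachD[OF attach[OF assms(1,2)] ] assms(3) fX(3)[OF assms(1) succD(3)[OF assms(2)]]
  by (auto simp: hom_def)

lemma counit_ex:
  assumes "y \<in> Obj C"
  shows "\<exists>h. h \<in> hom C (L y) y \<and> (\<forall>b \<in> Field r. h \<cdot> c y b = e y b)"
proof -
  have "is_cocone (ord_cat r) C (X y) y (e y)"
    unfolding is_cocone_ord_cat using assms e_hom e_nat by blast
  then show ?thesis using is_colimit_map[OF colimit[OF assms]] by (metis ord_cat_simps(1))
qed

definition counit :: "'o \<Rightarrow> 'm" where
  "counit y = (SOME h. h \<in> hom C (L y) y \<and> (\<forall>b \<in> Field r. h \<cdot> c y b = e y b))"

lemma counit: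
  assumes "y \<in> Obj C"
  shows "counit y \<in> hom C (L y) y" "\<And>b. b \<in> Field r \<Longrightarrow> counit y \<cdot> c y b = e y b"
  using someI_ex[OF counit_ex[OF assms]] unfolding counit_def by auto

text \<open>The last clause sends a cell to the cell of the same stage with the same generator and
  with the attaching map pushed forward along \<open>\<eta> b\<close>. The map \<open>g\<close> is
  defined on \<open>L y\<close> only, so the bottom edge of the new square is the image of the cell
  in \<open>L y\<close> followed by \<open>g\<close>.\<close>

definition levelwise :: "'o \<Rightarrow> 'o \<Rightarrow> 'm \<Rightarrow> ('u \<Rightarrow> 'm) \<Rightarrow> bool" where
  "levelwise y y' g \<eta> \<longleftrightarrow>
     (\<forall>b \<in> Field r. \<eta> b \<in> hom C (OMap (X y) b) (OMap (X y') b) \<and> e y' b \<cdot> \<eta> b = g \<cdot> c y b) \<and>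
     (\<forall>a b. (a, b) \<in> r \<longrightarrow> \<eta> b \<cdot> AMap (X y) (a, b) = AMap (X y') (a, b) \<cdot> \<eta> a) \<and>
     (\<forall>b s. is_succ r b s \<longrightarrow> (\<forall>t \<in> K y b.
        \<eta> s \<cdot> q y b t = q y' b (fst t, \<eta> b \<cdot> fst (snd t), g \<cdot> (c y s \<cdot> q y b t))))"

text \<open>Every commuting square over \<open>y'\<close> is a cell of this tower, so commutation is
  all that must be checked. Under the novelty condition this would break down: the image of a new
  attaching map may factor through an earlier stage.\<close>

lemma levelwise_cell:
  assumes y: "y \<in> Obj C" "y' \<in> Obj C" and g: "g \<in> hom C (L y) y'" and bs: "is_succ r b s" and t: "t \<in> K y b"
    and h: "h \<in> hom C (OMap (X y) b) (OMap (X y') b)" and P: "e y' b \<cdot> h = g \<cdot> c y b"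
  shows "(fst t, h \<cdot> fst (snd t), g \<cdot> (c y s \<cdot> q y b t)) \<in> K y' b"
proof (rule cellI)
  note s = succD[OF bs] and tD = cellD[OF t] and qh = q_hom[OF y(1) bs t]
  note cq = Cmp_hom[OF qh(2) c_hom[OF y(1) s(2)]]
  show "fst t \<in> G" by (rule tD)
  show "h \<cdot> fst (snd t) \<in> hom C (Dom C (fst t)) (OMap (X y') b)" using Cmp_hom[OF tD(2) h] .
  show "g \<cdot> (c y s \<cdot> q y b t) \<in> hom C (Cod C (fst t)) y'" using Cmp_hom[OF cq g] .
  have "c y s \<cdot> q y b t \<cdot> fst t = c y s \<cdot> AMap (X y) (b, s) \<cdot> fst (snd t)"
    using Cmp_assoc[OF qh(1,2) c_hom[OF y(1) s(2)]] qh(3)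
      Cmp_assoc[OF tD(2) fX(3)[OF y(1) s(3)] c_hom[OF y(1) s(2)]] by simp
  also have "\<dots> = c y b \<cdot> fst (snd t)" using c_nat[OF y(1) s(3)] by simp
  finally have "g \<cdot> (c y s \<cdot> q y b t) \<cdot> fst t = g \<cdot> (c y b \<cdot> fst (snd t))"
    using Cmp_assoc[OF qh(1) cq g] by simp
  also have "\<dots> = e y' b \<cdot> (h \<cdot> fst (snd t))"
    using Cmp_assoc[OF tD(2) c_hom[OF y(1) s(1)] g] P Cmp_assoc[OF tD(2) h e_hom[OF y(2) s(1)]] by simp
  finally show "e y' b \<cdot> (h \<cdot> fst (snd t)) = g \<cdot> (c y s \<cdot> q y b t) \<cdot> fst t" by (rule sym)
qed

lemma levelwise_exists:
  assumes y: "y \<in> Obj C" "y' \<in> Obj C" and g: "g \<in> hom C (L y) y'"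
  shows "\<exists>\<eta>. levelwise y y' g \<eta>"
proof -
  define P where "P b h \<longleftrightarrow> e y' b \<cdot> h = g \<cdot> c y b" for b h
  define R where "R b s h h' \<longleftrightarrow> (\<forall>t \<in> K y b. h' \<cdot> q y b t = q y' b (fst t, h \<cdot> fst (snd t), g \<cdot> (c y s \<cdot> q y b t)))" for b s h h'
  obtain \<eta> where \<eta>: "\<And>b. b \<in> Field r \<Longrightarrow> \<eta> b \<in> hom C (OMap (X y) b) (OMap (X y') b)" "\<And>b. b \<in> Field r \<Longrightarrow> P b (\<eta> b)"
    "\<And>a b. (a, b) \<in> r \<Longrightarrow> \<eta> b \<cdot> AMap (X y) (a, b) = AMap (X y') (a, b) \<cdot> \<eta> a"
    "\<And>b s. is_succ r b s \<Longrightarrow> R b s (\<eta> b) (\<eta> s)"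
  proof (rule sequence_map_exists[OF seq[OF y(1)] is_sequenceD(2)[OF seq[OF y(2)]], where P = P and R = R])
    fix z assume z: "z \<in> Field r" "underS r z = {}"
    have z0: "OMap (X y) z = z0" "OMap (X y') z = z0" using zero z y by auto
    have "e y' z \<cdot> Ide C z0 \<in> hom C z0 y'" "g \<cdot> c y z \<in> hom C z0 y'"
      using Cmp_hom[OF Ide_hom e_hom[OF y(2) z(1)]] Cmp_hom[OF c_hom[OF y(1) z(1)] g] initial(1) z0 by auto
    \<comment> \<open>Both towers start at the initial object, so the identity serves at stage zero,
      and the condition over \<open>y'\<close> compares two maps out of an initial object.\<close>
    then have "P z (Ide C z0)" unfolding P_def using initial(2)[OF y(2)] by blast
    then show "\<exists>h \<in> hom C (OMap (X y) z) (OMap (X y') z). P z h" unfolding z0 using Ide_hom[OF initial(1)] by blast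
  next
    fix b s h assume bs: "is_succ r b s" and h: "h \<in> hom C (OMap (X y) b) (OMap (X y') b)" and P: "P b h"
    note s = succD[OF bs]
    define f where "f t = q y' b (fst t, h \<cdot> fst (snd t), g \<cdot> (c y s \<cdot> q y b t))" for t
    note X = fX(3)[OF y(1) s(3)] and X' = fX(3)[OF y(2) s(3)]
    have f: "f t \<in> hom C (Cod C (fst t)) (OMap (X y') s)"
      "f t \<cdot> fst t = AMap (X y') (b, s) \<cdot> h \<cdot> (fst \<circ> snd) t"
      "e y' s \<cdot> f t = g \<cdot> (c y s \<cdot> q y b t)" if t: "t \<in> K y b" for t
    proof -
      note cell = levelwise_cell[OF y g bs t h P[unfolded P_def]]
      note qh = q_hom[OF y(2) bs cell]
      show "f t \<in> hom C (Cod C (fst t)) (OMap (X y') s)" using qh(2) by (simp add: f_def)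
      show "f t \<cdot> fst t = AMap (X y') (b, s) \<cdot> h \<cdot> (fst \<circ> snd) t"
        using qh(3) Cmp_assoc[OF cellD(2)[OF t] h X'] by (simp add: f_def)
      show "e y' s \<cdot> f t = g \<cdot> (c y s \<cdot> q y b t)" using e_cell[OF y(2) bs cell] by (simp add: f_def)
    qed
    note att = attach[OF y(1) bs]
    have XD: "Dom C (AMap (X y) (b, s)) = OMap (X y) b" "Cod C (AMap (X y) (b, s)) = OMap (X y) s"
      using X by (auto simp: hom_def)
    have Xh: "AMap (X y') (b, s) \<cdot> h \<in> hom C (Dom C (AMap (X y) (b, s))) (OMap (X y') s)"
      unfolding XD using Cmp_hom[OF h X'] .
    obtain w where w: "w \<in> hom C (OMap (X y) s) (OMap (X y') s)" "w \<cdot> AMap (X y) (b, s) = AMap (X y') (b, s) \<cdot> h"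
      "\<And>t. t \<in> K y b \<Longrightarrow> w \<cdot> q y b t = f t"
      using is_attach_map[OF att Xh f(1,2)] unfolding XD by metis
    \<comment> \<open>On the old stage this is the induction hypothesis. On a cell it holds because
      the augmentation returns the bottom edge of the named cell, which was chosen to be the value
      of \<open>g\<close>.\<close>
    have "e y' s \<cdot> w = g \<cdot> c y s"
    proof (rule is_attach_eq[OF att, unfolded XD])
      note es = e_hom[OF y(2) s(2)] and cs = c_hom[OF y(1) s(2)]
      show "e y' s \<cdot> w \<in> hom C (OMap (X y) s) y'" "g \<cdot> c y s \<in> hom C (OMap (X y) s) y'"
        using Cmp_hom[OF w(1) es] Cmp_hom[OF cs g] by auto
      have "e y' s \<cdot> w \<cdot> AMap (X y) (b, s) = e y' b \<cdot> h"
        using Cmp_assoc[OF X w(1) es] w(2) Cmp_assoc[OF h X' es] e_nat[OF y(2) s(3)] by simp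
      also have "\<dots> = g \<cdot> c y s \<cdot> AMap (X y) (b, s)"
        using P Cmp_assoc[OF X cs g] c_nat[OF y(1) s(3)] unfolding P_def by simp
      finally show "e y' s \<cdot> w \<cdot> AMap (X y) (b, s) = g \<cdot> c y s \<cdot> AMap (X y) (b, s)" .
      fix t assume t: "t \<in> K y b"
      note qh = q_hom(2)[OF y(1) bs t]
      show "e y' s \<cdot> w \<cdot> q y b t = g \<cdot> c y s \<cdot> q y b t"
        using Cmp_assoc[OF qh w(1) es] w(3)[OF t] f(3)[OF t] Cmp_assoc[OF qh cs g] by simp
    qed
    then show "\<exists>h' \<in> hom C (OMap (X y) s) (OMap (X y') s).
        h' \<cdot> AMap (X y) (b, s) = AMap (X y') (b, s) \<cdot> h \<and> P s h' \<and> R b s h h'"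
      using w unfolding P_def R_def f_def by blast
  next
    fix l h k assume l: "is_lim r l" and h: "h \<in> hom C (OMap (X y) l) (OMap (X y') l)"
      and k: "\<And>b. b \<in> underS r l \<Longrightarrow> k b \<in> hom C (OMap (X y) b) (OMap (X y') b) \<and> P b (k b) \<and>
        h \<cdot> AMap (X y) (b, l) = AMap (X y') (b, l) \<cdot> k b"
    have lF: "l \<in> Field r" using l by (simp add: is_lim_def)
    note el = e_hom[OF y(2) lF] and cl = c_hom[OF y(1) lF]
    have "e y' l \<cdot> h = g \<cdot> c y l"
    proof (rule is_colimit_eq[OF is_sequenceD(4)[OF seq[OF y(1)] l] Cmp_hom[OF h el] Cmp_hom[OF cl g]])
      fix b assume "b \<in> Obj (ord_cat (Restr r (underS r l)))"
      then have b: "b \<in> underS r l" by (simp add: Restr_underS(1)[OF well_orderD(1,2)[OF wo]])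
      then have bl: "(b, l) \<in> r" by (simp add: underS_def)
      have kb: "k b \<in> hom C (OMap (X y) b) (OMap (X y') b)" using k[OF b] by blast
      note X = fX(3)[OF y(1) bl] and X' = fX(3)[OF y(2) bl]
      have "e y' l \<cdot> h \<cdot> AMap (X y) (b, l) = e y' b \<cdot> k b"
        using Cmp_assoc[OF X h el] k[OF b] Cmp_assoc[OF kb X' el] e_nat[OF y(2) bl] by simp
      also have "\<dots> = g \<cdot> c y l \<cdot> AMap (X y) (b, l)"
        using k[OF b] Cmp_assoc[OF X cl g] c_nat[OF y(1) bl] unfolding P_def by simp
      finally show "e y' l \<cdot> h \<cdot> AMap (X y) (b, l) = g \<cdot> c y l \<cdot> AMap (X y) (b, l)" .
    qed
    then show "P l h" unfolding P_def .
  qed (rule that)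
  have "levelwise y y' g \<eta>" unfolding levelwise_def using \<eta> unfolding P_def R_def by blast
  then show ?thesis by blast
qed

text \<open>At zero both components are maps out of an initial object. At a successor naturality
  fixes the map on the old stage, and the naming clause fixes it on the cells in terms of the
  previous component.\<close>

lemma levelwise_unique:
  assumes y: "y \<in> Obj C" "y' \<in> Obj C" and \<eta>: "levelwise y y' g \<eta>" and \<theta>: "levelwise y y' g \<theta>" and b: "b \<in> Field r"
  shows "\<eta> b = \<theta> b"
proof (rule sequence_map_unique[OF seq[OF y(1)] is_sequenceD(2)[OF seq[OF y(2)]] _ _ _ _ _ _ b])
  show \<eta>h: "\<eta> b \<in> hom C (OMap (X y) b) (OMap (X y') b)" if "b \<in> Field r" for b using \<eta> that by (simp add: levelwise_def)
  show \<theta>h: "\<theta> b \<in> hom C (OMap (X y) b) (OMap (X y') b)" if "b \<in> Field r" for b using \<theta> that by (simp add: levelwise_def)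
  show \<eta>n: "\<eta> b \<cdot> AMap (X y) (a, b) = AMap (X y') (a, b) \<cdot> \<eta> a" if "(a, b) \<in> r" for a b
    using \<eta> that by (simp add: levelwise_def)
  show \<theta>n: "\<theta> b \<cdot> AMap (X y) (a, b) = AMap (X y') (a, b) \<cdot> \<theta> a" if "(a, b) \<in> r" for a b
    using \<theta> that by (simp add: levelwise_def)
  show "\<eta> z = \<theta> z" if z: "z \<in> Field r" "underS r z = {}" for z
    using \<eta>h[OF z(1)] \<theta>h[OF z(1)] initial zero[OF y(1) z] zero[OF y(2) z] by auto
  show "\<eta> s = \<theta> s" if bs: "is_succ r b s" and eq: "\<eta> b = \<theta> b" for b s
  proof -
    note s = succD[OF bs]
    have XD: "Dom C (AMap (X y) (b, s)) = OMap (X y) b" "Cod C (AMap (X y) (b, s)) = OMap (X y) s"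
      using fX(3)[OF y(1) s(3)] by (auto simp: hom_def)
    show ?thesis
    proof (rule is_attach_eq[OF attach[OF y(1) bs], unfolded XD])
      show "\<eta> s \<in> hom C (OMap (X y) s) (OMap (X y') s)" "\<theta> s \<in> hom C (OMap (X y) s) (OMap (X y') s)"
        using \<eta>h \<theta>h s by auto
      show "\<eta> s \<cdot> AMap (X y) (b, s) = \<theta> s \<cdot> AMap (X y) (b, s)" using \<eta>n \<theta>n s eq by simp
      show "\<eta> s \<cdot> q y b t = \<theta> s \<cdot> q y b t" if "t \<in> K y b" for t
        using \<eta> \<theta> bs that eq unfolding levelwise_def by simp
    qed
  qed
qed

text \<open>The equation \<open>counit y' \<cdot> h = g\<close> does not determine \<open>h\<close>
  in general; being induced by a levelwise family does.\<close>

definition extends :: "'o \<Rightarrow> 'o \<Rightarrow> 'm \<Rightarrow> 'm \<Rightarrow> bool" where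
  "extends y y' g h \<longleftrightarrow> h \<in> hom C (L y) (L y') \<and>
     (\<exists>\<eta>. levelwise y y' g \<eta> \<and> (\<forall>b \<in> Field r. h \<cdot> c y b = c y' b \<cdot> \<eta> b))"

lemma extends_exists:
  assumes y: "y \<in> Obj C" "y' \<in> Obj C" and g: "g \<in> hom C (L y) y'"
  shows "\<exists>h. extends y y' g h"
proof -
  obtain \<eta> where \<eta>: "levelwise y y' g \<eta>" using levelwise_exists[OF assms] by blast
  have h: "\<eta> b \<in> hom C (OMap (X y) b) (OMap (X y') b)" if "b \<in> Field r" for b using \<eta> that by (simp add: levelwise_def)
  have "is_cocone (ord_cat r) C (X y) (L y') (\<lambda>b. c y' b \<cdot> \<eta> b)"
    unfolding is_cocone_ord_cat
  proof (intro conjI ballI allI impI)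
    show "L y' \<in> Obj C" using is_colimit_cocone[OF colimit[OF y(2)]] by (simp add: is_cocone_def)
    show "c y' b \<cdot> \<eta> b \<in> hom C (OMap (X y) b) (L y')" if "b \<in> Field r" for b
      using Cmp_hom[OF h[OF that] c_hom[OF y(2) that]] .
    fix a b assume ab: "(a, b) \<in> r"
    then have F: "a \<in> Field r" "b \<in> Field r" by (auto intro: FieldI1 FieldI2)
    have "c y' b \<cdot> \<eta> b \<cdot> AMap (X y) (a, b) = c y' b \<cdot> (AMap (X y') (a, b) \<cdot> \<eta> a)"
      using Cmp_assoc[OF fX(3)[OF y(1) ab] h[OF F(2)] c_hom[OF y(2) F(2)]] \<eta> ab by (simp add: levelwise_def)
    also have "\<dots> = c y' a \<cdot> \<eta> a"
      using Cmp_assoc[OF h[OF F(1)] fX(3)[OF y(2) ab] c_hom[OF y(2) F(2)]] c_nat[OF y(2) ab] by simp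
    finally show "c y' b \<cdot> \<eta> b \<cdot> AMap (X y) (a, b) = c y' a \<cdot> \<eta> a" .
  qed
  then obtain h where "h \<in> hom C (L y) (L y')" "\<And>b. b \<in> Field r \<Longrightarrow> h \<cdot> c y b = c y' b \<cdot> \<eta> b"
    by (rule ord_colimit_map[OF colimit[OF y(1)]]) (rule that)
  then show ?thesis using \<eta> unfolding extends_def by blast
qed

lemma extends_unique:
  assumes y: "y \<in> Obj C" "y' \<in> Obj C" and h: "extends y y' g h" and k: "extends y y' g k"
  shows "h = k"
proof -
  obtain \<eta> \<theta> where *: "levelwise y y' g \<eta>" "\<And>b. b \<in> Field r \<Longrightarrow> h \<cdot> c y b = c y' b \<cdot> \<eta> b"
    "levelwise y y' g \<theta>" "\<And>b. b \<in> Field r \<Longrightarrow> k \<cdot> c y b = c y' b \<cdot> \<theta> b"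
    using h k unfolding extends_def by blast
  show ?thesis
  proof (rule L_eq[OF y(1)])
    show "h \<in> hom C (L y) (L y')" "k \<in> hom C (L y) (L y')" using h k by (auto simp: extends_def)
    show "h \<cdot> c y b = k \<cdot> c y b" if "b \<in> Field r" for b
      using *(2)[OF that] *(4)[OF that] levelwise_unique[OF y *(1,3) that] by simp
  qed
qed

lemma extends_counit:
  assumes y: "y \<in> Obj C" "y' \<in> Obj C" and g: "g \<in> hom C (L y) y'" and h: "extends y y' g h"
  shows "counit y' \<cdot> h = g"
proof -
  obtain \<eta> where \<eta>: "levelwise y y' g \<eta>" "\<And>b. b \<in> Field r \<Longrightarrow> h \<cdot> c y b = c y' b \<cdot> \<eta> b"
    and hh: "h \<in> hom C (L y) (L y')" using h unfolding extends_def by blast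
  show ?thesis
  proof (rule L_eq[OF y(1) Cmp_hom[OF hh counit(1)[OF y(2)]] g])
    fix b assume b: "b \<in> Field r"
    have \<eta>b: "\<eta> b \<in> hom C (OMap (X y) b) (OMap (X y') b)" "e y' b \<cdot> \<eta> b = g \<cdot> c y b"
      using \<eta> b by (auto simp: levelwise_def)
    show "counit y' \<cdot> h \<cdot> c y b = g \<cdot> c y b"
      using Cmp_assoc[OF c_hom[OF y(1) b] hh counit(1)[OF y(2)]] \<eta>(2)[OF b]
        Cmp_assoc[OF \<eta>b(1) c_hom[OF y(2) b] counit(1)[OF y(2)]] counit(2)[OF y(2) b] \<eta>b(2) by simp
  qed
qed

lemma L_Obj: "y \<in> Obj C \<Longrightarrow> L y \<in> Obj C"
  using is_colimit_cocone[OF colimit] by (simp add: is_cocone_def)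

text \<open>For \<open>g = counit y\<close> the cell named by \<open>t\<close> is \<open>t\<close>
  itself: the augmentation recovers the bottom edge of \<open>t\<close> from its characteristic
  map.\<close>

lemma extends_of_counit:
  assumes y: "y \<in> Obj C"
  shows "extends y y (counit y) (Ide C (L y))"
proof -
  have "levelwise y y (counit y) (\<lambda>b. Ide C (OMap (X y) b))"
    unfolding levelwise_def
  proof (intro conjI ballI allI impI)
    fix b assume b: "b \<in> Field r"
    show "Ide C (OMap (X y) b) \<in> hom C (OMap (X y) b) (OMap (X y) b)" using Ide_hom[OF fX(1)[OF y b]] .
    show "e y b \<cdot> Ide C (OMap (X y) b) = counit y \<cdot> c y b"
      using Cmp_Ide_right[OF e_hom[OF y b]] counit(2)[OF y b] by simp
  next
    fix a b assume ab: "(a, b) \<in> r"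
    show "Ide C (OMap (X y) b) \<cdot> AMap (X y) (a, b) = AMap (X y) (a, b) \<cdot> Ide C (OMap (X y) a)"
      using Cmp_Ide_left[OF fX(3)[OF y ab]] Cmp_Ide_right[OF fX(3)[OF y ab]] by simp
  next
    fix b s t assume bs: "is_succ r b s" and t: "t \<in> K y b"
    note s = succD[OF bs] and qh = q_hom[OF y bs t]
    have "counit y \<cdot> (c y s \<cdot> q y b t) = snd (snd t)"
      using Cmp_assoc[OF qh(2) c_hom[OF y s(2)] counit(1)[OF y]] counit(2)[OF y s(2)] e_cell[OF y bs t] by simp
    then show "Ide C (OMap (X y) s) \<cdot> q y b t =
        q y b (fst t, Ide C (OMap (X y) b) \<cdot> fst (snd t), counit y \<cdot> (c y s \<cdot> q y b t))"
      using Cmp_Ide_left[OF qh(2)] Cmp_Ide_left[OF cellD(2)[OF t]] by simp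
  qed
  moreover have "Ide C (L y) \<cdot> c y b = c y b \<cdot> Ide C (OMap (X y) b)" if "b \<in> Field r" for b
    using Cmp_Ide_left[OF c_hom[OF y that]] Cmp_Ide_right[OF c_hom[OF y that]] by simp
  ultimately show ?thesis unfolding extends_def using Ide_hom[OF L_Obj[OF y]] by blast
qed

text \<open>Renaming a cell twice and renaming it once along the composite give the same triple;
  coassociativity rests on this.\<close>

lemma extends_comp:
  assumes y: "y \<in> Obj C" "y' \<in> Obj C" "y'' \<in> Obj C" and g: "g \<in> hom C (L y) y'" and k: "k \<in> hom C (L y') y''"
    and h: "extends y y' g h" and m: "extends y' y'' k m"
  shows "extends y y'' (k \<cdot> h) (m \<cdot> h)"
proof -
  obtain \<eta> where \<eta>: "levelwise y y' g \<eta>" and hc: "\<And>b. b \<in> Field r \<Longrightarrow> h \<cdot> c y b = c y' b \<cdot> \<eta> b"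
    and hh: "h \<in> hom C (L y) (L y')" using h unfolding extends_def by blast
  obtain \<theta> where \<theta>: "levelwise y' y'' k \<theta>" and mc: "\<And>b. b \<in> Field r \<Longrightarrow> m \<cdot> c y' b = c y'' b \<cdot> \<theta> b"
    and mh: "m \<in> hom C (L y') (L y'')" using m unfolding extends_def by blast
  have \<eta>h: "\<eta> b \<in> hom C (OMap (X y) b) (OMap (X y') b)" if "b \<in> Field r" for b using \<eta> that by (simp add: levelwise_def)
  have \<theta>h: "\<theta> b \<in> hom C (OMap (X y') b) (OMap (X y'') b)" if "b \<in> Field r" for b using \<theta> that by (simp add: levelwise_def)
  have "levelwise y y'' (k \<cdot> h) (\<lambda>b. \<theta> b \<cdot> \<eta> b)"
    unfolding levelwise_def
  proof (intro conjI ballI allI impI)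
    fix b assume b: "b \<in> Field r"
    note nb = \<eta>h[OF b] and tb = \<theta>h[OF b] and cb = c_hom[OF y(2) b]
    show "\<theta> b \<cdot> \<eta> b \<in> hom C (OMap (X y) b) (OMap (X y'') b)" using Cmp_hom[OF nb tb] .
    have "e y'' b \<cdot> (\<theta> b \<cdot> \<eta> b) = k \<cdot> c y' b \<cdot> \<eta> b"
      using Cmp_assoc[OF nb tb e_hom[OF y(3) b]] \<theta> b by (simp add: levelwise_def)
    also have "\<dots> = k \<cdot> (h \<cdot> c y b)" using Cmp_assoc[OF nb cb k] hc[OF b] by simp
    finally show "e y'' b \<cdot> (\<theta> b \<cdot> \<eta> b) = k \<cdot> h \<cdot> c y b"
      using Cmp_assoc[OF c_hom[OF y(1) b] hh k] by simp
  next
    fix a b assume ab: "(a, b) \<in> r"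
    then have F: "a \<in> Field r" "b \<in> Field r" by (auto intro: FieldI1 FieldI2)
    have "\<theta> b \<cdot> \<eta> b \<cdot> AMap (X y) (a, b) = \<theta> b \<cdot> (AMap (X y') (a, b) \<cdot> \<eta> a)"
      using Cmp_assoc[OF fX(3)[OF y(1) ab] \<eta>h[OF F(2)] \<theta>h[OF F(2)]] \<eta> ab by (simp add: levelwise_def)
    also have "\<dots> = AMap (X y'') (a, b) \<cdot> \<theta> a \<cdot> \<eta> a"
      using Cmp_assoc[OF \<eta>h[OF F(1)] fX(3)[OF y(2) ab] \<theta>h[OF F(2)]] \<theta> ab by (simp add: levelwise_def)
    finally show "\<theta> b \<cdot> \<eta> b \<cdot> AMap (X y) (a, b) = AMap (X y'') (a, b) \<cdot> (\<theta> a \<cdot> \<eta> a)"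
      using Cmp_assoc[OF \<eta>h[OF F(1)] \<theta>h[OF F(1)] fX(3)[OF y(3) ab]] by simp
  next
    fix b s t assume bs: "is_succ r b s" and t: "t \<in> K y b"
    note s = succD[OF bs] and qh = q_hom[OF y(1) bs t]
    define t' where "t' = (fst t, \<eta> b \<cdot> fst (snd t), g \<cdot> (c y s \<cdot> q y b t))"
    have t': "t' \<in> K y' b"
      unfolding t'_def using \<eta> s(1) by (intro levelwise_cell[OF y(1,2) g bs t]) (auto simp: levelwise_def)
    note qh' = q_hom[OF y(2) bs t'] and cs = c_hom[OF y(1) s(2)] and cs' = c_hom[OF y(2) s(2)]
    have \<eta>q: "\<eta> s \<cdot> q y b t = q y' b t'" using \<eta> bs t unfolding levelwise_def t'_def by blast
    \<comment> \<open>The bottom edges agree because the image of the cell \<open>t\<close> under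
      \<open>h\<close> is the characteristic map of the renamed cell \<open>t'\<close>.\<close>
    have v: "k \<cdot> (c y' s \<cdot> q y' b t') = k \<cdot> h \<cdot> (c y s \<cdot> q y b t)"
    proof -
      have "c y' s \<cdot> q y' b t' = h \<cdot> c y s \<cdot> q y b t"
        using Cmp_assoc[OF qh(2) \<eta>h[OF s(2)] cs'] \<eta>q hc[OF s(2)] by simp
      then show ?thesis
        using Cmp_assoc[OF qh(2) cs hh] Cmp_assoc[OF Cmp_hom[OF qh(2) cs] hh k] by simp
    qed
    have "\<theta> s \<cdot> \<eta> s \<cdot> q y b t = \<theta> s \<cdot> q y' b t'"
      using Cmp_assoc[OF qh(2) \<eta>h[OF s(2)] \<theta>h[OF s(2)]] \<eta>q by simp
    also have "\<dots> = q y'' b (fst t', \<theta> b \<cdot> fst (snd t'), k \<cdot> (c y' s \<cdot> q y' b t'))"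
      using \<theta> bs t' unfolding levelwise_def by blast
    also have "\<dots> = q y'' b (fst t, \<theta> b \<cdot> (\<eta> b \<cdot> fst (snd t)), k \<cdot> h \<cdot> (c y s \<cdot> q y b t))"
      unfolding v by (simp add: t'_def)
    also have "\<theta> b \<cdot> (\<eta> b \<cdot> fst (snd t)) = \<theta> b \<cdot> \<eta> b \<cdot> fst (snd t)"
      using Cmp_assoc[OF cellD(2)[OF t] \<eta>h[OF s(1)] \<theta>h[OF s(1)]] by simp
    finally show "\<theta> s \<cdot> \<eta> s \<cdot> q y b t =
        q y'' b (fst t, \<theta> b \<cdot> \<eta> b \<cdot> fst (snd t), k \<cdot> h \<cdot> (c y s \<cdot> q y b t))" .
  qed
  moreover have "m \<cdot> h \<cdot> c y b = c y'' b \<cdot> (\<theta> b \<cdot> \<eta> b)" if b: "b \<in> Field r" for b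
    using Cmp_assoc[OF c_hom[OF y(1) b] hh mh] hc[OF b] Cmp_assoc[OF \<eta>h[OF b] c_hom[OF y(2) b] mh] mc[OF b]
      Cmp_assoc[OF \<eta>h[OF b] \<theta>h[OF b] c_hom[OF y(3) b]] by simp
  ultimately show ?thesis unfolding extends_def using Cmp_hom[OF hh mh] by blast
qed

definition coext :: "'o \<Rightarrow> 'o \<Rightarrow> 'm \<Rightarrow> 'm" where
  "coext y y' g = (SOME h. extends y y' g h)"

lemma extends_coext:
  assumes "y \<in> Obj C" "y' \<in> Obj C" "g \<in> hom C (L y) y'"
  shows "extends y y' g (coext y y' g)"
  unfolding coext_def using extends_exists[OF assms] by (rule someI_ex)

text \<open>Co-Kleisli extension is Kleisli extension in the opposite category, whence the exchanged
  arguments of \<open>coext\<close>. Each law compares two maps satisfying the same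
  \<open>extends\<close> condition.\<close>

lemma kleisli_op_cat: "kleisli (op_cat C) L counit (\<lambda>a b. coext b a)"
proof (intro kleisli.intro kleisli_axioms.intro, goal_cases)
  case 1 show ?case by (rule category_op_cat)
next
  case (2 a) then show ?case using counit(1) by simp
next
  case (3 a b f) then show ?case using extends_coext[of b a f] by (simp add: extends_def)
next
  case (4 a b f) then show ?case using extends_counit[OF _ _ _ extends_coext, of b a f] by simp
next
  case (5 a) then show ?case
    using extends_unique[OF _ _ extends_coext extends_of_counit, of a] counit(1)[of a] by simp
next
  case (6 a b d f g)
  then have ob: "a \<in> Obj C" "b \<in> Obj C" "d \<in> Obj C" and f: "f \<in> hom C (L b) a" and g: "g \<in> hom C (L d) b" by auto
  note ef = extends_coext[OF ob(2,1) f] and eg = extends_coext[OF ob(3,2) g]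
  have "f \<cdot> coext d b g \<in> hom C (L d) a" using Cmp_hom[OF _ f] eg unfolding extends_def by blast
  then have "coext b a f \<cdot> coext d b g = coext d a (f \<cdot> coext d b g)"
    using extends_unique[OF ob(3,1) extends_comp[OF ob(3,2,1) g f eg ef] extends_coext[OF ob(3,1)]] by blast
  then show ?case by simp
qed

text \<open>The small object argument: the top edge factors through a stage, the resulting square is
  itself a cell of that stage, and its characteristic map at the successor is the lift.\<close>

lemma counit_lift:
  assumes y: "y \<in> Obj C" and i: "i \<in> G"
    and factor: "\<And>u. u \<in> hom C (Dom C i) (L y) \<Longrightarrow> \<exists>b \<in> Field r. \<exists>u' \<in> hom C (Dom C i) (OMap (X y) b). u = c y b \<cdot> u'"
  shows "has_lift C i (counit y)"
proof -
  note eps = counit(1)[OF y]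
  have d: "Dom C (counit y) = L y" "Cod C (counit y) = y" using eps by (auto simp: hom_def)
  show ?thesis
    unfolding has_lift_def d
  proof (intro ballI impI)
    fix u v assume u: "u \<in> hom C (Dom C i) (L y)" and v: "v \<in> hom C (Cod C i) y" and uv: "counit y \<cdot> u = v \<cdot> i"
    obtain b u' where b: "b \<in> Field r" and u': "u' \<in> hom C (Dom C i) (OMap (X y) b)" and eq: "u = c y b \<cdot> u'"
      using factor[OF u] by blast
    obtain s where bs: "is_succ r b s" using no_max[OF b] by blast
    note s = succD[OF bs]
    have "e y b \<cdot> u' = v \<cdot> i" using Cmp_assoc[OF u' c_hom[OF y b] eps] counit(2)[OF y b] uv eq by simp
    then have t: "(i, u', v) \<in> K y b" using cellI[OF i u' v] by blast
    note qh = q_hom[OF y bs t, simplified]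
    note cs = c_hom[OF y s(2)]
    have "c y s \<cdot> q y b (i, u', v) \<cdot> i = u"
      using Cmp_assoc[OF qh(1,2) cs] qh(3) Cmp_assoc[OF u' fX(3)[OF y s(3)] cs] c_nat[OF y s(3)] eq by simp
    moreover have "counit y \<cdot> (c y s \<cdot> q y b (i, u', v)) = v"
      using Cmp_assoc[OF qh(2) cs eps] counit(2)[OF y s(2)] e_cell[OF y bs t] by simp
    ultimately show "\<exists>h \<in> hom C (Cod C i) (L y). h \<cdot> i = u \<and> counit y \<cdot> h = v"
      using Cmp_hom[OF qh(2) cs] by blast
  qed
qed

end

section \<open>Free algebraically fibrant objects\<close>

lemma is_succ_unique:
  assumes "Well_order r" "is_succ r b s" "is_succ r b s'"
  shows "s = s'"
proof (rule ccontr)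
  assume "s \<noteq> s'"
  moreover have "s \<in> Field r" "s' \<in> Field r" and eq: "underS r s = underS r s'"
    using assms(2,3) by (auto simp: is_succ_def)
  ultimately have "s \<in> underS r s' \<or> s' \<in> underS r s"
    using well_orderD(4)[OF assms(1)] unfolding total_on_def underS_def by auto
  then show False unfolding eq[symmetric] using eq by (auto simp: underS_def)
qed

lemma (in category) terminal_eq:
  assumes "terminal C t" "f \<in> hom C a t" "g \<in> hom C a t"
  shows "f = g"
  using assms hom_Obj[OF assms(2)] unfolding terminal_def by blast

text \<open>Each map from the domain of a generator into the tower gives rise to exactly one cell,
  attached at the first stage through which the map factors; so \<open>L y\<close> carries chosen fillers,
  and maps out of \<open>L y\<close> preserving fillers are freely determined on \<open>y\<close>.\<close>

locale free_towers = category +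
  fixes r :: "'u rel" and J :: "'m set" and \<tau> :: 'o and z :: 'u and X :: "'o \<Rightarrow> ('u, 'u \<times> 'u, 'o, 'm) ftor"
    and e :: "'o \<Rightarrow> 'u \<Rightarrow> 'm" and q :: "'o \<Rightarrow> 'u \<Rightarrow> 'm \<times> 'm \<times> 'm \<Rightarrow> 'm"
    and L :: "'o \<Rightarrow> 'o" and c :: "'o \<Rightarrow> 'u \<Rightarrow> 'm"
  assumes wo: "Well_order r" and no_max: "\<And>b. b \<in> Field r \<Longrightarrow> \<exists>s. is_succ r b s"
    and z: "z \<in> Field r" "underS r z = {}" and terminal: "terminal C \<tau>" and J: "J \<subseteq> Arr C"
    and tower: "\<And>y. y \<in> Obj C \<Longrightarrow> is_cell_tower C True r J \<tau> (X y) (e y) (q y)"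
    and zero: "\<And>y. y \<in> Obj C \<Longrightarrow> OMap (X y) z = y"
    and colimit: "\<And>y. y \<in> Obj C \<Longrightarrow> is_colimit (ord_cat r) C (X y) (L y) (c y)"
    and mono: "\<And>y b. y \<in> Obj C \<Longrightarrow> b \<in> Field r \<Longrightarrow> monic C (c y b)"
    and factor: "\<And>y j u. y \<in> Obj C \<Longrightarrow> j \<in> J \<Longrightarrow> u \<in> hom C (Dom C j) (L y) \<Longrightarrow>
      \<exists>b \<in> Field r. \<exists>u' \<in> hom C (Dom C j) (OMap (X y) b). u = c y b \<cdot> u'"
begin

abbreviation K :: "'o \<Rightarrow> 'u \<Rightarrow> ('m \<times> 'm \<times> 'm) set" where
  "K y b \<equiv> stage_cells C True r J \<tau> (X y) (e y) b"

lemma seq: "y \<in> Obj C \<Longrightarrow> is_sequence C r (X y)"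
  using tower by (simp add: is_cell_tower_def)

lemmas fX = functor_ord_catD[OF wo is_sequenceD(2)[OF seq]]

lemma e_hom: "y \<in> Obj C \<Longrightarrow> b \<in> Field r \<Longrightarrow> e y b \<in> hom C (OMap (X y) b) \<tau>"
  using tower by (simp add: is_cell_tower_def)

lemma attach: "y \<in> Obj C \<Longrightarrow> is_succ r b s \<Longrightarrow> is_attach C (K y b) fst (fst \<circ> snd) (AMap (X y) (b, s)) (q y b)"
  using tower unfolding is_cell_tower_def by blast

lemma c_hom: "y \<in> Obj C \<Longrightarrow> b \<in> Field r \<Longrightarrow> c y b \<in> hom C (OMap (X y) b) (L y)"
  using is_colimit_leg[OF colimit] by simp

lemma c_nat: "y \<in> Obj C \<Longrightarrow> (a, b) \<in> r \<Longrightarrow> c y b \<cdot> AMap (X y) (a, b) = c y a"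
  using is_colimit_cocone[OF colimit] unfolding is_cocone_ord_cat by blast

lemma c_mono:
  assumes "y \<in> Obj C" "b \<in> Field r" "f \<in> hom C x (OMap (X y) b)" "g \<in> hom C x (OMap (X y) b)" "c y b \<cdot> f = c y b \<cdot> g"
  shows "f = g"
proof -
  have d: "Dom C (c y b) = OMap (X y) b" using c_hom[OF assms(1,2)] by (simp add: hom_def)
  show ?thesis using mono[OF assms(1,2)] assms(3-5) unfolding monic_def d by blast
qed

lemma L_Obj: "y \<in> Obj C \<Longrightarrow> L y \<in> Obj C"
  using is_colimit_cocone[OF colimit] by (simp add: is_cocone_def)

lemma succD:
  assumes "is_succ r b s"
  shows "b \<in> Field r" "s \<in> Field r" "(b, s) \<in> r"
  using assms is_succD(1)[OF wo assms] by (auto simp: is_succ_def)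

lemma cellD:
  assumes "t \<in> K y b"
  shows "fst t \<in> J" "fst (snd t) \<in> hom C (Dom C (fst t)) (OMap (X y) b)" "snd (snd t) \<in> hom C (Cod C (fst t)) \<tau>"
    "\<And>a u'. a \<in> underS r b \<Longrightarrow> u' \<in> hom C (Dom C (fst t)) (Dom C (AMap (X y) (a, b))) \<Longrightarrow>
      fst (snd t) \<noteq> AMap (X y) (a, b) \<cdot> u'"
  using assms unfolding cells_def by auto

lemma q_hom:
  assumes "y \<in> Obj C" "is_succ r b s" "t \<in> K y b"
  shows "fst t \<in> hom C (Dom C (fst t)) (Cod C (fst t))" "q y b t \<in> hom C (Cod C (fst t)) (OMap (X y) s)"
    "q y b t \<cdot> fst t = AMap (X y) (b, s) \<cdot> fst (snd t)"
  using is_attachD[OF attach[OF assms(1,2)]] assms(3) fX(3)[OF assms(1) succD(3)[OF assms(2)]]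
  by (auto simp: hom_def)

section \<open>Chosen fillers on the colimit of a tower\<close>

definition filler :: "'o \<Rightarrow> 'm \<Rightarrow> 'm \<Rightarrow> 'm \<Rightarrow> bool" where
  "filler y j u f \<longleftrightarrow> (\<exists>b s t. is_succ r b s \<and> t \<in> K y b \<and> fst t = j \<and>
     c y b \<cdot> fst (snd t) = u \<and> f = c y s \<cdot> q y b t)"

text \<open>At the least stage through which \<open>u\<close> factors, its factorization is new and
  therefore the attaching map of a cell.\<close>

lemma filler_exists:
  assumes y: "y \<in> Obj C" and j: "j \<in> J" and u: "u \<in> hom C (Dom C j) (L y)"
  shows "\<exists>f. filler y j u f"
proof -
  define B where "B = {b \<in> Field r. \<exists>u' \<in> hom C (Dom C j) (OMap (X y) b). u = c y b \<cdot> u'}"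
  have "B \<noteq> {}" using factor[OF assms] unfolding B_def by blast
  then obtain b where b: "b \<in> B" and min: "\<And>a. (a, b) \<in> r - Id \<Longrightarrow> a \<notin> B"
    using wfE_min[OF well_orderD(5)[OF wo], of _ B] by blast
  then obtain u' where bF: "b \<in> Field r" and u': "u' \<in> hom C (Dom C j) (OMap (X y) b)" and uu': "u = c y b \<cdot> u'"
    unfolding B_def by blast
  have jA: "j \<in> hom C (Dom C j) (Cod C j)" using j J by (intro Arr_hom) blast
  have "\<exists>!f. f \<in> hom C (Cod C j) \<tau>" using terminal hom_Obj[OF jA] by (simp add: terminal_def)
  then obtain v where v: "v \<in> hom C (Cod C j) \<tau>" by blast
  \<comment> \<open>Squares over a terminal object commute for free, so novelty is the only
    condition with content.\<close>
  have "e y b \<cdot> u' = v \<cdot> j"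
    using terminal_eq[OF terminal Cmp_hom[OF u' e_hom[OF y bF]] Cmp_hom[OF jA v]] .
  moreover have "u' \<noteq> AMap (X y) (a, b) \<cdot> w"
    if a: "a \<in> underS r b" and w: "w \<in> hom C (Dom C j) (Dom C (AMap (X y) (a, b)))" for a w
  proof
    assume eq: "u' = AMap (X y) (a, b) \<cdot> w"
    have ab: "(a, b) \<in> r" "a \<noteq> b" and aF: "a \<in> Field r" using a by (auto simp: underS_def intro: FieldI1)
    have X: "AMap (X y) (a, b) \<in> hom C (OMap (X y) a) (OMap (X y) b)" using fX(3)[OF y ab(1)] .
    then have w': "w \<in> hom C (Dom C j) (OMap (X y) a)" using w by (simp add: hom_def)
    have "u = c y a \<cdot> w" using uu' eq Cmp_assoc[OF w' X c_hom[OF y bF]] c_nat[OF y ab(1)] by simp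
    then have "a \<in> B" unfolding B_def using aF w' by blast
    then show False using min ab by blast
  qed
  ultimately have t: "(j, u', v) \<in> K y b" unfolding cells_def using j u' v by blast
  obtain s where s: "is_succ r b s" using no_max[OF bF] by blast
  have "filler y j u (c y s \<cdot> q y b (j, u', v))"
    unfolding filler_def
    by (rule exI[of _ b], rule exI[of _ s], rule exI[of _ "(j, u', v)"]) (use s t uu' in simp)
  then show ?thesis by blast
qed

text \<open>If \<open>b\<close> came strictly before \<open>b'\<close>, cancelling the monic leg
  \<open>c y b'\<close> would make the attaching map of \<open>t'\<close> factor through stage
  \<open>b\<close>, against its novelty.\<close>

lemma cell_stage:
  assumes y: "y \<in> Obj C" and t: "t \<in> K y b" "t' \<in> K y b'" and F: "b \<in> Field r" "b' \<in> Field r"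
    and eq: "fst t = fst t'" "c y b \<cdot> fst (snd t) = c y b' \<cdot> fst (snd t')" and bb': "(b, b') \<in> r"
  shows "b = b'"
proof (rule ccontr)
  assume "b \<noteq> b'"
  then have b: "b \<in> underS r b'" using bb' by (simp add: underS_def)
  note X = fX(3)[OF y bb'] and u = cellD(2)[OF t(1)] and u' = cellD(2)[OF t(2)]
  have "c y b' \<cdot> (AMap (X y) (b, b') \<cdot> fst (snd t)) = c y b' \<cdot> fst (snd t')"
    using Cmp_assoc[OF u X c_hom[OF y F(2)]] c_nat[OF y bb'] eq(2) by simp
  then have "fst (snd t') = AMap (X y) (b, b') \<cdot> fst (snd t)"
    using c_mono[OF y F(2) Cmp_hom[OF u X]] u' eq(1) by simp
  moreover have "fst (snd t) \<in> hom C (Dom C (fst t')) (Dom C (AMap (X y) (b, b')))"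
    using u X eq(1) by (simp add: hom_def)
  ultimately show False using cellD(4)[OF t(2) b] by blast
qed

text \<open>The stage is fixed by \<open>cell_stage\<close>, the attaching map by monicity of the
  leg, and the bottom edge by terminality; so only one cell can name a given
  \<open>u\<close>.\<close>

lemma filler_unique:
  assumes y: "y \<in> Obj C" and f: "filler y j u f" and g: "filler y j u g"
  shows "f = g"
proof -
  obtain b s t where 1: "is_succ r b s" "t \<in> K y b" "fst t = j" "c y b \<cdot> fst (snd t) = u" "f = c y s \<cdot> q y b t"
    using f unfolding filler_def by blast
  obtain b' s' t' where 2: "is_succ r b' s'" "t' \<in> K y b'" "fst t' = j" "c y b' \<cdot> fst (snd t') = u" "g = c y s' \<cdot> q y b' t'"
    using g unfolding filler_def by blast
  note F = succD(1)[OF 1(1)] succD(1)[OF 2(1)]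
  have "(b, b') \<in> r \<or> (b', b) \<in> r" using F well_orderD(1,4)[OF wo] unfolding total_on_def refl_on_def by metis
  then have b: "b' = b"
    using cell_stage[OF y 1(2) 2(2) F] cell_stage[OF y 2(2) 1(2) F(2,1)] 1(3,4) 2(3,4) by auto
  have s: "s' = s" using is_succ_unique[OF wo] 1(1) 2(1) b by blast
  have "fst (snd t) = fst (snd t')"
    using c_mono[OF y F(1)] cellD(2)[OF 1(2)] cellD(2)[OF 2(2)] 1(3,4) 2(3,4) b by simp
  moreover have "snd (snd t) = snd (snd t')"
  proof -
    have "snd (snd t) \<in> hom C (Cod C j) \<tau>" "snd (snd t') \<in> hom C (Cod C j) \<tau>"
      using cellD(3)[OF 1(2)] cellD(3)[OF 2(2)] 1(3) 2(3) by auto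
    then show ?thesis by (rule terminal_eq[OF terminal])
  qed
  ultimately have "t = t'" using 1(3) 2(3) by (simp add: prod_eq_iff)
  then show ?thesis using 1(5) 2(5) b s by simp
qed

definition fill :: "'o \<Rightarrow> 'm \<Rightarrow> 'm \<Rightarrow> 'm" where
  "fill y j u = (SOME f. filler y j u f)"

text \<open>Uniqueness of fillers lets \<open>fill\<close> be evaluated on cells despite its
  definition by choice.\<close>

lemma fill_cell:
  assumes y: "y \<in> Obj C" and bs: "is_succ r b s" and t: "t \<in> K y b"
  shows "fill y (fst t) (c y b \<cdot> fst (snd t)) = c y s \<cdot> q y b t"
proof -
  have "filler y (fst t) (c y b \<cdot> fst (snd t)) (c y s \<cdot> q y b t)" unfolding filler_def using bs t by blast
  then show ?thesis using filler_unique[OF y] someI[of "filler y (fst t) (c y b \<cdot> fst (snd t))"]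
    unfolding fill_def by blast
qed

lemma fill:
  assumes y: "y \<in> Obj C" and j: "j \<in> J" and u: "u \<in> hom C (Dom C j) (L y)"
  shows "fill y j u \<in> hom C (Cod C j) (L y)" "fill y j u \<cdot> j = u"
proof -
  have "filler y j u (fill y j u)" unfolding fill_def using filler_exists[OF assms] by (rule someI_ex)
  then obtain b s t where 1: "is_succ r b s" "t \<in> K y b" "fst t = j" "c y b \<cdot> fst (snd t) = u"
    "fill y j u = c y s \<cdot> q y b t" unfolding filler_def by blast
  note s = succD[OF 1(1)] and qh = q_hom[OF y 1(1,2)]
  note cs = c_hom[OF y s(2)]
  show "fill y j u \<in> hom C (Cod C j) (L y)" using Cmp_hom[OF qh(2) cs] 1(3,5) by simp
  show "fill y j u \<cdot> j = u"
    using Cmp_assoc[OF qh(1,2) cs] qh(3) Cmp_assoc[OF cellD(2)[OF 1(2)] fX(3)[OF y s(3)] cs] c_nat[OF y s(3)] 1(3-5) by simp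
qed

text \<open>These are the homomorphisms between objects with chosen fillers; the following two
  lemmas say that \<open>L y\<close> is free on \<open>y\<close> among the objects
  \<open>L y'\<close>.\<close>

definition preserves :: "'o \<Rightarrow> 'o \<Rightarrow> 'm \<Rightarrow> bool" where
  "preserves y y' h \<longleftrightarrow> h \<in> hom C (L y) (L y') \<and>
     (\<forall>j \<in> J. \<forall>u \<in> hom C (Dom C j) (L y). h \<cdot> fill y j u = fill y' j (h \<cdot> u))"

text \<open>On stage \<open>z\<close> the map is \<open>f\<close>, and each cell is sent to the
  filler that \<open>L y'\<close> has chosen for the image of its attaching map.\<close>

lemma extension_exists:
  assumes y: "y \<in> Obj C" "y' \<in> Obj C" and f: "f \<in> hom C y (L y')"
  shows "\<exists>h. preserves y y' h \<and> h \<cdot> c y z = f"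
proof -
  define Y where "Y = \<lparr>OMap = (\<lambda>_::'u. L y'), AMap = (\<lambda>_::'u \<times> 'u. Ide C (L y'))\<rparr>"
  have Ys: "OMap Y b = L y'" "AMap Y p = Ide C (L y')" for b p by (simp_all add: Y_def)
  have Yf: "is_functor (ord_cat r) C Y"
    unfolding Y_def using functor_const[OF well_orderD(1,2)[OF wo] L_Obj[OF y(2)]] .
  \<comment> \<open>The value is prescribed at the bottom stage alone; later components are governed
    by \<open>R\<close>.\<close>
  define P where "P b h \<longleftrightarrow> b = z \<longrightarrow> h = f" for b h
  define R where "R b s h h' \<longleftrightarrow> (\<forall>t \<in> K y b. h' \<cdot> q y b t = fill y' (fst t) (h \<cdot> fst (snd t)))" for b s :: 'u and h h'
  obtain \<eta> where \<eta>: "\<And>b. b \<in> Field r \<Longrightarrow> \<eta> b \<in> hom C (OMap (X y) b) (OMap Y b)" "\<And>b. b \<in> Field r \<Longrightarrow> P b (\<eta> b)"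
    "\<And>a b. (a, b) \<in> r \<Longrightarrow> \<eta> b \<cdot> AMap (X y) (a, b) = AMap Y (a, b) \<cdot> \<eta> a"
    "\<And>b s. is_succ r b s \<Longrightarrow> R b s (\<eta> b) (\<eta> s)"
  proof (rule sequence_map_exists[OF seq[OF y(1)] Yf, where P = P and R = R])
    fix b assume b: "b \<in> Field r" "underS r b = {}"
    then have "b = z" using zero_unique[OF wo z] by blast
    then show "\<exists>h \<in> hom C (OMap (X y) b) (OMap Y b). P b h" using f zero[OF y(1)] unfolding Ys P_def by auto
  next
    fix b s h assume bs: "is_succ r b s" and h: "h \<in> hom C (OMap (X y) b) (OMap Y b)"
    note s = succD[OF bs] and att = attach[OF y(1) bs]
    have h': "h \<in> hom C (OMap (X y) b) (L y')" using h by (simp add: Ys)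
    have XD: "Dom C (AMap (X y) (b, s)) = OMap (X y) b" "Cod C (AMap (X y) (b, s)) = OMap (X y) s"
      using fX(3)[OF y(1) s(3)] by (auto simp: hom_def)
    \<comment> \<open>The image of an attaching map is a map from the domain of a generator into
      \<open>L y'\<close>, so it has a chosen filler, and this filler commutes with the generator as
      gluing requires.\<close>
    have g: "fill y' (fst t) (h \<cdot> fst (snd t)) \<in> hom C (Cod C (fst t)) (L y')"
      "fill y' (fst t) (h \<cdot> fst (snd t)) \<cdot> fst t = h \<cdot> (fst \<circ> snd) t" if t: "t \<in> K y b" for t
      using fill[OF y(2) cellD(1)[OF t] Cmp_hom[OF cellD(2)[OF t] h']] by auto
    obtain w where w: "w \<in> hom C (OMap (X y) s) (L y')" "w \<cdot> AMap (X y) (b, s) = h"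
      "\<And>t. t \<in> K y b \<Longrightarrow> w \<cdot> q y b t = fill y' (fst t) (h \<cdot> fst (snd t))"
      using is_attach_map[OF att _ g] h' unfolding XD by metis
    have "s \<noteq> z" using is_succD(3)[OF wo bs] z(2) by blast
    then show "\<exists>h' \<in> hom C (OMap (X y) s) (OMap Y s).
        h' \<cdot> AMap (X y) (b, s) = AMap Y (b, s) \<cdot> h \<and> P s h' \<and> R b s h h'"
      using w Cmp_Ide_left[OF h'] unfolding Ys P_def R_def by auto
  next
    fix l h k assume "is_lim r l"
    then have "l \<noteq> z" using z(2) by (auto simp: is_lim_def)
    then show "P l h" unfolding P_def by blast
  qed (rule that)
  have \<eta>h: "\<eta> b \<in> hom C (OMap (X y) b) (L y')" if "b \<in> Field r" for b using \<eta>(1)[OF that] by (simp add: Ys)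
  have "is_cocone (ord_cat r) C (X y) (L y') \<eta>"
    unfolding is_cocone_ord_cat
  proof (intro conjI ballI allI impI)
    show "L y' \<in> Obj C" using L_Obj[OF y(2)] .
    show "\<eta> b \<in> hom C (OMap (X y) b) (L y')" if "b \<in> Field r" for b using \<eta>h that .
    show "\<eta> b \<cdot> AMap (X y) (a, b) = \<eta> a" if ab: "(a, b) \<in> r" for a b
      using \<eta>(3)[OF ab] Cmp_Ide_left[OF \<eta>h[OF FieldI1[OF ab]]] by (simp add: Ys)
  qed
  then obtain h where h: "h \<in> hom C (L y) (L y')" and hc: "\<And>b. b \<in> Field r \<Longrightarrow> h \<cdot> c y b = \<eta> b"
    by (rule ord_colimit_map[OF colimit[OF y(1)]]) (rule that)
  \<comment> \<open>Every \<open>u\<close> is the attaching map of a cell at some stage, so the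
    relation \<open>R\<close> at that stage is preservation at \<open>u\<close>.\<close>
  have "h \<cdot> fill y j u = fill y' j (h \<cdot> u)" if j: "j \<in> J" and u: "u \<in> hom C (Dom C j) (L y)" for j u
  proof -
    obtain b s t where 1: "is_succ r b s" "t \<in> K y b" "fst t = j" "c y b \<cdot> fst (snd t) = u"
      using filler_exists[OF y(1) j u] unfolding filler_def by blast
    note s = succD[OF 1(1)] and qh = q_hom[OF y(1) 1(1,2)]
    have "h \<cdot> fill y j u = h \<cdot> (c y s \<cdot> q y b t)" using fill_cell[OF y(1) 1(1,2)] 1(3,4) by simp
    also have "\<dots> = \<eta> s \<cdot> q y b t" using Cmp_assoc[OF qh(2) c_hom[OF y(1) s(2)] h] hc[OF s(2)] by simp
    also have "\<dots> = fill y' j (\<eta> b \<cdot> fst (snd t))" using \<eta>(4)[OF 1(1)] 1(2,3) unfolding R_def by blast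
    also have "\<eta> b \<cdot> fst (snd t) = h \<cdot> u"
      using Cmp_assoc[OF cellD(2)[OF 1(2)] c_hom[OF y(1) s(1)] h] hc[OF s(1)] 1(4) by simp
    finally show ?thesis .
  qed
  moreover have "h \<cdot> c y z = f" using hc[OF z(1)] \<eta>(2)[OF z(1)] by (simp add: P_def)
  ultimately show ?thesis using h unfolding preserves_def by blast
qed

text \<open>Characteristic maps are chosen fillers. Hence a filler-preserving map is known on the
  cells of a stage once it is known on that stage, and the induction starts from agreement on
  \<open>y\<close>.\<close>

lemma extension_unique:
  assumes y: "y \<in> Obj C" "y' \<in> Obj C" and h: "preserves y y' h" and k: "preserves y y' k"
    and eq: "h \<cdot> c y z = k \<cdot> c y z"
  shows "h = k"
proof -
  define Y where "Y = \<lparr>OMap = (\<lambda>_::'u. L y'), AMap = (\<lambda>_::'u \<times> 'u. Ide C (L y'))\<rparr>"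
  have Ys: "OMap Y b = L y'" "AMap Y p = Ide C (L y')" for b p by (simp_all add: Y_def)
  have Yf: "is_functor (ord_cat r) C Y"
    unfolding Y_def using functor_const[OF well_orderD(1,2)[OF wo] L_Obj[OF y(2)]] .
  have hh: "h \<in> hom C (L y) (L y')" and kh: "k \<in> hom C (L y) (L y')" using h k by (auto simp: preserves_def)
  have hom: "g \<cdot> c y b \<in> hom C (OMap (X y) b) (OMap Y b)" if "g \<in> hom C (L y) (L y')" "b \<in> Field r" for g b
    unfolding Ys using Cmp_hom[OF c_hom[OF y(1) that(2)] that(1)] .
  have nat: "g \<cdot> c y b \<cdot> AMap (X y) (a, b) = AMap Y (a, b) \<cdot> (g \<cdot> c y a)"
    if g: "g \<in> hom C (L y) (L y')" and ab: "(a, b) \<in> r" for g a b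
    using Cmp_assoc[OF fX(3)[OF y(1) ab] c_hom[OF y(1) FieldI2[OF ab]] g] c_nat[OF y(1) ab]
      Cmp_Ide_left[OF Cmp_hom[OF c_hom[OF y(1) FieldI1[OF ab]] g]] by (simp add: Ys)
  have "h \<cdot> c y b = k \<cdot> c y b" if b: "b \<in> Field r" for b
  proof (rule sequence_map_unique[OF seq[OF y(1)] Yf hom[OF hh] hom[OF kh] nat[OF hh] nat[OF kh] _ _ b])
    fix a assume a: "a \<in> Field r" "underS r a = {}"
    then have "a = z" using zero_unique[OF wo z] by blast
    then show "h \<cdot> c y a = k \<cdot> c y a" using eq by simp
  next
    fix b s assume bs: "is_succ r b s" and IH: "h \<cdot> c y b = k \<cdot> c y b"
    note s = succD[OF bs]
    note X = fX(3)[OF y(1) s(3)] and cs = c_hom[OF y(1) s(2)]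
    have XD: "Dom C (AMap (X y) (b, s)) = OMap (X y) b" "Cod C (AMap (X y) (b, s)) = OMap (X y) s"
      using X by (auto simp: hom_def)
    show "h \<cdot> c y s = k \<cdot> c y s"
    proof (rule is_attach_eq[OF attach[OF y(1) bs], unfolded XD])
      show "h \<cdot> c y s \<in> hom C (OMap (X y) s) (L y')" "k \<cdot> c y s \<in> hom C (OMap (X y) s) (L y')"
        using Cmp_hom[OF cs hh] Cmp_hom[OF cs kh] by auto
      show "h \<cdot> c y s \<cdot> AMap (X y) (b, s) = k \<cdot> c y s \<cdot> AMap (X y) (b, s)"
        using Cmp_assoc[OF X cs hh] Cmp_assoc[OF X cs kh] c_nat[OF y(1) s(3)] IH by simp
      fix t assume t: "t \<in> K y b"
      note qh = q_hom(2)[OF y(1) bs t] and u = cellD(2)[OF t] and cb = c_hom[OF y(1) s(1)]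
      have *: "g \<cdot> c y s \<cdot> q y b t = fill y' (fst t) (g \<cdot> c y b \<cdot> fst (snd t))" if g: "preserves y y' g" for g
      proof -
        have gh: "g \<in> hom C (L y) (L y')" using g by (simp add: preserves_def)
        have "g \<cdot> c y s \<cdot> q y b t = g \<cdot> fill y (fst t) (c y b \<cdot> fst (snd t))"
          using Cmp_assoc[OF qh cs gh] fill_cell[OF y(1) bs t] by simp
        also have "\<dots> = fill y' (fst t) (g \<cdot> (c y b \<cdot> fst (snd t)))"
          using g cellD(1)[OF t] Cmp_hom[OF u cb] unfolding preserves_def by blast
        finally show ?thesis using Cmp_assoc[OF u cb gh] by simp
      qed
      show "h \<cdot> c y s \<cdot> q y b t = k \<cdot> c y s \<cdot> q y b t" using *[OF h] *[OF k] IH by simp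
    qed
  qed
  then show ?thesis using is_colimit_eq[OF colimit[OF y(1)] hh kh] by simp
qed

definition extension :: "'o \<Rightarrow> 'o \<Rightarrow> 'm \<Rightarrow> 'm" where
  "extension y y' f = (SOME h. preserves y y' h \<and> h \<cdot> c y z = f)"

lemma extension:
  assumes "y \<in> Obj C" "y' \<in> Obj C" "f \<in> hom C y (L y')"
  shows "preserves y y' (extension y y' f)" "extension y y' f \<in> hom C (L y) (L y')" "extension y y' f \<cdot> c y z = f"
proof -
  have "preserves y y' (extension y y' f) \<and> extension y y' f \<cdot> c y z = f"
    unfolding extension_def using extension_exists[OF assms] by (rule someI_ex)
  then show "preserves y y' (extension y y' f)" "extension y y' f \<in> hom C (L y) (L y')"
    "extension y y' f \<cdot> c y z = f" by (auto simp: preserves_def)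
qed

text \<open>Identities and composites preserve fillers, so each law follows by comparing two
  preserving maps on \<open>y\<close>.\<close>

lemma kleisli: "kleisli C L (\<lambda>y. c y z) extension"
proof
  show unit: "c a z \<in> hom C a (L a)" if "a \<in> Obj C" for a using c_hom[OF that z(1)] zero[OF that] by simp
  fix a b f assume ab: "a \<in> Obj C" "b \<in> Obj C" and f: "f \<in> hom C a (L b)"
  note E = extension[OF ab f]
  show "extension a b f \<in> hom C (L a) (L b)" "extension a b f \<cdot> c a z = f" using E by auto
  fix d g assume d: "d \<in> Obj C" and g: "g \<in> hom C b (L d)"
  note E' = extension[OF ab(2) d g]
  have "extension b d g \<cdot> f \<in> hom C a (L d)" using Cmp_hom[OF f E'(2)] .
  note E'' = extension[OF ab(1) d this]
  show "extension b d g \<cdot> extension a b f = extension a d (extension b d g \<cdot> f)"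
  proof (rule extension_unique[OF ab(1) d _ E''(1)])
    show "preserves a d (extension b d g \<cdot> extension a b f)"
      unfolding preserves_def
    proof (intro conjI ballI)
      show "extension b d g \<cdot> extension a b f \<in> hom C (L a) (L d)" using Cmp_hom[OF E(2) E'(2)] .
      fix j u assume j: "j \<in> J" and u: "u \<in> hom C (Dom C j) (L a)"
      have "extension b d g \<cdot> extension a b f \<cdot> fill a j u = extension b d g \<cdot> fill b j (extension a b f \<cdot> u)"
        using Cmp_assoc[OF fill(1)[OF ab(1) j u] E(2) E'(2)] E(1) j u unfolding preserves_def by simp
      also have "\<dots> = fill d j (extension b d g \<cdot> (extension a b f \<cdot> u))"
        using E'(1) j Cmp_hom[OF u E(2)] unfolding preserves_def by blast
      finally show "extension b d g \<cdot> extension a b f \<cdot> fill a j u = fill d j (extension b d g \<cdot> extension a b f \<cdot> u)"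
        using Cmp_assoc[OF u E(2) E'(2)] by simp
    qed
    show "extension b d g \<cdot> extension a b f \<cdot> c a z = extension a d (extension b d g \<cdot> f) \<cdot> c a z"
      using Cmp_assoc[OF unit[OF ab(1)] E(2) E'(2)] E(3) E''(3) by simp
  qed
next
  fix a assume a: "a \<in> Obj C"
  have ca: "c a z \<in> hom C a (L a)" using c_hom[OF a z(1)] zero[OF a] by simp
  note E = extension[OF a a ca]
  show "extension a a (c a z) = Ide C (L a)"
  proof (rule extension_unique[OF a a E(1)])
    show "preserves a a (Ide C (L a))"
      unfolding preserves_def using Ide_hom[OF L_Obj[OF a]] Cmp_Ide_left fill(1)[OF a] by metis
    show "extension a a (c a z) \<cdot> c a z = Ide C (L a) \<cdot> c a z" using E(3) Cmp_Ide_left[OF ca] by simp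
  qed
qed

text \<open>The chosen filler solves the upper triangle, and terminality the lower one.\<close>

lemma terminal_lift:
  assumes y: "y \<in> Obj C" and j: "j \<in> J" and p: "p \<in> hom C (L y) \<tau>"
  shows "has_lift C j p"
proof -
  have d: "Dom C p = L y" "Cod C p = \<tau>" using p by (auto simp: hom_def)
  have "p \<cdot> fill y j u = v" if "u \<in> hom C (Dom C j) (L y)" "v \<in> hom C (Cod C j) \<tau>" for u v
    using terminal_eq[OF terminal Cmp_hom[OF fill(1)[OF y j that(1)] p] that(2)] .
  then show ?thesis unfolding has_lift_def d using fill[OF y j] by blast
qed

end

section \<open>Fibrant-replacement triples\<close>

text \<open>An infinite cardinal is a limit ordinal, so every stage of a tower indexed by it has a
  successor at which cells of that stage are attached.\<close>

lemma infinite_regular_cardinal: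
  assumes "regular_cardinal l"
  shows "Well_order l" "Field l \<noteq> {}" "\<And>b. b \<in> Field l \<Longrightarrow> \<exists>s. is_succ l b s"
proof -
  have co: "Card_order l" and inf: "infinite (Field l)"
    using assms unfolding regular_cardinal_def cinfinite_def by auto
  show wo: "Well_order l" using co by (simp add: card_order_on_well_order_on)
  show "Field l \<noteq> {}" using inf by auto
  show "\<exists>s. is_succ l b s" if b: "b \<in> Field l" for b
  proof -
    obtain d where "d \<in> Field l" "b \<noteq> d" "(b, d) \<in> l"
      using infinite_Card_order_limit[OF co inf b] by blast
    then show ?thesis using succ_exists[OF wo] by metis
  qed
qed

lemma small_Field:
  assumes "regular_cardinal l" "l <o \<kappa>"
  shows "small \<kappa> (Field l)"
  using assms card_of_Field_ordIso ordIso_ordLess_trans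
  unfolding small_def regular_cardinal_def by blast

text \<open>The colimit of the empty diagram. For the opposite category it yields a terminal
  object.\<close>

lemma initial_exists:
  fixes \<kappa> :: "'u rel"
  assumes "category C" "regular_cardinal \<kappa>" "cocomplete \<kappa> C"
  obtains i where "i \<in> Obj C" "\<And>a. a \<in> Obj C \<Longrightarrow> \<exists>!f. f \<in> hom C i a"
proof -
  interpret category C by fact
  define D where "D = \<lparr>OMap = (\<lambda>_::'u. undefined :: 'a), AMap = (\<lambda>_::'u \<times> 'u. undefined :: 'b)\<rparr>"
  have "is_functor (ord_cat ({} :: 'u rel)) C D"
    by (subst is_functor_ord_cat) (auto simp: refl_on_def trans_def)
  moreover have "small \<kappa> (Arr (ord_cat ({} :: 'u rel)))" by (simp add: small_finite[OF assms(2)])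
  ultimately obtain i c where col: "is_colimit (ord_cat ({} :: 'u rel)) C D i c"
    using cocomplete_colimit[OF assms(3)] by blast
  have "\<exists>!f. f \<in> hom C i a" if "a \<in> Obj C" for a
  proof -
    have "is_cocone (ord_cat ({} :: 'u rel)) C D a c" using that unfolding is_cocone_ord_cat by simp
    then have "\<exists>!f. f \<in> hom C i a \<and> (\<forall>j \<in> Obj (ord_cat ({} :: 'u rel)). f \<cdot>\<^bsub>C\<^esub> c j = c j)"
      using col unfolding is_colimit_def by blast
    then show ?thesis by simp
  qed
  moreover have "i \<in> Obj C" using is_colimit_cocone[OF col] by (simp add: is_cocone_def)
  ultimately show ?thesis using that by blast
qed

section \<open>The opposite model category\<close>

lemma op_model_simps [simp]:
  "Obj (op_model M) = Obj M" "Arr (op_model M) = Arr M" "Dom (op_model M) f = Cod M f" "Cod (op_model M) f = Dom M f"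
  "Ide (op_model M) a = Ide M a" "g \<cdot>\<^bsub>op_model M\<^esub> f = f \<cdot>\<^bsub>M\<^esub> g"
  "Weq (op_model M) = Weq M" "Cof (op_model M) = Fib M" "Fib (op_model M) = Cof M"
  by (simp_all add: op_model_def op_cat_def)

lemma hom_op_model [simp]: "hom (op_model M) a b = hom M b a"
  by (auto simp: hom_def)

lemma is_retract_op_model:
  assumes "is_retract (op_model M) f g"
  shows "is_retract M f g"
proof -
  have fg: "f \<in> Arr M" "g \<in> Arr M" using assms by (simp_all add: is_retract_def)
  obtain i j r s where *: "i \<in> hom M (Cod M g) (Cod M f)" "j \<in> hom M (Dom M g) (Dom M f)"
    "r \<in> hom M (Cod M f) (Cod M g)" "s \<in> hom M (Dom M f) (Dom M g)"
    "f \<cdot>\<^bsub>M\<^esub> j = i \<cdot>\<^bsub>M\<^esub> g" "g \<cdot>\<^bsub>M\<^esub> s = r \<cdot>\<^bsub>M\<^esub> f" "i \<cdot>\<^bsub>M\<^esub> r = Ide M (Cod M f)" "j \<cdot>\<^bsub>M\<^esub> s = Ide M (Dom M f)"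
    using assms unfolding is_retract_def op_model_simps hom_op_model by (elim conjE bexE) (rule that)
  show ?thesis
    unfolding is_retract_def
  proof (intro conjI)
    show "\<exists>i \<in> hom M (Dom M f) (Dom M g). \<exists>j \<in> hom M (Cod M f) (Cod M g).
      \<exists>r \<in> hom M (Dom M g) (Dom M f). \<exists>s \<in> hom M (Cod M g) (Cod M f).
        j \<cdot>\<^bsub>M\<^esub> f = g \<cdot>\<^bsub>M\<^esub> i \<and> s \<cdot>\<^bsub>M\<^esub> g = f \<cdot>\<^bsub>M\<^esub> r \<and> r \<cdot>\<^bsub>M\<^esub> i = Ide M (Dom M f) \<and> s \<cdot>\<^bsub>M\<^esub> j = Ide M (Cod M f)"
      \<comment> \<open>Reversing arrows exchanges inclusions with retractions and domains with
        codomains, which permutes the four witnesses.\<close>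
      by (rule bexI[of _ s], rule bexI[of _ r], rule bexI[of _ j], rule bexI[of _ i]) (simp_all add: *)
  qed (rule fg)+
qed

lemma is_functor_op_model:
  assumes "is_functor J (op_model M) D" "category M"
  shows "is_functor (op_cat J) M D"
  using assms category.category_op_cat[of J] unfolding is_functor_def by simp

text \<open>The record \<open>op_cat (op_model M)\<close> agrees with \<open>M\<close> in the fields
  of a category but has \<open>Cof\<close> and \<open>Fib\<close> exchanged. Facts must therefore be
  moved between records that share only the categorical fields; \<open>is_colimit_same\<close> and
  \<open>is_triple_same\<close> serve the same end.\<close>

lemma category_cong:
  assumes "category C" "Obj D = Obj C" "Arr D = Arr C" "Dom D = Dom C" "Cod D = Cod C" "Ide D = Ide C" "Cmp D = Cmp C"
  shows "category D"
  using assms unfolding category_def hom_def by simp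

lemma is_colimit_same:
  assumes "is_colimit J C X x c" "Obj D = Obj C" "Arr D = Arr C" "Dom D = Dom C" "Cod D = Cod C" "Ide D = Ide C" "Cmp D = Cmp C"
  shows "is_colimit J D X x c"
proof -
  have cat: "category C \<Longrightarrow> category D" using category_cong assms(2-) by blast
  have "hom D = hom C" by (simp add: fun_eq_iff hom_def assms(2-))
  then show ?thesis using assms cat unfolding is_colimit_def is_functor_def is_cocone_def by simp
qed

lemma model_category_op_model:
  fixes M :: "('o, 'm, 'z) model_cat_scheme" and \<kappa> :: "'u rel"
  assumes "model_category \<kappa> M"
  shows "model_category \<kappa> (op_model M)"
proof -
  interpret model_category \<kappa> M by fact
  have op: "Obj (op_model M) = Obj (op_cat M)" "Arr (op_model M) = Arr (op_cat M)" "Dom (op_model M) = Dom (op_cat M)"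
    "Cod (op_model M) = Cod (op_cat M)" "Ide (op_model M) = Ide (op_cat M)" "Cmp (op_model M) = Cmp (op_cat M)"
    by (simp_all add: fun_eq_iff)
  have cat: "category (op_model M)" using category_cong[OF category_op_cat op] .
  \<comment> \<open>An index category has no further fields, so here double reversal is an equality
    of records.\<close>
  have oo: "op_cat (op_cat J) = J" for J :: "('u, 'u) cat" by (simp add: op_cat_def)
  show ?thesis
  proof (intro model_category.intro model_category_axioms.intro, goal_cases)
    case 1 show ?case by (rule cat)
  next
    case 2 show ?case using classes by simp
  next
    case 3 show ?case using classes by simp
  next
    case 4 show ?case using classes by simp
  next
    case (5 a b) then show ?case using locally_small by simp
  next
    case 6
    show ?case
      unfolding complete_cat_def
    proof (intro allI impI)
      fix J :: "('u, 'u) cat" and D :: "('u, 'u, 'o, 'm) ftor"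
      assume "small \<kappa> (Arr J) \<and> is_functor J (op_model M) D"
      then have "small \<kappa> (Arr (op_cat J))" "is_functor (op_cat J) M D"
        using is_functor_op_model category_axioms by auto
      then obtain x c where "is_colimit (op_cat J) M D x c" using colimits unfolding cocomplete_def by blast
      then have "is_colimit (op_cat J) (op_cat (op_model M)) D x c"
        by (rule is_colimit_same) (simp_all add: fun_eq_iff)
      then show "\<exists>x c. is_limit J (op_model M) D x c" unfolding is_limit_def by blast
    qed
  next
    case 7
    show ?case
      unfolding cocomplete_def
    proof (intro allI impI)
      fix J :: "('u, 'u) cat" and D :: "('u, 'u, 'o, 'm) ftor"
      assume "small \<kappa> (Arr J) \<and> is_functor J (op_model M) D"
      then have "small \<kappa> (Arr (op_cat J))" "is_functor (op_cat J) M D"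
        using is_functor_op_model category_axioms by auto
      then obtain x c where "is_limit (op_cat J) M D x c" using limits unfolding complete_cat_def by blast
      then have "is_colimit J (op_cat M) D x c" unfolding is_limit_def oo .
      then have "is_colimit J (op_model M) D x c" by (rule is_colimit_same) (simp_all add: fun_eq_iff)
      then show "\<exists>x c. is_colimit J (op_model M) D x c" by blast
    qed
  next
    case (8 f a b g d)
    then have "g \<in> hom M d b" "f \<in> hom M b a" by auto
    from two_of_three[OF this] show ?case unfolding op_model_simps by blast
  next
    case (9 f g) then show ?case using retracts[of f g] by (simp add: is_retract_op_model)
  next
    case (10 i p)
    then have lift: "has_lift M p i" using lifting[of p i] by auto
    show ?case
      unfolding has_lift_def op_model_simps hom_op_model
    proof (intro ballI impI)
      fix u v assume "u \<in> hom M (Cod M p) (Cod M i)" "v \<in> hom M (Dom M p) (Dom M i)" "u \<cdot>\<^bsub>M\<^esub> p = i \<cdot>\<^bsub>M\<^esub> v"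
      then obtain h where "h \<in> hom M (Cod M p) (Dom M i)" "h \<cdot>\<^bsub>M\<^esub> p = v" "i \<cdot>\<^bsub>M\<^esub> h = u"
        using has_liftD[OF lift, of v u] by metis
      then show "\<exists>h \<in> hom M (Cod M p) (Dom M i). i \<cdot>\<^bsub>M\<^esub> h = u \<and> h \<cdot>\<^bsub>M\<^esub> p = v" by blast
    qed
  next
    case (11 f a b)
    then obtain x i p where "i \<in> hom M b x" "p \<in> hom M x a" "i \<in> Cof M" "p \<in> Fib M \<inter> Weq M" "f = p \<cdot>\<^bsub>M\<^esub> i"
      using factorization_afib[of f b a] by auto
    then show ?case by auto
  next
    case (12 f a b)
    then obtain x i p where "i \<in> hom M b x" "p \<in> hom M x a" "i \<in> Cof M \<inter> Weq M" "p \<in> Fib M" "f = p \<cdot>\<^bsub>M\<^esub> i"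
      using factorization_acof[of f b a] by auto
    then show ?case by auto
  qed
qed

lemma is_triple_same:
  assumes "is_triple C F \<nu> \<mu>" "Obj D = Obj C" "Arr D = Arr C" "Dom D = Dom C" "Cod D = Cod C" "Ide D = Ide C" "Cmp D = Cmp C"
  shows "is_triple D F \<nu> \<mu>"
proof -
  have cat: "category C \<Longrightarrow> category D" using category_cong assms(2-) by blast
  have "hom D = hom C" by (simp add: fun_eq_iff hom_def assms(2-))
  then show ?thesis using assms cat unfolding is_triple_def is_functor_def is_nat_trans_def by simp
qed

section \<open>The two replacement constructions and the theorem\<close>

lemma cofibrantly_generated_fibrant_replacement:
  fixes \<kappa> :: "'u rel" and M :: "('o, 'm, 'z) model_cat_scheme"
  assumes reg: "regular_cardinal \<kappa>" and M: "model_category \<kappa> M"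
    and gen: "cofibrantly_generated \<kappa> M" and mono: "\<And>f. f \<in> Cof M \<inter> Weq M \<Longrightarrow> monic M f"
  shows "\<exists>F \<nu> \<mu>. fibrant_replacement_triple M F \<nu> \<mu>"
proof -
  interpret model_category \<kappa> M by fact
  interpret op: model_category \<kappa> "op_model M" using model_category_op_model[OF M] .
  obtain J and l :: "'u rel" where smJ: "small \<kappa> J" and J: "J \<subseteq> Cof M \<inter> Weq M"
    and acof: "Cof M \<inter> Weq M = {f. \<exists>g. relative_cell_complex \<kappa> M J g \<and> is_retract M f g}"
    and l: "regular_cardinal l" "l <o \<kappa>"
    and smrel: "\<And>j. j \<in> J \<Longrightarrow> small_relative \<kappa> l M (Cof M \<inter> Weq M) (Dom M j)"
    using gen unfolding cofibrantly_generated_def by (elim exE conjE) (rule that, assumption+, erule (1) bspec)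
  note wo = infinite_regular_cardinal(1)[OF l(1)]
  have JA: "J \<subseteq> Arr M" using J classes by blast
  obtain \<tau> where \<tau>: "\<tau> \<in> Obj M" "\<And>a. a \<in> Obj M \<Longrightarrow> \<exists>!f. f \<in> hom M a \<tau>"
    using initial_exists[OF op.category_axioms reg op.colimits] by auto
  then have term\<tau>: "terminal M \<tau>" unfolding terminal_def by blast
  obtain z where z: "z \<in> Field l" "underS l z = {}"
    using zero_exists[OF wo infinite_regular_cardinal(2)[OF l(1)]] by blast
  \<comment> \<open>With the implication inside the quantifiers the statement is total in
    \<open>y\<close>, and choice yields a family of towers.\<close>
  have "\<exists>X e q x c. y \<in> Obj M \<longrightarrow> is_cell_tower M True l J \<tau> X e q \<and> OMap X z = y \<and> is_colimit (ord_cat l) M X x c" for y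
  proof (cases "y \<in> Obj M")
    case True
    then obtain e0 where "e0 \<in> hom M y \<tau>" using \<tau> by blast
    then obtain X e q x c where "is_cell_tower M True l J \<tau> X e q" "OMap X z = y" "is_colimit (ord_cat l) M X x c"
      using cell_tower_exists[OF colimits reg locally_small wo small_Field[OF l] smJ JA] z by metis
    then show ?thesis by blast
  qed blast
  then obtain X e q L c where tower: "\<And>y. y \<in> Obj M \<Longrightarrow> is_cell_tower M True l J \<tau> (X y) (e y) (q y)"
    and zero: "\<And>y. y \<in> Obj M \<Longrightarrow> OMap (X y) z = y"
    and colimit: "\<And>y. y \<in> Obj M \<Longrightarrow> is_colimit (ord_cat l) M (X y) (L y) (c y)" by metis
  have seq: "is_sequence M l (X y)" if "y \<in> Obj M" for y using tower[OF that] by (simp add: is_cell_tower_def)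
  have step_lift: "has_lift M (AMap (X y) (b, s)) p" if "y \<in> Obj M" "is_succ l b s" "p \<in> Fib M" for y b s p
    using cell_tower_step_lift[OF tower[OF that(1)] _ _ that(2)] that(3) classes(3) lifting J by blast
  \<comment> \<open>Needed at every stage: at \<open>z\<close> it makes the unit a weak equivalence,
    and at all stages it makes the legs monic.\<close>
  have c_acof: "c y b \<in> Cof M \<inter> Weq M" if y: "y \<in> Obj M" and b: "b \<in> Field l" for y b
  proof (rule acofI)
    show "c y b \<in> Arr M" using is_colimit_leg[OF colimit[OF y]] b by (simp add: hom_def)
    show "has_lift M (c y b) p" if "p \<in> Fib M" for p
      using sequence_lift[OF seq[OF y] colimit[OF y] _ step_lift[OF y _ that] b] that classes(3) by blast
  qed
  \<comment> \<open>Smallness of the domains speaks of sequences in the acyclic cofibrations, so the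
    tower has to be one before maps into \<open>L y\<close> can be factored.\<close>
  have seq_in: "is_sequence_in M (Cof M \<inter> Weq M) l (X y)" if y: "y \<in> Obj M" for y
    unfolding is_sequence_in_def
  proof (intro conjI allI impI)
    fix b s assume bs: "is_succ l b s"
    show "AMap (X y) (b, s) \<in> Cof M \<inter> Weq M"
    proof (rule acofI)
      have "AMap (X y) (b, s) \<in> hom M (OMap (X y) b) (OMap (X y) s)"
        using functor_ord_catD(3)[OF wo is_sequenceD(2)[OF seq[OF y]]] is_succD(1)[OF wo bs] by blast
      then show "AMap (X y) (b, s) \<in> Arr M" by (simp add: hom_def)
    qed (rule step_lift[OF y bs])
  qed (rule seq[OF y])
  interpret free_towers M l J \<tau> z X e q L c
  proof
    fix y j u assume y: "y \<in> Obj M" and j: "j \<in> J" and u: "u \<in> hom M (Dom M j) (L y)"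
    show "\<exists>b \<in> Field l. \<exists>u' \<in> hom M (Dom M j) (OMap (X y) b). u = c y b \<cdot>\<^bsub>M\<^esub> u'"
      using small_relative_factor[OF smrel[OF j] l seq_in[OF y] colimit[OF y] u] by metis
  qed (use wo infinite_regular_cardinal(3)[OF l(1)] z term\<tau> JA tower zero colimit mono c_acof in auto)
  obtain F \<mu> where F: "is_triple M F (\<lambda>y. c y z) \<mu>" "\<And>a. OMap F a = L a"
    using kleisli.triple[OF kleisli] by blast
  have "fibrant M (L y)" if y: "y \<in> Obj M" for y
  proof -
    obtain p where p: "p \<in> hom M (L y) \<tau>" using \<tau>(2)[OF L_Obj[OF y]] by blast
    then have pA: "p \<in> Arr M" by (simp add: hom_def)
    \<comment> \<open>The chosen fillers give lifting against \<open>J\<close>; it spreads to cell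
      complexes and their retracts, which are all the acyclic cofibrations.\<close>
    have "p \<in> Fib M"
    proof (rule fibI[OF pA])
      fix i assume "i \<in> Cof M" "i \<in> Weq M"
      then obtain g where "relative_cell_complex \<kappa> M J g" "is_retract M i g" using acof by blast
      then show "has_lift M i p"
        using retract_lift[OF _ relative_cell_complex_lift[OF _ pA terminal_lift[OF y _ p]] pA] by blast
    qed
    then show ?thesis unfolding fibrant_def using L_Obj[OF y] term\<tau> p by blast
  qed
  then have "fibrant_replacement_triple M F (\<lambda>y. c y z) \<mu>"
    unfolding fibrant_replacement_triple_def F(2) using F(1) c_acof z(1) by blast
  then show ?thesis by blast
qed

text \<open>Cofibrancy is phrased as a cofibration out of a named initial object, which reversal
  turns literally into a fibration to a terminal object.\<close>

lemma cofibrantly_generated_cofibrant_replacement: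
  fixes \<kappa> :: "'u rel" and M :: "('o, 'm, 'z) model_cat_scheme"
  assumes reg: "regular_cardinal \<kappa>" and M: "model_category \<kappa> M" and gen: "cofibrantly_generated \<kappa> M"
  obtains F \<nu> \<mu> i where "is_triple (op_cat M) F \<nu> \<mu>" "\<And>a. a \<in> Obj M \<Longrightarrow> \<nu> a \<in> Weq M"
    "i \<in> Obj M" "\<And>a. a \<in> Obj M \<Longrightarrow> \<exists>!f. f \<in> hom M i a"
    "\<And>a. a \<in> Obj M \<Longrightarrow> OMap F a \<in> Obj M \<and> (\<exists>f \<in> hom M i (OMap F a). f \<in> Cof M)"
proof -
  interpret model_category \<kappa> M by fact
  obtain G and l :: "'u rel" where smG: "small \<kappa> G" and G: "G \<subseteq> Cof M"
    and cof: "Cof M = {f. \<exists>g. relative_cell_complex \<kappa> M G g \<and> is_retract M f g}"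
    and l: "regular_cardinal l" "l <o \<kappa>"
    and smrel: "\<And>i. i \<in> G \<Longrightarrow> small_relative \<kappa> l M (Cof M) (Dom M i)"
    using gen unfolding cofibrantly_generated_def by (elim exE conjE) (rule that, assumption+, erule (1) bspec)
  note wo = infinite_regular_cardinal(1)[OF l(1)]
  have GA: "G \<subseteq> Arr M" using G classes by blast
  obtain i where i: "i \<in> Obj M" "\<And>a. a \<in> Obj M \<Longrightarrow> \<exists>!f. f \<in> hom M i a"
    using initial_exists[OF category_axioms reg colimits] by auto
  obtain z where z: "z \<in> Field l" "underS l z = {}"
    using zero_exists[OF wo infinite_regular_cardinal(2)[OF l(1)]] by blast
  have "\<exists>X e q x c. y \<in> Obj M \<longrightarrow> is_cell_tower M False l G y X e q \<and> OMap X z = i \<and> is_colimit (ord_cat l) M X x c" for y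
  proof (cases "y \<in> Obj M")
    case True
    then obtain e0 where "e0 \<in> hom M i y" using i by blast
    then obtain X e q x c where "is_cell_tower M False l G y X e q" "OMap X z = i" "is_colimit (ord_cat l) M X x c"
      using cell_tower_exists[OF colimits reg locally_small wo small_Field[OF l] smG GA] z by metis
    then show ?thesis by blast
  qed blast
  then obtain X e q L c where tower: "\<And>y. y \<in> Obj M \<Longrightarrow> is_cell_tower M False l G y (X y) (e y) (q y)"
    and zero: "\<And>y. y \<in> Obj M \<Longrightarrow> OMap (X y) z = i"
    and colimit: "\<And>y. y \<in> Obj M \<Longrightarrow> is_colimit (ord_cat l) M (X y) (L y) (c y)" by metis
  have seq: "is_sequence M l (X y)" if "y \<in> Obj M" for y using tower[OF that] by (simp add: is_cell_tower_def)
  have step_lift: "has_lift M (AMap (X y) (b, s)) p" if "y \<in> Obj M" "is_succ l b s" "p \<in> Fib M" "p \<in> Weq M" for y b s p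
    using cell_tower_step_lift[OF tower[OF that(1)] _ _ that(2)] that(3,4) classes(3) lifting G by blast
  have c_cof: "c y z \<in> Cof M" if y: "y \<in> Obj M" for y
  proof (rule cofI)
    show "c y z \<in> Arr M" using is_colimit_leg[OF colimit[OF y]] z by (simp add: hom_def)
    show "has_lift M (c y z) p" if "p \<in> Fib M" "p \<in> Weq M" for p
      using sequence_lift[OF seq[OF y] colimit[OF y] _ step_lift[OF y _ that] z(1)] that classes(3) by blast
  qed
  have seq_in: "is_sequence_in M (Cof M) l (X y)" if y: "y \<in> Obj M" for y
    unfolding is_sequence_in_def
  proof (intro conjI allI impI)
    fix b s assume bs: "is_succ l b s"
    show "AMap (X y) (b, s) \<in> Cof M"
    proof (rule cofI)
      have "AMap (X y) (b, s) \<in> hom M (OMap (X y) b) (OMap (X y) s)"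
        using functor_ord_catD(3)[OF wo is_sequenceD(2)[OF seq[OF y]]] is_succD(1)[OF wo bs] by blast
      then show "AMap (X y) (b, s) \<in> Arr M" by (simp add: hom_def)
    qed (rule step_lift[OF y bs])
  qed (rule seq[OF y])
  have zero': "OMap (X y) z' = i" if "y \<in> Obj M" "z' \<in> Field l" "underS l z' = {}" for y z'
    using zero[OF that(1)] zero_unique[OF wo z that(2,3)] by simp
  interpret cofibrant_towers M l G i X e q L c
    by unfold_locales (use wo infinite_regular_cardinal(3)[OF l(1)] i tower zero' colimit in auto)
  obtain F \<mu> where F: "is_triple (op_cat M) F counit \<mu>" "\<And>a. OMap F a = L a"
    using kleisli.triple[OF kleisli_op_cat] by blast
  have "counit y \<in> Weq M" if y: "y \<in> Obj M" for y
  proof -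
    have A: "counit y \<in> Arr M" using counit(1)[OF y] by (simp add: hom_def)
    have lift: "has_lift M j (counit y)" if j: "j \<in> G" for j
      using counit_lift[OF y j] small_relative_factor[OF smrel[OF j] l seq_in[OF y] colimit[OF y]] by metis
    \<comment> \<open>Lifting against the generators spreads to all cofibrations, so the counit is
      even an acyclic fibration.\<close>
    have "counit y \<in> Fib M \<inter> Weq M"
    proof (rule afibI[OF A])
      fix k assume "k \<in> Cof M"
      then obtain g where "relative_cell_complex \<kappa> M G g" "is_retract M k g" using cof by blast
      then show "has_lift M k (counit y)"
        using retract_lift[OF _ relative_cell_complex_lift[OF _ A lift] A] by blast
    qed
    then show ?thesis by blast
  qed
  moreover have "L y \<in> Obj M \<and> (\<exists>f \<in> hom M i (L y). f \<in> Cof M)" if y: "y \<in> Obj M" for y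
    using L_Obj[OF y] c_hom[OF y z(1)] zero'[OF y z] c_cof[OF y] by auto
  ultimately show ?thesis using that[of F counit \<mu> i] F i by simp
qed

theorem theorem3p4:
  fixes \<kappa> :: "'u rel" and M :: "('o, 'm) model_cat"
  assumes "regular_cardinal \<kappa>"
    and "model_category \<kappa> M"
    and "fibrantly_generated \<kappa> M \<or>
      (cofibrantly_generated \<kappa> M \<and> (\<forall>f \<in> Cof M \<inter> Weq M. monic M f))"
  shows "\<exists>T \<nu> \<mu>. fibrant_replacement_triple M T \<nu> \<mu>"
  using assms(3)
proof
  assume "fibrantly_generated \<kappa> M"
  then have gen: "cofibrantly_generated \<kappa> (op_model M)" by (simp add: fibrantly_generated_def)
  obtain F \<nu> \<mu> t where F: "is_triple (op_cat (op_model M)) F \<nu> \<mu>" and \<nu>: "\<And>a. a \<in> Obj M \<Longrightarrow> \<nu> a \<in> Weq M"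
    and t: "t \<in> Obj M" "\<And>a. a \<in> Obj M \<Longrightarrow> \<exists>!f. f \<in> hom M a t"
    and fib: "\<And>a. a \<in> Obj M \<Longrightarrow> OMap F a \<in> Obj M \<and> (\<exists>f \<in> hom M (OMap F a) t. f \<in> Fib M)"
    using cofibrantly_generated_cofibrant_replacement[OF assms(1) model_category_op_model[OF assms(2)] gen]
    unfolding op_model_simps hom_op_model by metis
  \<comment> \<open>Reversing twice restores the category, and a triple does not mention the
    exchanged classes \<open>Cof\<close> and \<open>Fib\<close>.\<close>
  have "is_triple M F \<nu> \<mu>" using F by (rule is_triple_same) (simp_all add: fun_eq_iff)
  moreover have "terminal M t" using t by (simp add: terminal_def)
  ultimately show ?thesis
    unfolding fibrant_replacement_triple_def fibrant_def using \<nu> fib by blast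
next
  assume "cofibrantly_generated \<kappa> M \<and> (\<forall>f \<in> Cof M \<inter> Weq M. monic M f)"
  then show ?thesis using cofibrantly_generated_fibrant_replacement[OF assms(1,2)] by blast
qed

end
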